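(* Let $B=B_1\cup B_2\cup B_3$ be a 3C-curve of degree $b\geq 4$, with $b_i=\deg B_i$ and $b_1\leq b_2\leq b_3$, and let $N=\bigcup_{i\neq j}B_i\cap B_j$. (a) If $b=4$ then $|\mathrm{Hyp}_1(B,2)|=10$. More precisely, $C\in\mathrm{Hyp}_1(B,2)$ if and only if $C$ is one of the four lines through two distinct points of $B_3\cap(B_1\cup B_2)$ different from $B_1$ and $B_2$, or $C$ is one of the six lines tangent to $B_3$ and passing through a point of $N$. (b) If $b\geq 5$ then $\mathrm{Hyp}_1(B,2)$ is finite, and it is empty if $B$ is general. More precisely, if $b_1=b_2=1$ then $|\mathrm{Hyp}_1(B,2)|\leq 3b_3(b_3-2)$, and $|\mathrm{Hyp}_1(B,2)|\leq 2|N|$ otherwise.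
   Context: We work over $\mathbb{C}$; a curve is integral if it is reduced and irreducible. A 3C-curve is a reduced plane curve $B=B_1\cup B_2\cup B_3\subset\mathbb{P}^2$ with each $B_i$ integral of degree $b_i\geq 1$, such that for all $i\neq j$ every point of $B_i\cap B_j$ is a node of $B$ (so the components meet only pairwise and transversally); one always assumes $b_1\leq b_2\leq b_3$. For an integral plane curve $C$ let $\nu_C:C^\nu\to C$ be its normalization, and set $$\mathrm{Hyp}_d(B,2)=\{C\subset\mathbb{P}^2:\ C\text{ integral},\ \deg C=d,\ |\nu_C^{-1}(C\cap B)|\leq 2\}.$$ "$B$ is general" means: for each fixed triple of degrees $(b_1,b_2,b_3)$, the curve $B$ varies in a suitable open dense subset of the space of triples of plane curves of degrees $(b_1,b_2,b_3)$. *)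

theory Defs
  imports
    "HOL-Analysis.Analysis"
    "HOL-Computational_Algebra.Computational_Algebra"
    "HOL-Algebra.QuotRing"
begin

text \<open>A point of the complex projective plane is the set of its homogeneous coordinate vectors.\<close>

typedef point = "{{c *s v | c. c \<noteq> 0} | v :: complex ^ 3. v \<noteq> 0}"
  morphisms coords Abs_point
proof -
  have "axis 1 1 \<noteq> (0 :: complex ^ 3)"
    by (simp add: axis_eq_0_iff)
  then show ?thesis by blast
qed

text \<open>Polynomials in \<open>\<complex>[x][y][z]\<close>: the outermost variable is \<open>z\<close>.\<close>

type_synonym poly3 = "complex poly poly poly"

definition mcoeff :: "poly3 \<Rightarrow> nat \<Rightarrow> nat \<Rightarrow> nat \<Rightarrow> complex" where
  "mcoeff F i j k = coeff (coeff (coeff F k) j) i"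

definition homogeneous :: "nat \<Rightarrow> poly3 \<Rightarrow> bool" where
  "homogeneous d F \<longleftrightarrow> (\<forall>i j k. mcoeff F i j k \<noteq> 0 \<longrightarrow> i + j + k = d)"

definition eval3 :: "poly3 \<Rightarrow> complex ^ 3 \<Rightarrow> complex" where
  "eval3 F v = poly (poly (poly F [:[:v $ 3:]:]) [:v $ 2:]) (v $ 1)"

text \<open>The univariate polynomial \<open>F (v + t w)\<close> in \<open>t\<close>.\<close>

definition along :: "poly3 \<Rightarrow> complex ^ 3 \<Rightarrow> complex ^ 3 \<Rightarrow> complex poly" where
  "along F v w =
     poly (map_poly (\<lambda>g. poly (map_poly (\<lambda>h. pcompose h [:v $ 1, w $ 1:]) g)
       [:v $ 2, w $ 2:]) F) [:v $ 3, w $ 3:]"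

definition zeros :: "poly3 \<Rightarrow> point set" where
  "zeros F = {p. \<forall>v\<in>coords p. eval3 F v = 0}"

text \<open>An integral curve is identified with its set of points.\<close>

definition integral_curve :: "nat \<Rightarrow> point set \<Rightarrow> bool" where
  "integral_curve d C \<longleftrightarrow> (\<exists>F. homogeneous d F \<and> irreducible F \<and> C = zeros F)"

abbreviation is_line :: "point set \<Rightarrow> bool" where
  "is_line \<equiv> integral_curve 1"

definition smooth_point :: "poly3 \<Rightarrow> point \<Rightarrow> bool" where
  "smooth_point F p \<longleftrightarrow>
     p \<in> zeros F \<and> (\<forall>v\<in>coords p. \<exists>w. coeff (along F v w) 1 \<noteq> 0)"

definition tangent_line :: "poly3 \<Rightarrow> point \<Rightarrow> point set" where
  "tangent_line F p = {q. \<forall>v\<in>coords p. \<forall>w\<in>coords q. coeff (along F v w) 1 = 0}"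

text \<open>Ordinary double point: the multiplicity is 2 and the tangent cone, given by the quadratic
  term of \<open>F (v + t w)\<close> as a function of \<open>w\<close>, is a pair of distinct lines.\<close>

definition node :: "poly3 \<Rightarrow> point \<Rightarrow> bool" where
  "node F p \<longleftrightarrow>
     (\<forall>v\<in>coords p.
        (\<forall>w. coeff (along F v w) 0 = 0 \<and> coeff (along F v w) 1 = 0) \<and>
        (\<exists>a b :: complex ^ 3. a \<noteq> b \<and> vec.independent {a, b} \<and>
           (\<forall>w. coeff (along F v w) 2 = (\<Sum>i\<in>UNIV. a $ i * w $ i) * (\<Sum>i\<in>UNIV. b $ i * w $ i))))"

text \<open>The function field of an integral curve \<open>C\<close> is the residue field of the plane at the generic
  point of \<open>C\<close>: quotients of forms of equal degree whose denominator does not vanish identically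
  on \<open>C\<close>, modulo those whose numerator does.\<close>

definition generic_ring :: "point set \<Rightarrow> poly3 fract ring" where
  "generic_ring C =
     \<lparr>carrier = {Fract G H | G H d. homogeneous d G \<and> homogeneous d H \<and> \<not> C \<subseteq> zeros H},
      mult = (*), one = 1, zero = 0, add = (+)\<rparr>"

definition generic_ideal :: "point set \<Rightarrow> poly3 fract set" where
  "generic_ideal C =
     {Fract G H | G H d. homogeneous d G \<and> homogeneous d H \<and> \<not> C \<subseteq> zeros H \<and> C \<subseteq> zeros G}"

definition function_field :: "point set \<Rightarrow> poly3 fract set ring" where
  "function_field C = generic_ring C Quot generic_ideal C"

definition local_ring :: "point set \<Rightarrow> point \<Rightarrow> poly3 fract set set" where
  "local_ring C p =
     {generic_ideal C +>\<^bsub>generic_ring C\<^esub> Fract G H | G H d.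
        homogeneous d G \<and> homogeneous d H \<and> p \<notin> zeros H}"

definition integral_closure :: "('a, 'm) ring_scheme \<Rightarrow> 'a set \<Rightarrow> 'a set" where
  "integral_closure K A =
     {x \<in> carrier K. \<exists>n a. a \<in> {..<n::nat} \<rightarrow> A \<and>
        x [^]\<^bsub>K\<^esub> n \<oplus>\<^bsub>K\<^esub> (\<Oplus>\<^bsub>K\<^esub>i\<in>{..<n}. a i \<otimes>\<^bsub>K\<^esub> x [^]\<^bsub>K\<^esub> i) = \<zero>\<^bsub>K\<^esub>}"

text \<open>Over \<open>Spec\<close> of the local ring at \<open>p\<close>, the normalization is \<open>Spec\<close> of the integral closure of
  that ring in the function field; so the points over \<open>p\<close> are the maximal ideals of the latter.\<close>

definition normalization_fibre :: "point set \<Rightarrow> point \<Rightarrow> poly3 fract set set set" where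
  "normalization_fibre C p =
     {M. maximalideal M
           (function_field C\<lparr>carrier := integral_closure (function_field C) (local_ring C p)\<rparr>)}"

definition normalization_preimage ::
    "point set \<Rightarrow> point set \<Rightarrow> (point \<times> poly3 fract set set) set" where
  "normalization_preimage C S = Sigma (C \<inter> S) (normalization_fibre C)"

definition Hyp :: "nat \<Rightarrow> point set \<Rightarrow> nat \<Rightarrow> point set set" where
  "Hyp d B m = {C. integral_curve d C \<and>
     finite (normalization_preimage C B) \<and> card (normalization_preimage C B) \<le> m}"

definition union3 :: "poly3 \<Rightarrow> poly3 \<Rightarrow> poly3 \<Rightarrow> point set" where
  "union3 F1 F2 F3 = zeros F1 \<union> zeros F2 \<union> zeros F3"

definition crossings :: "poly3 \<Rightarrow> poly3 \<Rightarrow> poly3 \<Rightarrow> point set" where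
  "crossings F1 F2 F3 =
     (zeros F1 \<inter> zeros F2) \<union> (zeros F1 \<inter> zeros F3) \<union> (zeros F2 \<inter> zeros F3)"

text \<open>The curve is given by equations \<open>F1\<close>, \<open>F2\<close>, \<open>F3\<close> of its components.\<close>

definition three_C_curve :: "nat \<Rightarrow> nat \<Rightarrow> nat \<Rightarrow> poly3 \<Rightarrow> poly3 \<Rightarrow> poly3 \<Rightarrow> bool" where
  "three_C_curve b1 b2 b3 F1 F2 F3 \<longleftrightarrow>
     homogeneous b1 F1 \<and> homogeneous b2 F2 \<and> homogeneous b3 F3 \<and>
     irreducible F1 \<and> irreducible F2 \<and> irreducible F3 \<and>
     squarefree (F1 * F2 * F3) \<and>
     (\<forall>p\<in>crossings F1 F2 F3. node (F1 * F2 * F3) p)"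

text \<open>Plane curves of degree \<open>d\<close>, possibly reducible or non-reduced, are nonzero forms of degree
  \<open>d\<close> up to scalars. The open sets below are those of the product of the three projective spaces
  of forms, pulled back to triples of nonzero forms; they are stable under rescaling each form.\<close>

definition triples :: "nat \<Rightarrow> nat \<Rightarrow> nat \<Rightarrow> (poly3 \<times> poly3 \<times> poly3) set" where
  "triples b1 b2 b3 =
     {F. homogeneous b1 F \<and> F \<noteq> 0} \<times> {F. homogeneous b2 F \<and> F \<noteq> 0} \<times>
     {F. homogeneous b3 F \<and> F \<noteq> 0}"

inductive_set coeff_polys :: "(poly3 \<times> poly3 \<times> poly3 \<Rightarrow> complex) set" where
  const: "(\<lambda>_. c) \<in> coeff_polys"
| coeff1: "(\<lambda>(F1, F2, F3). mcoeff F1 i j k) \<in> coeff_polys"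
| coeff2: "(\<lambda>(F1, F2, F3). mcoeff F2 i j k) \<in> coeff_polys"
| coeff3: "(\<lambda>(F1, F2, F3). mcoeff F3 i j k) \<in> coeff_polys"
| add: "P \<in> coeff_polys \<Longrightarrow> Q \<in> coeff_polys \<Longrightarrow> (\<lambda>T. P T + Q T) \<in> coeff_polys"
| mult: "P \<in> coeff_polys \<Longrightarrow> Q \<in> coeff_polys \<Longrightarrow> (\<lambda>T. P T * Q T) \<in> coeff_polys"

definition multihomogeneous :: "(poly3 \<times> poly3 \<times> poly3 \<Rightarrow> complex) \<Rightarrow> bool" where
  "multihomogeneous P \<longleftrightarrow>
     (\<exists>l m n. \<forall>r s t F1 F2 F3.
        P (smult [:[:r:]:] F1, smult [:[:s:]:] F2, smult [:[:t:]:] F3) =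
          r ^ l * s ^ m * t ^ n * P (F1, F2, F3))"

definition zariski_triples :: "nat \<Rightarrow> nat \<Rightarrow> nat \<Rightarrow> (poly3 \<times> poly3 \<times> poly3) topology" where
  "zariski_triples b1 b2 b3 =
     topology_generated_by
       {{T \<in> triples b1 b2 b3. P T \<noteq> 0} | P. P \<in> coeff_polys \<and> multihomogeneous P}"

definition open_dense :: "'a topology \<Rightarrow> 'a set \<Rightarrow> bool" where
  "open_dense X U \<longleftrightarrow> openin X U \<and> X closure_of U = topspace X"

end

theory Submission
  imports Defs "HOL-Computational_Algebra.Field_as_Ring"
begin

no_notation fps_nth (infixl "$" 75)

text \<open>
  A line is its own normalization: restricting rational functions to \<open>v + t w\<close> identifies its function
  field with \<open>\<complex>(t)\<close> and its local ring at \<open>v\<close> with the valuation ring of rational functions regular at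
  \<open>0\<close>. So there is one point over each point of the line, and \<open>Hyp 1 B 2\<close> consists of the lines that meet
  \<open>B\<close> in at most two points.

  No point lies on all three components, and a line meets each of them. Hence a line that meets \<open>B\<close> in at most
  two points meets \<open>B\<^sub>2\<close> or \<open>B\<^sub>3\<close> in a single point, which also lies on another component. If that
  curve has degree at least 2, the line is its tangent at a point of \<open>N\<close>, and each point of \<open>N\<close> has two
  tangents. If \<open>B\<^sub>1\<close> and \<open>B\<^sub>2\<close> are lines, a line that avoids their common point \<open>o\<close> meets
  \<open>B\<^sub>3\<close> only at points of \<open>B\<^sub>1 \<union> B\<^sub>2\<close> and is tangent to \<open>B\<^sub>3\<close> at one of them
  (or, for a conic, is a chord); a line through \<open>o\<close> meets \<open>B\<^sub>3\<close> in a single point, which lies on the polar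
  line of \<open>o\<close>, so there are at most \<open>b\<^sub>3\<close> of the latter.

  For the generic statement, the forms of a triple restrict to multiples of \<open>s ^ m * t ^ (b\<^sub>i - m)\<close> on a line
  that meets it in at most two points. Such triples depend on 4 parameters for the two points, 3 scalars, and
  forms of degree \<open>b\<^sub>i - 1\<close>; these are \<open>b - 4\<close> fewer than the coefficients of a triple, so the
  coefficients satisfy a nontrivial polynomial relation.
\<close>

subsection \<open>Polynomials in three variables\<close>

text \<open>All geometry of lines is read off the coefficients of \<open>F (v + t w)\<close>. The
  two points where a line may meet the curve are put at \<open>t = 0\<close> and
  \<open>t = \<infinity>\<close>; the restriction is then a monomial, and its missing coefficients
  are the equations of tangents and polars. The node condition enters through the quadratic term.
  Where two factors vanish, this term is the product of their differentials and the value of the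
  third factor. It is zero at a triple point and a multiple of a square at a tangency, while a node
  asks for a product of two independent forms. The bound by 2|N| requires N to be finite, which
  comes from eliminating one variable. For two lines and a curve of degree b3 the count gives 2 b3 +
  b3 lines, and this is at most 3 b3 (b3 - 2) because b3 >= 3. In the generic statement, a form of
  degree b_i has b_i + 1 more coefficients than a form of degree b_i - 1, in total b + 3 more,
  against 7 extra parameters. A relation follows by comparing numbers of monomials.\<close>

definition const3 :: "complex \<Rightarrow> poly3" where "const3 c = [:[:[:c:]:]:]"

definition var3 :: "3 \<Rightarrow> poly3" where
  "var3 i = (if i = 1 then [:[:[:0, 1:]:]:] else if i = 2 then [:[:0, 1:]:] else [:0, 1:])"

definition mono3 :: "nat \<Rightarrow> nat \<Rightarrow> nat \<Rightarrow> complex \<Rightarrow> poly3" where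
  "mono3 i j k c = monom (monom (monom c i) j) k"

lemma three_cases: "(i::3) = 1 \<or> i = 2 \<or> i = 3"
  by (metis exhaust_3)

lemma three_distinct [simp]: "(1::3) \<noteq> 2" "(1::3) \<noteq> 3" "(2::3) \<noteq> 3" "(2::3) \<noteq> 1" "(3::3) \<noteq> 1" "(3::3) \<noteq> 2"
  by simp_all

lemma third_index: "i \<noteq> j \<Longrightarrow> \<exists>k. k \<noteq> i \<and> k \<noteq> j" for i j :: 3
  using three_cases[of i] three_cases[of j] by (metis three_distinct)

lemma index_cases: "i \<noteq> j \<Longrightarrow> k \<noteq> i \<Longrightarrow> k \<noteq> j \<Longrightarrow> l = i \<or> l = j \<or> l = k" for i j k l :: 3
  using three_cases[of i] three_cases[of j] three_cases[of k] three_cases[of l] by metis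

text \<open>The ring is generated by constants and variables. This makes it possible to prove facts
  about nested polynomials, such as the Leibniz rule, without touching the nesting.\<close>

lemma poly3_induct [case_names const var add mult]:
  fixes F :: poly3
  assumes c: "\<And>c. P (const3 c)" and v: "\<And>i. P (var3 i)"
    and a: "\<And>F G. P F \<Longrightarrow> P G \<Longrightarrow> P (F + G)" and m: "\<And>F G. P F \<Longrightarrow> P G \<Longrightarrow> P (F * G)"
  shows "P F"
proof -
  have h: "P [:[:h:]:]" for h
  proof (induction h)
    case 0
    show ?case using c[of 0] by (simp add: const3_def)
  next
    case (pCons e h)
    have "[:[:pCons e h:]:] = const3 e + var3 1 * [:[:h:]:]" by (simp add: var3_def const3_def)
    then show ?case using a[OF c m[OF v pCons.IH]] by simp
  qed
  have g: "P [:g:]" for g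
  proof (induction g)
    case 0
    show ?case using c[of 0] by (simp add: const3_def)
  next
    case (pCons e g)
    have "[:pCons e g:] = [:[:e:]:] + var3 2 * [:g:]" by (simp add: var3_def)
    then show ?case using a[OF h m[OF v pCons.IH]] by simp
  qed
  show ?thesis
  proof (induction F)
    case 0
    show ?case using c[of 0] by (simp add: const3_def)
  next
    case (pCons e F)
    have "pCons e F = [:e:] + var3 3 * F" by (simp add: var3_def)
    then show ?case using a[OF g m[OF v pCons.IH]] by simp
  qed
qed

section \<open>Evaluation and restriction to a parametrized line\<close>

lemma eval3_add [simp]: "eval3 (F + G) v = eval3 F v + eval3 G v"
  and eval3_mult [simp]: "eval3 (F * G) v = eval3 F v * eval3 G v"
  and eval3_diff [simp]: "eval3 (F - G) v = eval3 F v - eval3 G v"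
  and eval3_zero [simp]: "eval3 0 v = 0"
  and eval3_one [simp]: "eval3 1 v = 1"
  and eval3_const [simp]: "eval3 (const3 c) v = c"
  and eval3_var [simp]: "eval3 (var3 i) v = v $ i"
  using three_cases[of i] by (auto simp: eval3_def var3_def const3_def)

lemma eval3_power [simp]: "eval3 (F ^ n) v = eval3 F v ^ n"
  by (induction n) auto

lemma eval3_sum [simp]: "eval3 (\<Sum>x\<in>A. f x) v = (\<Sum>x\<in>A. eval3 (f x) v)"
  by (induction A rule: infinite_finite_induct) auto

lemma eval3_mono [simp]: "eval3 (mono3 i j k c) v = c * (v $ 1) ^ i * (v $ 2) ^ j * (v $ 3) ^ k"
  by (simp add: eval3_def mono3_def poly_monom mult_ac flip: poly_const_pow)

text \<open>A complex polynomial is determined by its values, so this formula transfers every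
  algebraic law of \<open>eval3\<close> to \<open>along\<close>.\<close>

lemma poly_along: "poly (along F v w) t = eval3 F (v + t *s w)"
proof -
  have 1: "poly (poly (map_poly (\<lambda>h. pcompose h [:v $ 1, w $ 1:]) g) [:v $ 2, w $ 2:]) t
     = poly (poly g [:v $ 2 + t * w $ 2:]) (v $ 1 + t * w $ 1)" for g :: "complex poly poly"
    by (induction g) (simp_all add: map_poly_pCons poly_pcompose algebra_simps)
  show ?thesis
    unfolding along_def eval3_def
    by (induction F) (simp_all add: map_poly_pCons 1 algebra_simps)
qed

lemma poly_ext_complex: "(\<And>t. poly p t = poly q t) \<Longrightarrow> p = (q :: complex poly)"
  by (metis poly_eq_poly_eq_iff ext)

lemma along_add [simp]: "along (F + G) v w = along F v w + along G v w"
  and along_mult [simp]: "along (F * G) v w = along F v w * along G v w"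
  and along_diff [simp]: "along (F - G) v w = along F v w - along G v w"
  and along_zero [simp]: "along 0 v w = 0"
  and along_one [simp]: "along 1 v w = 1"
  and along_const [simp]: "along (const3 c) v w = [:c:]"
  and along_var [simp]: "along (var3 i) v w = [:v $ i, w $ i:]"
  by (rule poly_ext_complex; simp add: poly_along)+

lemma along_power [simp]: "along (F ^ n) v w = along F v w ^ n"
  by (induction n) auto

lemma along_sum [simp]: "along (\<Sum>x\<in>A. f x) v w = (\<Sum>x\<in>A. along (f x) v w)"
  by (induction A rule: infinite_finite_induct) auto

lemma coeff_along_0 [simp]: "coeff (along F v w) 0 = eval3 F v"
  using poly_along[of F v w 0] by (simp add: poly_0_coeff_0)

lemma poly_zero_if_vanishes_on_range:
  fixes p :: "'a::idom poly" and c :: "complex \<Rightarrow> 'a"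
  assumes "inj c" "\<And>y. poly p (c y) = 0"
  shows "p = 0"
proof (rule ccontr)
  assume "p \<noteq> 0"
  then have "finite {x. poly p x = 0}" by (rule poly_roots_finite)
  moreover have "range c \<subseteq> {x. poly p x = 0}" using assms(2) by auto
  ultimately have "finite (range c)" by (rule finite_subset[rotated])
  then show False using assms(1) infinite_UNIV_char_0 finite_imageD by blast
qed

text \<open>The variables are removed one at a time: over an integral domain, a polynomial that
  vanishes at infinitely many constants is zero.\<close>

lemma eval3_eq_0_imp: 
  assumes "\<And>v. eval3 F v = 0" shows "F = 0"
proof (rule poly_zero_if_vanishes_on_range[where c = "\<lambda>z. [:[:z:]:]"])
  fix z
  show "poly F [:[:z:]:] = 0"
  proof (rule poly_zero_if_vanishes_on_range[where c = "\<lambda>y. [:y:]"])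
    fix y
    have "poly (poly (poly F [:[:z:]:]) [:y:]) x = poly 0 x" for x
      using assms[of "vector [x, y, z]"] by (simp add: eval3_def)
    then show "poly (poly F [:[:z:]:]) [:y:] = 0" by (rule poly_ext_complex)
  qed (simp add: inj_on_def)
qed (simp add: inj_on_def)

lemma eval3_ext: "(\<And>v. eval3 F v = eval3 G v) \<Longrightarrow> F = G"
  using eval3_eq_0_imp[of "F - G"] by simp

section \<open>Coefficients and forms\<close>

lemma mcoeff_ext: "(\<And>i j k. mcoeff F i j k = mcoeff G i j k) \<Longrightarrow> F = G"
  by (simp add: mcoeff_def poly_eq_iff)

lemma mcoeff_add [simp]: "mcoeff (F + G) i j k = mcoeff F i j k + mcoeff G i j k"
  and mcoeff_diff [simp]: "mcoeff (F - G) i j k = mcoeff F i j k - mcoeff G i j k"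
  and mcoeff_zero [simp]: "mcoeff 0 i j k = 0"
  by (simp_all add: mcoeff_def)

lemma mcoeff_sum [simp]: "mcoeff (\<Sum>x\<in>A. f x) i j k = (\<Sum>x\<in>A. mcoeff (f x) i j k)"
  by (induction A rule: infinite_finite_induct) auto

lemma mcoeff_mono [simp]:
  "mcoeff (mono3 i j k c) i' j' k' = (if i' = i \<and> j' = j \<and> k' = k then c else 0)"
  by (auto simp: mcoeff_def mono3_def)

lemma mcoeff_const_mult [simp]: "mcoeff (const3 c * F) i j k = c * mcoeff F i j k"
  by (simp add: mcoeff_def const3_def)

lemma mcoeff_smult [simp]: "mcoeff (smult [:[:c:]:] F) i j k = c * mcoeff F i j k"
  by (simp add: mcoeff_def)

lemma mcoeff_var_mult:
  "mcoeff (var3 1 * F) i j k = (if i = 0 then 0 else mcoeff F (i - 1) j k)"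
  "mcoeff (var3 2 * F) i j k = (if j = 0 then 0 else mcoeff F i (j - 1) k)"
  "mcoeff (var3 3 * F) i j k = (if k = 0 then 0 else mcoeff F i j (k - 1))"
  by (auto simp: mcoeff_def var3_def coeff_pCons split: nat.split)

definition idx3 :: "nat \<Rightarrow> (nat \<times> nat \<times> nat) set" where
  "idx3 d = {(i, j, k). i + j + k = d}"

lemma finite_idx3 [simp]: "finite (idx3 d)"
  by (rule finite_subset[of _ "{..d} \<times> {..d} \<times> {..d}"]) (auto simp: idx3_def)

definition form_of :: "nat \<Rightarrow> (nat \<times> nat \<times> nat \<Rightarrow> complex) \<Rightarrow> poly3" where
  "form_of d c = (\<Sum>(i, j, k)\<in>idx3 d. mono3 i j k (c (i, j, k)))"

lemma mcoeff_form_of: "mcoeff (form_of d c) i j k = (if i + j + k = d then c (i, j, k) else 0)"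
proof -
  have "mcoeff (form_of d c) i j k = (\<Sum>x\<in>idx3 d. if x = (i, j, k) then c (i, j, k) else 0)"
    unfolding form_of_def mcoeff_sum by (rule sum.cong) (auto split: prod.splits)
  also have "\<dots> = (if (i, j, k) \<in> idx3 d then c (i, j, k) else 0)" by (rule sum.delta[OF finite_idx3])
  finally show ?thesis by (simp add: idx3_def)
qed

lemma homogeneous_eq_sum:
  assumes "homogeneous d F"
  shows "F = (\<Sum>(i, j, k)\<in>idx3 d. mono3 i j k (mcoeff F i j k))"
proof -
  have "F = form_of d (\<lambda>(i, j, k). mcoeff F i j k)"
    using assms by (intro mcoeff_ext) (auto simp: mcoeff_form_of homogeneous_def)
  then show ?thesis by (simp add: form_of_def)
qed

lemma homogeneous_form_of: "homogeneous d (form_of d c)"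
  by (simp add: homogeneous_def mcoeff_form_of)

lemma homogeneous_0 [simp]: "homogeneous d 0"
  by (simp add: homogeneous_def)

lemma homogeneous_add: "homogeneous d F \<Longrightarrow> homogeneous d G \<Longrightarrow> homogeneous d (F + G)"
  by (auto simp: homogeneous_def) (metis add.right_neutral)

lemma homogeneous_sum: "(\<And>x. x \<in> A \<Longrightarrow> homogeneous d (f x)) \<Longrightarrow> homogeneous d (\<Sum>x\<in>A. f x)"
  by (induction A rule: infinite_finite_induct) (auto intro: homogeneous_add)

lemma homogeneous_mono: "i + j + k = d \<Longrightarrow> homogeneous d (mono3 i j k c)"
  by (auto simp: homogeneous_def)

lemma homogeneous_mult:
  assumes "homogeneous d F" "homogeneous e G"
  shows "homogeneous (d + e) (F * G)"
proof -
  have m: "mono3 i j k a * mono3 i' j' k' b = mono3 (i + i') (j + j') (k + k') (a * b)" for i j k i' j' k' a b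
    by (simp add: mono3_def mult_monom)
  have "F * G = (\<Sum>x\<in>idx3 d. \<Sum>y\<in>idx3 e. (case x of (i, j, k) \<Rightarrow> mono3 i j k (mcoeff F i j k)) *
      (case y of (i, j, k) \<Rightarrow> mono3 i j k (mcoeff G i j k)))"
    by (subst homogeneous_eq_sum[OF assms(1)], subst homogeneous_eq_sum[OF assms(2)]) (simp add: sum_product)
  also have "homogeneous (d + e) \<dots>"
    by (intro homogeneous_sum) (auto simp: m idx3_def intro!: homogeneous_mono)
  finally show ?thesis .
qed

lemma homogeneous_const [simp]: "homogeneous 0 (const3 c)"
  by (auto simp: homogeneous_def mcoeff_def const3_def coeff_pCons split: nat.splits)

lemma const3_1 [simp]: "const3 1 = 1"
  by (simp add: const3_def one_pCons)

lemma homogeneous_one [simp]: "homogeneous 0 1"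
  using homogeneous_const[of 1] by simp

lemma homogeneous_var [simp]: "homogeneous 1 (var3 i)"
  using three_cases[of i] by (auto simp: homogeneous_def mcoeff_def var3_def coeff_pCons split: nat.splits)

lemma homogeneous_power: "homogeneous d F \<Longrightarrow> homogeneous (d * n) (F ^ n)"
  by (induction n) (auto dest: homogeneous_mult)

lemma homogeneous_const_mult: "homogeneous d F \<Longrightarrow> homogeneous d (const3 c * F)"
  by (metis homogeneous_const homogeneous_mult add_0)

lemma homogeneous_diff: "homogeneous d F \<Longrightarrow> homogeneous d G \<Longrightarrow> homogeneous d (F - G)"
  by (auto simp: homogeneous_def) (metis diff_zero)

lemma eval3_scale:
  assumes "homogeneous d F"
  shows "eval3 F (c *s v) = c ^ d * eval3 F v"
  by (subst (1 2) homogeneous_eq_sum[OF assms])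
    (auto simp: sum_distrib_left idx3_def power_mult_distrib power_add intro!: sum.cong)

lemma degree_along_le:
  assumes "homogeneous d F"
  shows "degree (along F v w) \<le> d"
proof -
  have m: "mono3 i j k c = const3 c * var3 1 ^ i * var3 2 ^ j * var3 3 ^ k" for i j k c
    by (rule eval3_ext) simp
  have d: "degree ([:a, b:] ^ n) \<le> n" for a b :: complex and n
    by (rule order.trans[OF degree_power_le]) auto
  show ?thesis
    apply (subst homogeneous_eq_sum[OF assms], unfold along_sum, rule degree_sum_le)
     apply simp
    apply (clarsimp simp: m idx3_def)
    apply (intro order.trans[OF degree_smult_le] order.trans[OF degree_mult_le] add_mono d)
    done
qed

lemma poly_altdef_le: "degree p \<le> n \<Longrightarrow> poly p x = (\<Sum>i\<le>n. coeff p i * x ^ i)"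
  for x :: "'a :: {comm_semiring_0, semiring_1}"
  unfolding poly_altdef by (rule sum.mono_neutral_left) (auto simp: coeff_eq_0)

text \<open>The binary form F(s v + t w) is dehomogenized at either end: F(v + t w) = t^d F(w + v/t)
  for nonzero t. The coefficient of degree 1 at one end is the one of degree d - 1 at the other,
  which links tangents at \<open>v\<close> with polars of \<open>w\<close>.\<close>

lemma coeff_along_swap:
  assumes "homogeneous d F" "i \<le> d"
  shows "coeff (along F v w) i = coeff (along F w v) (d - i)"
proof -
  define q where "q = (\<Sum>i\<le>d. monom (coeff (along F w v) (d - i)) i)"
  have "poly (along F v w - q) t = 0" if "t \<noteq> 0" for t
  proof -
    have e: "v + t *s w = t *s (w + (1 / t) *s v)" using that by (simp add: vec_eq_iff field_simps)
    have "poly (along F v w) t = t ^ d * poly (along F w v) (1 / t)"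
      unfolding poly_along by (subst e) (rule eval3_scale[OF assms(1)])
    also have "\<dots> = t ^ d * (\<Sum>i\<le>d. coeff (along F w v) i * (1 / t) ^ i)"
      by (subst poly_altdef_le[OF degree_along_le[OF assms(1)]]) simp
    also have "\<dots> = (\<Sum>i\<le>d. coeff (along F w v) i * t ^ (d - i))"
      using that by (auto simp: sum_distrib_left power_diff field_simps intro!: sum.cong)
    also have "\<dots> = (\<Sum>i\<le>d. coeff (along F w v) (d - i) * t ^ i)"
      by (rule sum.reindex_bij_witness[of _ "\<lambda>i. d - i" "\<lambda>i. d - i"]) auto
    also have "\<dots> = poly q t" by (simp add: q_def poly_sum poly_monom)
    finally show ?thesis by simp
  qed
  then have "- {0} \<subseteq> {t. poly (along F v w - q) t = 0}" by auto
  moreover have "infinite (- {0 :: complex})" by (simp add: infinite_UNIV_char_0)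
  ultimately have "along F v w - q = 0" using poly_roots_finite finite_subset by blast
  then have "coeff (along F v w) i = coeff q i" by simp
  also have "\<dots> = coeff (along F w v) (d - i)"
    using assms(2) by (simp add: q_def coeff_sum)
  finally show ?thesis .
qed

lemma coeff_along_top:
  assumes "homogeneous d F"
  shows "coeff (along F v w) d = eval3 F w"
  using coeff_along_swap[OF assms, of d v w] by simp

lemma coeff_mult_1: "coeff (p * q) (Suc 0) = coeff p 0 * coeff q 1 + coeff p 1 * coeff q 0"
  by (simp add: coeff_mult)

lemma coeff_mult_2: "coeff (p * q) 2 = coeff p 0 * coeff q 2 + coeff p 1 * coeff q 1 + coeff p 2 * coeff q 0"
  by (simp add: coeff_mult numeral_2_eq_2)

section \<open>First-order terms\<close>

definition grad :: "poly3 \<Rightarrow> complex ^ 3 \<Rightarrow> complex ^ 3" where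
  "grad F v = (\<chi> i. coeff (along F v (axis i 1)) 1)"

definition dot :: "complex ^ 3 \<Rightarrow> complex ^ 3 \<Rightarrow> complex" where
  "dot a w = (\<Sum>i\<in>UNIV. a $ i * w $ i)"

lemma dot_add [simp]: "dot a (v + w) = dot a v + dot a w"
  and dot_scale [simp]: "dot a (c *s v) = c * dot a v"
  and dot_0 [simp]: "dot a 0 = 0"
  by (simp_all add: dot_def sum_3 algebra_simps)

text \<open>The first-order term is linear in \<open>w\<close> on generators, and the Leibniz rule
  passes this on to products; the values at the axis vectors then identify the linear form as
  \<open>grad\<close>.\<close>

lemma coeff_along_1: "coeff (along F v w) (Suc 0) = dot (grad F v) w"
proof -
  have "\<exists>g. \<forall>w. coeff (along F v w) (Suc 0) = dot g w"
  proof (induction F rule: poly3_induct)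
    case (const c)
    have "\<forall>w. coeff (along (const3 c) v w) (Suc 0) = dot 0 w" by (simp add: dot_def)
    then show ?case by blast
  next
    case (var i)
    have "\<forall>w. coeff (along (var3 i) v w) (Suc 0) = dot (axis i 1) w"
      using three_cases[of i] by (auto simp: dot_def axis_def sum_3)
    then show ?case by blast
  next
    case (add F G)
    then obtain f g where "\<forall>w. coeff (along F v w) (Suc 0) = dot f w" "\<forall>w. coeff (along G v w) (Suc 0) = dot g w"
      by blast
    then have "\<forall>w. coeff (along (F + G) v w) (Suc 0) = dot (f + g) w"
      by (simp add: dot_def sum_3 algebra_simps)
    then show ?case by blast
  next
    case (mult F G)
    then obtain f g where "\<forall>w. coeff (along F v w) (Suc 0) = dot f w" "\<forall>w. coeff (along G v w) (Suc 0) = dot g w"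
      by blast
    then have "\<forall>w. coeff (along (F * G) v w) (Suc 0) = dot (eval3 G v *s f + eval3 F v *s g) w"
      by (simp add: dot_def sum_3 coeff_mult_1 algebra_simps)
    then show ?case by blast
  qed
  then obtain g where g: "\<And>w. coeff (along F v w) (Suc 0) = dot g w" by blast
  have "grad F v = g"
    unfolding grad_def vec_eq_iff
  proof 
    fix i :: 3
    show "(\<chi> i. coeff (along F v (axis i 1)) 1) $ i = g $ i"
      using three_cases[of i] by (auto simp: g dot_def axis_def sum_3)
  qed
  then show ?thesis using g by simp
qed

text \<open>Euler's identity, from F((1 + t) v) = (1 + t)^d F(v).\<close>

lemma dot_grad_self:
  assumes "homogeneous d F"
  shows "dot (grad F v) v = of_nat d * eval3 F v"
proof -
  have "along F v v = smult (eval3 F v) ([:1, 1:] ^ d)"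
  proof (rule poly_ext_complex)
    fix t
    have e: "v + t *s v = (1 + t) *s v" by (simp add: vec_eq_iff algebra_simps)
    show "poly (along F v v) t = poly (smult (eval3 F v) ([:1, 1:] ^ d)) t"
      unfolding poly_along e eval3_scale[OF assms] by simp
  qed
  moreover have "coeff ([:1, 1:] ^ d) (Suc 0) = (of_nat d :: complex)"
    by (induction d) (simp_all add: coeff_mult_1 coeff_0_power)
  ultimately show ?thesis by (simp flip: coeff_along_1)
qed

section \<open>Linear forms and divisibility by them\<close>

definition lin :: "complex ^ 3 \<Rightarrow> poly3" where
  "lin a = (\<Sum>i\<in>UNIV. const3 (a $ i) * var3 i)"

lemma eval3_lin [simp]: "eval3 (lin a) v = dot a v"
  by (simp add: lin_def dot_def)

lemma homogeneous_lin [simp]: "homogeneous 1 (lin a)"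
  unfolding lin_def by (intro homogeneous_sum homogeneous_const_mult homogeneous_var)

lemma homogeneous_1_eq_lin:
  assumes "homogeneous 1 F" obtains a where "F = lin a"
proof -
  have "{(i, j, k). i + j + k = (1::nat)} = {(1, 0, 0), (0, 1, 0), (0, 0, 1)}" by auto
  then have i: "idx3 1 = {(1, 0, 0), (0, 1, 0), (0, 0, 1)}" by (simp add: idx3_def)
  have "F = lin (vector [mcoeff F 1 0 0, mcoeff F 0 1 0, mcoeff F 0 0 1])"
    by (rule eval3_ext, subst homogeneous_eq_sum[OF assms]) (simp add: i[simplified] dot_def sum_3)
  then show ?thesis using that by blast
qed

text \<open>Composing with the projection onto the plane \<open>dot a v = 0\<close> along a coordinate axis gives both
  the divisibility criterion and the primality of \<open>lin a\<close>.\<close>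

lemma mod_lin:
  fixes a :: "complex ^ 3"
  assumes "a $ k \<noteq> 0"
  shows "\<exists>F'. lin a dvd F - F' \<and> (\<forall>v. eval3 F' v = eval3 F (v - (dot a v / a $ k) *s axis k 1))"
proof (induction F rule: poly3_induct)
  case (const c)
  show ?case by (intro exI[of _ "const3 c"]) simp
next
  case (var i)
  show ?case
    by (intro exI[of _ "var3 i - const3 ((axis k 1 :: complex ^ 3) $ i / a $ k) * lin a"]) (simp add: field_simps)
next
  case (add F G)
  then obtain F' G' where "lin a dvd F - F'" "\<forall>v. eval3 F' v = eval3 F (v - (dot a v / a $ k) *s axis k 1)"
    "lin a dvd G - G'" "\<forall>v. eval3 G' v = eval3 G (v - (dot a v / a $ k) *s axis k 1)" by blast
  moreover have "F + G - (F' + G') = (F - F') + (G - G')" by simp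
  ultimately show ?case by (intro exI[of _ "F' + G'"]) (metis dvd_add eval3_add)
next
  case (mult F G)
  then obtain F' G' where "lin a dvd F - F'" "\<forall>v. eval3 F' v = eval3 F (v - (dot a v / a $ k) *s axis k 1)"
    "lin a dvd G - G'" "\<forall>v. eval3 G' v = eval3 G (v - (dot a v / a $ k) *s axis k 1)" by blast
  moreover have "F * G - (F' * G') = (F - F') * G' + F * (G - G')" by (simp add: algebra_simps)
  ultimately show ?case by (intro exI[of _ "F' * G'"]) (metis dvd_add eval3_mult dvd_mult dvd_mult2)
qed

lemma dot_axis [simp]: "dot a (axis k c) = a $ k * c"
  using three_cases[of k] by (auto simp: dot_def axis_def sum_3)

lemma dot_diff [simp]: "dot a (v - w) = dot a v - dot a w"
  by (simp add: dot_def sum_3 algebra_simps)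

lemma vec3_nonzero: "a \<noteq> 0 \<Longrightarrow> \<exists>k. a $ k \<noteq> (0 :: complex)" for a :: "complex ^ 3"
  by (metis vec_eq_iff zero_index)

lemma lin_dvd_iff:
  assumes "a \<noteq> 0"
  shows "lin a dvd F \<longleftrightarrow> (\<forall>v. dot a v = 0 \<longrightarrow> eval3 F v = 0)"
proof
  assume "lin a dvd F"
  then show "\<forall>v. dot a v = 0 \<longrightarrow> eval3 F v = 0" by (auto elim!: dvdE)
next
  assume *: "\<forall>v. dot a v = 0 \<longrightarrow> eval3 F v = 0"
  obtain k where k: "a $ k \<noteq> 0" using vec3_nonzero[OF assms] by blast
  obtain F' where F': "lin a dvd F - F'" "\<forall>v. eval3 F' v = eval3 F (v - (dot a v / a $ k) *s axis k 1)"
    using mod_lin[OF k] by blast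
  have "F' = 0" by (rule eval3_eq_0_imp) (use F'(2) * k in simp)
  then show "lin a dvd F" using F' by simp
qed

text \<open>If \<open>lin a\<close> divides a product, the remainders of the two factors have a
  product that vanishes everywhere, since each remainder evaluates its polynomial at a point of the
  plane. As there are no zero divisors, one remainder is zero.\<close>

lemma prime_elem_lin:
  assumes "a \<noteq> 0"
  shows "prime_elem (lin a)"
proof (rule prime_elemI)
  obtain k where k: "a $ k \<noteq> 0" using vec3_nonzero[OF assms] by blast
  then have "eval3 (lin a) (axis k 1) \<noteq> 0" by simp
  then show "lin a \<noteq> 0" by fastforce
  show "\<not> lin a dvd 1"
    using lin_dvd_iff[OF assms, of 1] by (metis dot_0 eval3_one one_neq_zero)
  fix F G assume FG: "lin a dvd F * G"
  obtain F' where F': "lin a dvd F - F'" "\<forall>v. eval3 F' v = eval3 F (v - (dot a v / a $ k) *s axis k 1)"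
    using mod_lin[OF k] by blast
  obtain G' where G': "lin a dvd G - G'" "\<forall>v. eval3 G' v = eval3 G (v - (dot a v / a $ k) *s axis k 1)"
    using mod_lin[OF k] by blast
  have "F' * G' = 0"
    by (rule eval3_eq_0_imp) (use F'(2) G'(2) FG k in \<open>simp add: lin_dvd_iff[OF assms]\<close>)
  then show "lin a dvd F \<or> lin a dvd G" using F' G' by auto
qed

lemma irreducible_lin_iff: "irreducible (lin a) \<longleftrightarrow> a \<noteq> 0"
proof
  assume "irreducible (lin a)"
  moreover have "lin 0 = 0" by (rule eval3_eq_0_imp) (simp add: dot_def)
  ultimately show "a \<noteq> 0" by (metis irreducible_def)
qed (rule prime_elem_imp_irreducible[OF prime_elem_lin])

subsection \<open>Points\<close>

definition proj :: "complex ^ 3 \<Rightarrow> point" where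
  "proj v = Abs_point {c *s v | c. c \<noteq> 0}"

lemma coords_proj: "v \<noteq> 0 \<Longrightarrow> coords (proj v) = {c *s v | c. c \<noteq> 0}"
  unfolding proj_def by (rule Abs_point_inverse) blast

lemma proj_cases [case_names proj]:
  obtains v where "v \<noteq> 0" "p = proj v"
proof -
  obtain v where "v \<noteq> 0" "coords p = {c *s v | c. c \<noteq> 0}" using coords[of p] by blast
  moreover from this have "p = proj v" using coords_inverse[of p] by (simp add: proj_def)
  ultimately show ?thesis using that by blast
qed

lemma proj_scale: "c \<noteq> 0 \<Longrightarrow> proj (c *s v) = proj v"
proof -
  assume c: "c \<noteq> 0"
  have "{d *s (c *s v) | d. d \<noteq> 0} = {d *s v | d. d \<noteq> 0}"
  proof (intro equalityI subsetI)
    fix x assume "x \<in> {d *s v | d. d \<noteq> 0}"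
    then obtain d where "d \<noteq> 0" "x = d *s v" by blast
    then have "x = (d / c) *s (c *s v)" "d / c \<noteq> 0" using c by (auto simp: vec_eq_iff)
    then show "x \<in> {d *s (c *s v) | d. d \<noteq> 0}" by blast
  qed (use c in \<open>auto simp: vec.scale_scale\<close>)
  then show ?thesis by (simp add: proj_def)
qed

lemma proj_eq_iff: "v \<noteq> 0 \<Longrightarrow> w \<noteq> 0 \<Longrightarrow> proj v = proj w \<longleftrightarrow> (\<exists>c. c \<noteq> 0 \<and> w = c *s v)"
proof
  assume v: "v \<noteq> 0" "w \<noteq> 0" "proj v = proj w"
  have "w \<in> {c *s w | c. c \<noteq> 0}" by (rule CollectI, rule exI[of _ 1]) simp
  then have "w \<in> coords (proj v)" using v coords_proj[of w] by simp
  then show "\<exists>c. c \<noteq> 0 \<and> w = c *s v" using v coords_proj[of v] by auto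
qed (auto simp: proj_scale)

lemma proj_in_zeros: "homogeneous d F \<Longrightarrow> v \<noteq> 0 \<Longrightarrow> proj v \<in> zeros F \<longleftrightarrow> eval3 F v = 0"
proof -
  assume "homogeneous d F" "v \<noteq> 0"
  then have "proj v \<in> zeros F \<longleftrightarrow> (\<forall>c. c \<noteq> 0 \<longrightarrow> c ^ d * eval3 F v = 0)"
    by (auto simp: zeros_def coords_proj eval3_scale)
  also have "\<dots> \<longleftrightarrow> eval3 F v = 0" by (auto dest: spec[of _ 1])
  finally show ?thesis .
qed

text \<open>Independence of a pair rather than of the set \<open>{v, w}\<close>, which would
  collapse to a single vector when \<open>v = w\<close>.\<close>

definition indep :: "complex ^ 3 \<Rightarrow> complex ^ 3 \<Rightarrow> bool" where
  "indep v w \<longleftrightarrow> (\<forall>s t. s *s v + t *s w = 0 \<longrightarrow> s = 0 \<and> t = 0)"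

lemma indepD: "indep v w \<Longrightarrow> s *s v + t *s w = 0 \<Longrightarrow> s = 0 \<and> t = 0"
  by (auto simp: indep_def)

lemma indep_sym: "indep v w \<Longrightarrow> indep w v"
  unfolding indep_def by (metis add.commute)

lemma indep_nonzero: "indep v w \<Longrightarrow> v \<noteq> 0" "indep v w \<Longrightarrow> w \<noteq> 0"
  by (auto simp: indep_def dest: spec[of _ 1] spec2[of _ 1 0] spec2[of _ 0 1])

lemma indep_iff_proj: "v \<noteq> 0 \<Longrightarrow> w \<noteq> 0 \<Longrightarrow> indep v w \<longleftrightarrow> proj v \<noteq> proj w"
proof
  assume vw: "v \<noteq> 0" "w \<noteq> 0" and i: "indep v w"
  show "proj v \<noteq> proj w"
  proof
    assume "proj v = proj w"
    then obtain c where "c \<noteq> 0" "w = c *s v" using proj_eq_iff vw by blast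
    then have "c *s v + (-1) *s w = 0" by simp
    from indepD[OF i this] show False by simp
  qed
next
  assume vw: "v \<noteq> 0" "w \<noteq> 0" "proj v \<noteq> proj w"
  show "indep v w"
    unfolding indep_def
  proof (intro allI impI)
    fix s t assume st: "s *s v + t *s w = 0"
    have "t = 0"
    proof (rule ccontr)
      assume t: "t \<noteq> 0"
      have "s * v $ i + t * w $ i = 0" for i using st by (simp add: vec_eq_iff)
      then have "w $ i = (- s / t) * v $ i" for i using t by (simp add: field_simps eq_neg_iff_add_eq_0)
      then have w: "w = (- s / t) *s v" by (simp add: vec_eq_iff)
      then have "- s / t \<noteq> 0" using vw by (metis vec.scale_zero_left)
      then show False using w vw proj_eq_iff by metis
    qed
    then show "s = 0 \<and> t = 0" using st vw by simp
  qed
qed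

lemma indep_minor:
  assumes "indep v w"
  shows "\<exists>i j. i \<noteq> j \<and> v $ i * w $ j - v $ j * w $ i \<noteq> 0"
proof (rule ccontr)
  assume "\<not> ?thesis"
  then have m: "v $ i * w $ j = v $ j * w $ i" for i j by (cases "i = j") auto
  obtain i where i: "v $ i \<noteq> 0" using vec3_nonzero indep_nonzero[OF assms] by blast
  have "w $ i *s v + (- v $ i) *s w = 0" using m by (simp add: vec_eq_iff)
  from indepD[OF assms this] show False using i by simp
qed

text \<open>Cramer's rule on two coordinates with nonzero minor; the axis vector of the remaining
  coordinate completes the basis.\<close>

lemma indep_extend:
  assumes "indep v w"
  obtains e where "\<And>x. \<exists>s t u. x = s *s v + t *s w + u *s e"
proof -
  obtain i j where ij: "i \<noteq> j" and m: "v $ i * w $ j - v $ j * w $ i \<noteq> 0"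
    using indep_minor[OF assms] by blast
  define m where "m = v $ i * w $ j - v $ j * w $ i"
  have m0: "m \<noteq> 0" using m by (simp add: m_def)
  obtain k where k: "k \<noteq> i" "k \<noteq> j" using third_index[OF ij] by blast
  note ijk = index_cases[OF ij k]
  have "\<exists>s t u. x = s *s v + t *s w + u *s axis k 1" for x
  proof (intro exI)
    define s where "s = (x $ i * w $ j - x $ j * w $ i) / m"
    define t where "t = (v $ i * x $ j - v $ j * x $ i) / m"
    have "s * v $ i + t * w $ i = x $ i * m / m" "s * v $ j + t * w $ j = x $ j * m / m"
      unfolding s_def t_def times_divide_eq_left add_divide_distrib[symmetric]
      by (simp_all add: m_def algebra_simps)
    then have i: "x $ i = s * v $ i + t * w $ i" and j: "x $ j = s * v $ j + t * w $ j"
      using m0 by simp_all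
    show "x = s *s v + t *s w + (x $ k - s * v $ k - t * w $ k) *s axis k 1"
      unfolding vec_eq_iff
    proof
      fix l show "x $ l = (s *s v + t *s w + (x $ k - s * v $ k - t * w $ k) *s axis k 1) $ l"
        using ijk[of l] i j k ij by (auto simp: axis_def)
    qed
  qed
  then show ?thesis using that by blast
qed

subsection \<open>Lines\<close>

definition span2 :: "complex ^ 3 \<Rightarrow> complex ^ 3 \<Rightarrow> point set" where
  "span2 v w = {proj (s *s v + t *s w) | s t. s \<noteq> 0 \<or> t \<noteq> 0}"

lemma is_line_iff: "is_line C \<longleftrightarrow> (\<exists>a. a \<noteq> 0 \<and> C = zeros (lin a))"
  by (metis homogeneous_1_eq_lin homogeneous_lin integral_curve_def irreducible_lin_iff)

text \<open>On a basis extending \<open>v\<close>, \<open>w\<close>, the nonzero functional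
  \<open>a\<close> can only be nonzero on the third vector, so the kernel is the span of the first
  two.\<close>

lemma kernel_eq_span:
  assumes "a \<noteq> 0" "indep v w" "dot a v = 0" "dot a w = 0"
  shows "dot a x = 0 \<longleftrightarrow> (\<exists>s t. x = s *s v + t *s w)"
proof
  assume x: "dot a x = 0"
  obtain e where e: "\<And>x. \<exists>s t u. x = s *s v + t *s w + u *s e" using indep_extend[OF assms(2)] by blast
  have "dot a e \<noteq> 0"
  proof
    assume ae: "dot a e = 0"
    have "dot a y = 0" for y
      using e[of y] ae assms by auto
    then have "dot a (axis k 1) = 0" for k by blast
    then have "a = 0" by (simp add: vec_eq_iff)
    then show False using assms by simp
  qed
  obtain s t u where "x = s *s v + t *s w + u *s e" using e by blast
  moreover from this have "u = 0" using x assms \<open>dot a e \<noteq> 0\<close> by simp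
  ultimately show "\<exists>s t. x = s *s v + t *s w" by auto
qed (use assms in auto)

lemma zeros_lin_eq_span2:
  assumes "a \<noteq> 0" "indep v w" "dot a v = 0" "dot a w = 0"
  shows "zeros (lin a) = span2 v w"
proof (intro equalityI subsetI)
  fix p assume p: "p \<in> zeros (lin a)"
  obtain x where x: "x \<noteq> 0" "p = proj x" by (rule proj_cases)
  then have "dot a x = 0" using p proj_in_zeros[OF homogeneous_lin] by auto
  then obtain s t where st: "x = s *s v + t *s w" using kernel_eq_span[OF assms] by blast
  then have "s \<noteq> 0 \<or> t \<noteq> 0" using x by auto
  then show "p \<in> span2 v w" using st x by (auto simp: span2_def)
next
  fix p assume "p \<in> span2 v w"
  then obtain s t where st: "s \<noteq> 0 \<or> t \<noteq> 0" "p = proj (s *s v + t *s w)" by (auto simp: span2_def)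
  have "s *s v + t *s w \<noteq> 0" using assms(2) st by (auto simp: indep_def)
  then show "p \<in> zeros (lin a)" using st assms by (simp add: proj_in_zeros[OF homogeneous_lin])
qed

lemma line_eq_span2:
  assumes "is_line C" "indep v w" "proj v \<in> C" "proj w \<in> C"
  shows "C = span2 v w"
proof -
  obtain a where "a \<noteq> 0" "C = zeros (lin a)" using assms(1) is_line_iff by blast
  then show ?thesis
    using assms zeros_lin_eq_span2[of a v w] indep_nonzero[OF assms(2)]
    by (simp add: proj_in_zeros[OF homogeneous_lin])
qed

lemma ex_normal:
  assumes "indep v w"
  obtains a where "a \<noteq> 0" "dot a v = 0" "dot a w = 0"
proof -
  \<comment> \<open>The cross product, whose entries are the minors up to sign.\<close>
  define a :: "complex ^ 3" where "a = vector [v$2 * w$3 - v$3 * w$2, v$3 * w$1 - v$1 * w$3, v$1 * w$2 - v$2 * w$1]"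
  obtain i j where ij: "i \<noteq> j" "v $ i * w $ j - v $ j * w $ i \<noteq> 0" using indep_minor[OF assms] by blast
  then have "a \<noteq> 0"
    using three_cases[of i] three_cases[of j] by (auto simp: a_def vec_eq_iff forall_3)
  moreover have "dot a v = 0" "dot a w = 0" by (simp_all add: a_def dot_def sum_3 algebra_simps)
  ultimately show ?thesis using that by blast
qed

lemma is_line_span2:
  assumes "indep v w" shows "is_line (span2 v w)"
  using ex_normal[OF assms] zeros_lin_eq_span2[OF _ assms] is_line_iff by metis

lemma proj_in_span2 [simp]: "proj v \<in> span2 v w" "proj w \<in> span2 v w"
  unfolding span2_def
  by (rule CollectI, rule exI[of _ 1], rule exI[of _ 0], simp)
    (rule CollectI, rule exI[of _ 0], rule exI[of _ 1], simp)

lemma proj_add_in_span2: "proj (v + t *s w) \<in> span2 v w"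
  unfolding span2_def by (rule CollectI, rule exI[of _ 1], rule exI[of _ t]) simp

lemma ex_indep_kernel:
  assumes "a \<noteq> 0"
  obtains v w where "indep v w" "dot a v = 0" "dot a w = 0"
proof -
  obtain k where k: "a $ k \<noteq> 0" using vec3_nonzero[OF assms] by blast
  obtain i j where ij: "i \<noteq> j" "i \<noteq> k" "j \<noteq> k" using three_cases[of k] by (metis three_distinct)
  define v where "v = axis i 1 - (a $ i / a $ k) *s axis k 1"
  define w where "w = axis j 1 - (a $ j / a $ k) *s axis k 1"
  have "indep v w"
    unfolding indep_def
  proof (intro allI impI)
    fix s t assume "s *s v + t *s w = 0"
    then have "(s *s v + t *s w) $ i = 0" "(s *s v + t *s w) $ j = 0" by simp_all
    then show "s = 0 \<and> t = 0" using ij by (simp add: v_def w_def axis_def)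
  qed
  moreover have "dot a v = 0" "dot a w = 0" using k by (simp_all add: v_def w_def)
  ultimately show ?thesis using that by blast
qed

lemma line_obtain_other:
  assumes "is_line C" "proj v \<in> C" "v \<noteq> 0"
  obtains w where "indep v w" "C = span2 v w"
proof -
  obtain a where a: "a \<noteq> 0" "C = zeros (lin a)" using assms(1) is_line_iff by blast
  obtain x y where xy: "indep x y" "dot a x = 0" "dot a y = 0" using ex_indep_kernel[OF a(1)] by blast
  have "indep v x \<or> indep v y"
    using xy assms(3) indep_nonzero[OF xy(1)] indep_iff_proj by metis
  moreover have "proj x \<in> C" "proj y \<in> C"
    using a xy indep_nonzero[OF xy(1)] by (simp_all add: proj_in_zeros[OF homogeneous_lin])
  ultimately show ?thesis using that line_eq_span2[OF assms(1)] assms(2) by metis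
qed

lemma line_unique:
  assumes "is_line C" "is_line D" "p \<noteq> q" "p \<in> C" "q \<in> C" "p \<in> D" "q \<in> D"
  shows "C = D"
proof -
  obtain v where v: "v \<noteq> 0" "p = proj v" by (rule proj_cases)
  obtain w where w: "w \<noteq> 0" "q = proj w" by (rule proj_cases)
  have "indep v w" using v w assms(3) by (simp add: indep_iff_proj)
  then show ?thesis using line_eq_span2[of _ v w] assms v w by metis
qed

lemma ex_line_through:
  assumes "p \<noteq> q" obtains C where "is_line C" "p \<in> C" "q \<in> C"
proof -
  obtain v where v: "v \<noteq> 0" "p = proj v" by (rule proj_cases)
  obtain w where w: "w \<noteq> 0" "q = proj w" by (rule proj_cases)
  have "indep v w" using v w assms by (simp add: indep_iff_proj)
  then show ?thesis using that[OF is_line_span2] v w by simp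
qed

lemma infinite_line:
  assumes "is_line C" shows "infinite C"
proof -
  obtain a where a: "a \<noteq> 0" "C = zeros (lin a)" using assms(1) is_line_iff by blast
  obtain v w where vw: "indep v w" "dot a v = 0" "dot a w = 0" using ex_indep_kernel[OF a(1)] by blast
  have C: "C = span2 v w" using zeros_lin_eq_span2 a vw by simp
  have "inj (\<lambda>t. proj (v + t *s w))"
  proof (rule injI)
    fix s t assume e: "proj (v + s *s w) = proj (v + t *s w)"
    have n: "v + t *s w \<noteq> 0" for t using vw(1) by (auto simp: indep_def dest: spec2[of _ 1 t])
    then obtain c where c: "v + t *s w = c *s (v + s *s w)" using e proj_eq_iff[OF n n] by metis
    have "(c - 1) *s v + (c * s - t) *s w = c *s (v + s *s w) - (v + t *s w)"
      by (simp add: vec_eq_iff algebra_simps)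
    then have "(c - 1) *s v + (c * s - t) *s w = 0" using c by simp
    from indepD[OF vw(1) this] show "s = t" by auto
  qed
  moreover have "range (\<lambda>t. proj (v + t *s w)) \<subseteq> C"
    unfolding C using proj_add_in_span2 by blast
  ultimately show ?thesis
    using infinite_UNIV_char_0 finite_imageD finite_subset by metis
qed

lemma span2_nonzero: "indep v w \<Longrightarrow> s \<noteq> 0 \<or> t \<noteq> 0 \<Longrightarrow> s *s v + t *s w \<noteq> 0"
  by (auto simp: indep_def)

text \<open>The affine chart \<open>v + t *s w\<close> of the line misses only
  \<open>proj w\<close>.\<close>

lemma span2_cases:
  assumes "p \<in> span2 v w" "p \<noteq> proj w"
  obtains t where "p = proj (v + t *s w)"
proof -
  obtain s t where st: "s \<noteq> 0 \<or> t \<noteq> 0" "p = proj (s *s v + t *s w)" using assms by (auto simp: span2_def)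
  have s: "s \<noteq> 0" using assms(2) st proj_scale by auto
  have "s *s v + t *s w = s *s (v + (t / s) *s w)" using s by (simp add: vec_eq_iff algebra_simps)
  then show ?thesis using that st s proj_scale by metis
qed

lemma line_subset_zeros_iff:
  assumes "homogeneous d F" "indep v w"
  shows "span2 v w \<subseteq> zeros F \<longleftrightarrow> along F v w = 0"
proof
  assume s: "span2 v w \<subseteq> zeros F"
  show "along F v w = 0"
  proof (rule poly_ext_complex)
    fix t
    have "proj (v + t *s w) \<in> zeros F" using s proj_add_in_span2 by blast
    moreover have "v + t *s w \<noteq> 0" using span2_nonzero[OF assms(2), of 1 t] by simp
    ultimately show "poly (along F v w) t = poly 0 t" by (simp add: poly_along proj_in_zeros[OF assms(1)])
  qed
next
  assume a: "along F v w = 0"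
  show "span2 v w \<subseteq> zeros F"
  proof
    fix p assume p: "p \<in> span2 v w"
    show "p \<in> zeros F"
    proof (cases "p = proj w")
      case True
      \<comment> \<open>The point outside the chart is controlled by the coefficient of degree
        \<open>d\<close>.\<close>
      have "eval3 F w = 0" using coeff_along_top[OF assms(1), of v w] a by simp
      then show ?thesis using True indep_nonzero[OF assms(2)] by (simp add: proj_in_zeros[OF assms(1)])
    next
      case False
      then obtain t where t: "p = proj (v + t *s w)" using span2_cases p by blast
      have "v + t *s w \<noteq> 0" using span2_nonzero[OF assms(2), of 1 t] by simp
      moreover have "eval3 F (v + t *s w) = 0" using a poly_along[of F v w t] by simp
      ultimately show ?thesis using t by (simp add: proj_in_zeros[OF assms(1)])
    qed
  qed
qed

lemma homogeneous_unique:
  assumes "homogeneous d F" "homogeneous e F" "F \<noteq> 0" shows "d = e"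
proof -
  obtain i j k where "mcoeff F i j k \<noteq> 0" using assms(3) mcoeff_ext[of F 0] by auto
  then show ?thesis using assms unfolding homogeneous_def by blast
qed

lemma unit_const3:
  fixes u :: poly3 assumes "u dvd 1" obtains c where "c \<noteq> 0" "u = const3 c"
proof -
  obtain p where p: "u = [:p:]" "p dvd 1" using assms is_unit_poly_iff by blast
  obtain q where q: "p = [:q:]" "q dvd 1" using p is_unit_poly_iff by blast
  obtain c where c: "q = [:c:]" "c dvd 1" using q is_unit_poly_iff by blast
  then have "c \<noteq> 0" by auto
  then show ?thesis using that p q c by (simp add: const3_def)
qed

lemma zeros_const_mult [simp]: "c \<noteq> 0 \<Longrightarrow> zeros (const3 c * F) = zeros F"
  by (simp add: zeros_def)

lemma irreducible_dvd_irreducible: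
  fixes F G :: poly3
  assumes "irreducible F" "irreducible G" "F dvd G"
  obtains c where "c \<noteq> 0" "G = const3 c * F"
proof -
  obtain u where u: "G = F * u" using assms(3) by blast
  then have "u dvd 1" using assms irreducibleD irreducible_def by blast
  then show ?thesis using unit_const3[of u] u that by (metis mult.commute)
qed

lemma hom_vanish_at_0: "homogeneous d F \<Longrightarrow> d \<ge> 1 \<Longrightarrow> eval3 F 0 = 0"
  using eval3_scale[of d F 0 0] by (auto simp: power_0_left split: if_splits)

lemma lin_dvd_if_line_subset:
  assumes "homogeneous d F" "d \<ge> 1" "a \<noteq> 0" "zeros (lin a) \<subseteq> zeros F"
  shows "lin a dvd F"
  unfolding lin_dvd_iff[OF assms(3)]
proof (intro allI impI)
  fix v assume v: "dot a v = 0"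
  show "eval3 F v = 0"
  proof (cases "v = 0")
    case False
    then have "proj v \<in> zeros (lin a)" using v by (simp add: proj_in_zeros[OF homogeneous_lin])
    then show ?thesis using assms(4) False by (auto simp: proj_in_zeros[OF assms(1)])
  qed (use hom_vanish_at_0 assms in simp)
qed

text \<open>The linear equation of the line divides \<open>F\<close>, and irreducibility leaves only
  a scalar as cofactor.\<close>

lemma line_in_irreducible:
  assumes "homogeneous d F" "d \<ge> 1" "irreducible F" "is_line C" "C \<subseteq> zeros F"
  shows "d = 1" "C = zeros F"
proof -
  obtain a where a: "a \<noteq> 0" "C = zeros (lin a)" using assms(4) is_line_iff by blast
  have "lin a dvd F" using lin_dvd_if_line_subset assms a by blast
  then obtain c where c: "c \<noteq> 0" "F = const3 c * lin a"
    using irreducible_dvd_irreducible assms(3) irreducible_lin_iff a by metis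
  then show "C = zeros F" using a by simp
  have "homogeneous 1 F" unfolding c by (intro homogeneous_const_mult homogeneous_lin)
  moreover have "F \<noteq> 0" using assms(3) by auto
  ultimately show "d = 1" using assms(1) homogeneous_unique by blast
qed

section \<open>Intersection of a line with a curve\<close>

lemma complex_poly_only_root_0:
  fixes p :: "complex poly"
  assumes "p \<noteq> 0" "\<And>x. poly p x = 0 \<Longrightarrow> x = 0"
  obtains c m where "c \<noteq> 0" "p = monom c m"
proof -
  obtain q where q: "p = [:- 0, 1:] ^ Polynomial.order 0 p * q" "\<not> [:- 0, 1:] dvd q"
    using order_decomp[OF assms(1)] by blast
  have "poly q x \<noteq> 0" for x
  proof
    assume x: "poly q x = 0"
    then have "poly p x = 0" by (subst q(1)) simp
    then have "x = 0" by (rule assms(2))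
    then show False using x q(2) by (simp add: poly_eq_0_iff_dvd)
  qed
  then have "constant (poly q)" using fundamental_theorem_of_algebra by blast
  then obtain c where c: "q = [:c:]" by (metis constant_degree degree_eq_zeroE)
  have "p = monom c (Polynomial.order 0 p)"
    by (subst q(1)) (simp add: c monom_altdef)
  moreover have "c \<noteq> 0" using q(2) c by auto
  ultimately show ?thesis using that by blast
qed

lemma proj_combination_in_span2: "x = s *s v + t *s w \<Longrightarrow> x \<noteq> 0 \<Longrightarrow> proj x \<in> span2 v w"
  unfolding span2_def by (rule CollectI, rule exI[of _ s], rule exI[of _ t]) auto

lemma proj_add_neq:
  assumes "indep v w"
  shows "v + t *s w \<noteq> 0" "proj (v + t *s w) \<noteq> proj w" "proj (v + t *s w) = proj v \<Longrightarrow> t = 0"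
proof -
  show n: "v + t *s w \<noteq> 0" using span2_nonzero[OF assms, of 1 t] by simp
  show "proj (v + t *s w) \<noteq> proj w"
  proof
    assume "proj (v + t *s w) = proj w"
    then obtain c where c: "v + t *s w = c *s w"
      using proj_eq_iff[of w "v + t *s w"] n indep_nonzero[OF assms] by metis
    have "1 *s v + (t - c) *s w = (v + t *s w) - c *s w" by (simp add: vec_eq_iff algebra_simps)
    then have "1 *s v + (t - c) *s w = 0" using c by simp
    from indepD[OF assms this] show False by simp
  qed
  assume "proj (v + t *s w) = proj v"
  then obtain c where c: "v + t *s w = c *s v"
    using proj_eq_iff[of v "v + t *s w"] n indep_nonzero[OF assms] by metis
  have "(1 - c) *s v + t *s w = (v + t *s w) - c *s v" by (simp add: vec_eq_iff algebra_simps)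
  then have "(1 - c) *s v + t *s w = 0" using c by simp
  from indepD[OF assms this] show "t = 0" by simp
qed

text \<open>The point at infinity of the chart is chosen off the curve. Then the restriction has
  exact degree \<open>d\<close>, with leading coefficient the value of \<open>F\<close> there, and
  all intersection points correspond to its roots.\<close>

lemma line_inter_zeros:
  assumes F: "homogeneous d F" and C: "is_line C" "\<not> C \<subseteq> zeros F"
  shows "finite (C \<inter> zeros F)" "card (C \<inter> zeros F) \<le> d" "d \<ge> 1 \<Longrightarrow> C \<inter> zeros F \<noteq> {}"
proof -
  obtain q where q: "q \<in> C" "q \<notin> zeros F" using C by blast
  obtain w where w: "w \<noteq> 0" "q = proj w" by (rule proj_cases)
  obtain v where v: "indep w v" "C = span2 w v" using line_obtain_other[OF C(1)] q w by metis
  have vw: "indep v w" using v indep_sym by blast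
  have Cs: "C = span2 v w"
    using line_eq_span2[OF C(1) vw] v by simp
  have Fw: "eval3 F w \<noteq> 0" using q w by (simp add: proj_in_zeros[OF F])
  let ?p = "along F v w"
  have top: "coeff ?p d \<noteq> 0" using coeff_along_top[OF F] Fw by simp
  then have p0: "?p \<noteq> 0" by auto
  have deg: "degree ?p = d" using top degree_along_le[OF F] le_degree le_antisym by metis
  have eq: "C \<inter> zeros F = (\<lambda>t. proj (v + t *s w)) ` {t. poly ?p t = 0}"
  proof (intro equalityI subsetI)
    fix x assume x: "x \<in> C \<inter> zeros F"
    then have "x \<noteq> proj w" using q w by blast
    then obtain t where t: "x = proj (v + t *s w)" using x Cs span2_cases by blast
    then have "poly ?p t = 0"
      using x proj_add_neq(1)[OF vw] by (simp add: poly_along proj_in_zeros[OF F])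
    then show "x \<in> (\<lambda>t. proj (v + t *s w)) ` {t. poly ?p t = 0}" using t by blast
  next
    fix x assume "x \<in> (\<lambda>t. proj (v + t *s w)) ` {t. poly ?p t = 0}"
    then obtain t where "x = proj (v + t *s w)" "poly ?p t = 0" by blast
    then show "x \<in> C \<inter> zeros F"
      using Cs proj_add_in_span2 proj_add_neq(1)[OF vw] by (simp add: poly_along proj_in_zeros[OF F])
  qed
  have fin: "finite {t. poly ?p t = 0}" using poly_roots_finite[OF p0] .
  then show "finite (C \<inter> zeros F)" unfolding eq by simp
  show "card (C \<inter> zeros F) \<le> d"
    unfolding eq using card_image_le[OF fin, of "\<lambda>t. proj (v + t *s w)"] card_poly_roots_bound[OF p0] deg by linarith
  assume "d \<ge> 1"
  then have "\<not> constant (poly ?p)" using deg constant_degree[of ?p] by simp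
  then show "C \<inter> zeros F \<noteq> {}" unfolding eq using fundamental_theorem_of_algebra by blast
qed

text \<open>With the two permitted points at \<open>t = 0\<close> and
  \<open>t = \<infinity>\<close>, zero is the only possible root. The exponent is the intersection
  multiplicity at \<open>proj v\<close>; that at \<open>proj w\<close> is
  \<open>d - m\<close>.\<close>

lemma along_eq_monom:
  assumes F: "homogeneous d F" and vw: "indep v w" and "\<not> span2 v w \<subseteq> zeros F"
    and s: "span2 v w \<inter> zeros F \<subseteq> {proj v, proj w}"
  obtains c m where "c \<noteq> 0" "m \<le> d" "along F v w = monom c m"
proof -
  have "along F v w \<noteq> 0" using assms line_subset_zeros_iff by blast
  moreover have "t = 0" if "poly (along F v w) t = 0" for t
  proof -
    have "proj (v + t *s w) \<in> span2 v w \<inter> zeros F"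
      using that proj_add_in_span2 proj_add_neq(1)[OF vw] by (simp add: poly_along proj_in_zeros[OF F])
    then show ?thesis using s proj_add_neq[OF vw] by blast
  qed
  ultimately obtain c m where "c \<noteq> 0" "along F v w = monom c m" using complex_poly_only_root_0 by blast
  moreover from this have "m \<le> d" using degree_along_le[OF F, of v w] by (simp add: degree_monom_eq)
  ultimately show ?thesis using that by blast
qed

lemma along_eq_top_monom:
  assumes F: "homogeneous d F" and vw: "indep v w" and s: "span2 v w \<inter> zeros F = {proj v}"
  shows "along F v w = monom (eval3 F w) d"
proof -
  have w: "proj w \<notin> zeros F"
    using s vw proj_in_span2(2)[of w v] indep_iff_proj indep_nonzero[OF vw] by (metis IntI singletonD)
  obtain c m where cm: "c \<noteq> 0" "m \<le> d" "along F v w = monom c m"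
    using along_eq_monom[OF F vw] s w proj_in_span2 by blast
  have "eval3 F w \<noteq> 0" using w indep_nonzero[OF vw] by (simp add: proj_in_zeros[OF F])
  then show ?thesis using coeff_along_top[OF F, of v w] cm by (auto split: if_splits)
qed

text \<open>The restriction is c t^d, and for d >= 2 its coefficients of degree 1 and d - 1 vanish.
  The former says that the line is tangent at \<open>v\<close>, the latter that \<open>v\<close>
  lies on the polar of \<open>w\<close>.\<close>

lemma dot_grad_eq_0_if_single:
  assumes F: "homogeneous d F" and vw: "indep v w" and s: "span2 v w \<inter> zeros F = {proj v}" and "d \<ge> 2"
  shows "dot (grad F v) w = 0" "dot (grad F w) v = 0"
proof -
  note a = along_eq_top_monom[OF F vw s]
  show "dot (grad F v) w = 0" using assms(4) by (simp add: a flip: coeff_along_1)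
  have "coeff (along F w v) (Suc 0) = coeff (along F v w) (d - 1)"
    using coeff_along_swap[OF F, of 1 w v] assms(4) by simp
  then show "dot (grad F w) v = 0" using assms(4) by (simp add: a flip: coeff_along_1)
qed

lemma along_conic:
  assumes "homogeneous 2 F"
  shows "along F v w = [:eval3 F v, dot (grad F v) w, eval3 F w:]"
proof (rule poly_eqI)
  fix n :: nat
  consider "n = 0" | "n = 1" | "n = 2" | "n > 2" by linarith
  then show "coeff (along F v w) n = coeff [:eval3 F v, dot (grad F v) w, eval3 F w:] n"
    by cases (use degree_along_le[OF assms, of v w] coeff_along_top[OF assms] in
        \<open>simp_all add: coeff_along_1 coeff_eq_0 numeral_2_eq_2\<close>)
qed

section \<open>Tangent lines, smooth points and nodes\<close>

lemma grad_scale: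
  assumes F: "homogeneous d F" "d \<ge> 1"
  shows "grad F (c *s v) = c ^ (d - 1) *s grad F v"
proof -
  have "coeff (along F (c *s v) w) 1 = c ^ (d - 1) * coeff (along F v w) 1" for w
  proof -
    have "along F w (c *s v) = pcompose (along F w v) [:0, c:]"
      by (rule poly_ext_complex) (simp add: poly_along poly_pcompose vec.scale_scale)
    then show ?thesis
      using coeff_along_swap[OF F, of "c *s v" w] coeff_along_swap[OF F, of v w]
      by (simp add: coeff_pcompose_linear)
  qed
  then show ?thesis by (simp add: grad_def vec_eq_iff)
qed

lemma tangent_line_proj:
  assumes F: "homogeneous d F" "d \<ge> 1" and v: "v \<noteq> 0"
  shows "tangent_line F (proj v) = zeros (lin (grad F v))"
proof -
  have "q \<in> tangent_line F (proj v) \<longleftrightarrow> q \<in> zeros (lin (grad F v))" for q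
  proof -
    have s: "dot (c *s a) w = c * dot a w" for a c w by (simp add: dot_def sum_distrib_left mult_ac)
    have "q \<in> tangent_line F (proj v) \<longleftrightarrow> (\<forall>c. c \<noteq> 0 \<longrightarrow> (\<forall>w\<in>coords q. c ^ (d - 1) * dot (grad F v) w = 0))"
      by (auto simp: tangent_line_def coords_proj[OF v] coeff_along_1 grad_scale[OF F] s)
    also have "\<dots> \<longleftrightarrow> (\<forall>w\<in>coords q. dot (grad F v) w = 0)"
      by (auto dest: spec[of _ 1])
    finally show ?thesis by (simp add: zeros_def)
  qed
  then show ?thesis by blast
qed

lemma smooth_point_proj:
  assumes F: "homogeneous d F" "d \<ge> 1" and v: "v \<noteq> 0"
  shows "smooth_point F (proj v) \<longleftrightarrow> eval3 F v = 0 \<and> grad F v \<noteq> 0"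
proof -
  have e: "(\<exists>w. dot a w \<noteq> 0) \<longleftrightarrow> a \<noteq> 0" for a
  proof
    assume "a \<noteq> 0"
    then obtain k where "a $ k \<noteq> 0" using vec3_nonzero by blast
    then have "dot a (axis k 1) \<noteq> 0" by simp
    then show "\<exists>w. dot a w \<noteq> 0" by blast
  qed (auto simp: dot_def)
  have "smooth_point F (proj v) \<longleftrightarrow> eval3 F v = 0 \<and> (\<forall>c. c \<noteq> 0 \<longrightarrow> grad F (c *s v) \<noteq> 0)"
    by (auto simp: smooth_point_def coords_proj[OF v] coeff_along_1 e proj_in_zeros[OF F(1) v])
  also have "\<dots> \<longleftrightarrow> eval3 F v = 0 \<and> grad F v \<noteq> 0"
    by (auto simp: grad_scale[OF F] dest: spec[of _ 1])
  finally show ?thesis .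
qed

lemma span2_eq_tangent_line:
  assumes F: "homogeneous d F" "d \<ge> 1" and vw: "indep v w" and "eval3 F v = 0" "grad F v \<noteq> 0"
    and "dot (grad F v) w = 0"
  shows "span2 v w = tangent_line F (proj v)"
  using zeros_lin_eq_span2[OF assms(5) vw] assms dot_grad_self[OF F(1), of v] indep_nonzero[OF vw]
  by (simp add: tangent_line_proj[OF F])

lemma indep_if_independent:
  assumes "vec.independent {a, b}" "a \<noteq> b" shows "indep a b"
  unfolding indep_def
proof (intro allI impI)
  fix s t assume st: "s *s a + t *s b = 0"
  let ?u = "\<lambda>x. if x = a then s else t"
  have s: "(\<Sum>v\<in>{a, b}. ?u v *s v) = 0" using st assms(2) by (subst sum.insert) auto
  show "s = 0 \<and> t = 0"
    using vec.independentD[OF assms(1) _ _ s, of a] vec.independentD[OF assms(1) _ _ s, of b] assms(2)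
    by (simp split: if_splits)
qed

text \<open>As \<open>G\<close> and \<open>H\<close> vanish at \<open>v\<close>, the quadratic term
  of the product is the product of their differentials times the value of \<open>K\<close>. It
  equals a product of two independent linear forms, which is neither zero nor a multiple of a
  square.\<close>

lemma node_transversal:
  assumes hom: "homogeneous g G" "homogeneous h H" and node: "node (G * H * K) (proj v)" and v: "v \<noteq> 0"
    and zero: "eval3 G v = 0" "eval3 H v = 0"
  shows "eval3 K v \<noteq> 0" "grad G v \<noteq> 0" "grad H v \<noteq> 0"
    "indep v w \<Longrightarrow> dot (grad G v) w = 0 \<Longrightarrow> dot (grad H v) w \<noteq> 0"
proof -
  have "v \<in> {c *s v | c. c \<noteq> 0}" by (rule CollectI, rule exI[of _ 1]) simp
  then obtain a b where ab: "a \<noteq> b" "vec.independent {a, b}"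
    and eq: "\<And>w. coeff (along (G * H * K) v w) 2 = dot a w * dot b w"
    using node unfolding node_def coords_proj[OF v] dot_def by blast
  have i: "indep a b" using indep_if_independent ab by blast
  have e: "dot (grad G v) w * dot (grad H v) w * eval3 K v = dot a w * dot b w" for w
    using eq[of w] by (simp add: coeff_mult_2 coeff_mult_1 coeff_mult_0 zero coeff_along_1)
  obtain i j where m: "a $ i * b $ j - a $ j * b $ i \<noteq> 0" using indep_minor[OF i] by blast
  \<comment> \<open>The vectors \<open>x\<close> and \<open>y\<close> each annihilate one of the two
    linear forms but not the other, so their product vanishes at both but not at
    \<open>x + y\<close>.\<close>
  define x where "x = axis i (a $ j) - axis j (a $ i)"
  define y where "y = axis i (b $ j) - axis j (b $ i)"
  have xy: "dot a x = 0" "dot b x \<noteq> 0" "dot b y = 0" "dot a y \<noteq> 0"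
    using m by (auto simp: x_def y_def algebra_simps)
  have z: "dot (grad G v) (x + y) * dot (grad H v) (x + y) * eval3 K v \<noteq> 0"
    unfolding e using xy by simp
  then show "eval3 K v \<noteq> 0" by simp
  show "grad G v \<noteq> 0" "grad H v \<noteq> 0" using z by (auto simp: dot_def)
  assume vw: "indep v w" and w: "dot (grad G v) w = 0"
  show "dot (grad H v) w \<noteq> 0"
  proof
    assume w': "dot (grad H v) w = 0"
    obtain e' where e': "\<And>x. \<exists>s t u. x = s *s v + t *s w + u *s e'" using indep_extend[OF vw] by blast
    have vv: "dot (grad G v) v = 0" "dot (grad H v) v = 0"
      using dot_grad_self[OF hom(1)] dot_grad_self[OF hom(2)] zero by simp_all
    \<comment> \<open>If both differentials vanish on the span of \<open>v\<close> and
      \<open>w\<close>, the quadratic term is \<open>k\<close> times the square of the third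
      coordinate. Vanishing at \<open>x\<close> and \<open>y\<close> would force vanishing at
      \<open>x + y\<close>.\<close>
    define k where "k = dot (grad G v) e' * dot (grad H v) e' * eval3 K v"
    obtain s t u where X: "x = s *s v + t *s w + u *s e'" using e' by blast
    obtain s' t' u' where Y: "y = s' *s v + t' *s w + u' *s e'" using e' by blast
    have "u * u * k = 0" using e[of x] xy by (simp add: X vv w w' k_def mult_ac)
    moreover have "u' * u' * k = 0" using e[of y] xy by (simp add: Y vv w w' k_def mult_ac)
    moreover have "(u + u') * (u + u') * k \<noteq> 0"
      using z by (simp add: X Y vv w w' k_def algebra_simps)
    ultimately show False by auto
  qed
qed

subsection \<open>Two curves without common component meet in finitely many points\<close>

text \<open>Bezout's identity over the fractions of C[x][y], with denominators cleared. An element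
  \<open>h\<close> of least z-degree in the ideal of \<open>F\<close> and \<open>G\<close> divides
  multiples of both by elements of C[x][y], by pseudo-division. Primality of \<open>F\<close> then
  shows that \<open>h\<close> itself is free of z.\<close>

lemma irreducible_elimination:
  fixes F G :: "complex poly poly poly"
  assumes F: "irreducible F" and G: "irreducible G" and ndvd: "\<not> F dvd G"
  obtains r u w where "r \<noteq> 0" "[:r:] = u * F + w * G"
proof (cases "degree F = 0")
  case True
  then obtain r where "F = [:r:]" by (metis degree_eq_zeroE)
  moreover from this have "r \<noteq> 0" using F by auto
  ultimately show ?thesis using that[of r 1 0] by simp
next
  case False
  have prime: "prime_elem F" by (rule irreducible_imp_prime_elem[OF F])
  define S where "S = {h. h \<noteq> 0 \<and> (\<exists>u w. h = u * F + w * G)}"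
  have "F = 1 * F + 0 * G" "F \<noteq> 0" using F by auto
  then have "F \<in> S" unfolding S_def by blast
  then obtain h where h: "h \<in> S" "\<And>h'. h' \<in> S \<Longrightarrow> degree h \<le> degree h'"
    using ex_has_least_nat[of "\<lambda>h. h \<in> S" F degree] by blast
  then obtain u w where uw: "h = u * F + w * G" and h0: "h \<noteq> 0" by (auto simp: S_def)
  have dvd: "\<exists>c q. c \<noteq> 0 \<and> smult c P = h * q" if P: "P = u' * F + w' * G" for P u' w'
  proof -
    obtain a q where a: "a \<noteq> 0" "smult a P = h * q + pseudo_mod P h"
      using pseudo_mod(1)[OF h0] by blast
    have "pseudo_mod P h = (smult a u' - q * u) * F + (smult a w' - q * w) * G"
      using a(2) by (simp add: P uw algebra_simps smult_add_right)
    then have "pseudo_mod P h \<in> S \<or> pseudo_mod P h = 0" unfolding S_def by blast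
    then have "pseudo_mod P h = 0" using pseudo_mod(2)[OF h0, of P] h(2) by fastforce
    then show ?thesis using a by auto
  qed
  obtain c q where c: "c \<noteq> 0" "smult c F = h * q" using dvd[of F 1 0] by auto
  obtain c' q' where c': "c' \<noteq> 0" "smult c' G = h * q'" using dvd[of G 0 1] by auto
  \<comment> \<open>A polynomial of positive z-degree does not divide a nonzero one free of
    z.\<close>
  have nd: "\<not> F dvd [:c':]" using False c'(1) dvd_imp_degree_le[of F "[:c':]"] by auto
  have "\<not> F dvd h"
  proof
    assume "F dvd h"
    then have "F dvd [:c':] * G" using c' by simp
    then show False using prime_elem_dvd_mult_iff[OF prime] nd ndvd by blast
  qed
  moreover have "F dvd h * q" using dvd_smult[OF dvd_refl, of F c] c(2) by simp
  ultimately have "F dvd q" using prime_elem_dvd_mult_iff[OF prime] by blast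
  then obtain q2 where "q = F * q2" by blast
  then have "F * [:c:] = F * (h * q2)" using c(2) by (simp add: mult_ac)
  then have "[:c:] = h * q2" using F by (metis irreducible_def mult_cancel_left)
  moreover from this have "h \<noteq> 0" "q2 \<noteq> 0" using c(1) by auto
  ultimately have "degree h = 0" using degree_mult_eq[of h q2] by (metis add_is_0 degree_pCons_0)
  then obtain r where "h = [:r:]" by (metis degree_eq_zeroE)
  then show ?thesis using that[of r u w] uw h0 by auto
qed

text \<open>The eliminant constrains the first two coordinates of a common zero, and hence confines
  the common zeros to finitely many lines through [0:0:1]. None of these lies in both curves, as its
  equation would be a common factor.\<close>

lemma finite_zeros_inter:
  assumes F: "homogeneous d F" "d \<ge> 1" "irreducible F" and G: "homogeneous e G" "e \<ge> 1" "irreducible G"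
    and ndvd: "\<not> F dvd G"
  shows "finite (zeros F \<inter> zeros G)"
proof -
  obtain r u w where r: "r \<noteq> 0" "[:r:] = u * F + w * G"
    using irreducible_elimination[OF F(3) G(3) ndvd] by blast
  have rz: "poly (poly r [:x $ 2:]) (x $ 1) = 0" if "eval3 F x = 0" "eval3 G x = 0" for x
  proof -
    have "eval3 [:r:] x = 0" unfolding r(2) using that by simp
    then show ?thesis by (simp add: eval3_def)
  qed
  \<comment> \<open>The eliminant need not be homogeneous. Common zeros are rescaled to first
    coordinate \<open>c0\<close>, a value at which its leading coefficient in y survives, so only
    finitely many y remain.\<close>
  obtain c0 where c0: "c0 \<noteq> 0" "poly (lead_coeff r) c0 \<noteq> 0"
  proof -
    have "finite {x. poly ([:0, 1:] * lead_coeff r) x = 0}"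
      by (rule poly_roots_finite) (use r in simp)
    then obtain x where "x \<notin> {x. poly ([:0, 1:] * lead_coeff r) x = 0}"
      using infinite_UNIV_char_0[where 'a = complex] by (metis ex_new_if_finite)
    then have "x \<noteq> 0" "poly (lead_coeff r) x \<noteq> 0" by auto
    then show ?thesis using that by blast
  qed
  define r0 where "r0 = map_poly (\<lambda>p. poly p c0) r"
  have "poly (poly p [:y:]) c0 = poly (map_poly (\<lambda>p. poly p c0) p) y" for p y
    by (induction p) (simp_all add: map_poly_pCons)
  then have r0: "poly (poly r [:y:]) c0 = poly r0 y" for y by (simp add: r0_def)
  have "coeff r0 (degree r) \<noteq> 0" using c0(2) by (simp add: r0_def coeff_map_poly)
  then have "finite {y. poly r0 y = 0}" by (intro poly_roots_finite) auto
  \<comment> \<open>Directions of the lines through [0:0:1]; \<open>axis 2 1\<close> accounts for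
    the zeros with first coordinate 0, which cannot be rescaled.\<close>
  define V :: "(complex ^ 3) set" where "V = insert (axis 2 1) ((\<lambda>y. vector [c0, y, 0]) ` {y. poly r0 y = 0})"
  let ?e = "axis 3 1 :: complex ^ 3"
  have finV: "finite V" using \<open>finite {y. poly r0 y = 0}\<close> by (simp add: V_def)
  have indepV: "indep v ?e" if "v \<in> V" for v
    unfolding indep_def
  proof (intro allI impI)
    fix s t assume "s *s v + t *s ?e = 0"
    then show "s = 0 \<and> t = 0"
      using that c0(1) by (auto simp: V_def vec_eq_iff forall_3 axis_def)
  qed
  have fin: "finite (span2 v ?e \<inter> (zeros F \<inter> zeros G))" if "v \<in> V" for v
  proof -
    have C: "is_line (span2 v ?e)" using is_line_span2 indepV that by blast
    have "\<not> (span2 v ?e \<subseteq> zeros F \<and> span2 v ?e \<subseteq> zeros G)"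
    proof
      assume s: "span2 v ?e \<subseteq> zeros F \<and> span2 v ?e \<subseteq> zeros G"
      obtain a where a: "a \<noteq> 0" "span2 v ?e = zeros (lin a)" using C is_line_iff by blast
      have "lin a dvd F" "lin a dvd G" using lin_dvd_if_line_subset[OF F(1,2) a(1)] lin_dvd_if_line_subset[OF G(1,2) a(1)] s a(2) by auto
      then show False
        using ndvd F(3) G(3) a(1) irreducible_lin_iff[of a] irreducible_dvd_irreducible[of "lin a" F]
        by (metis dvd_trans irreducibleD' irreducible_not_unit)
    qed
    then show ?thesis
      using line_inter_zeros(1)[OF F(1) C] line_inter_zeros(1)[OF G(1) C]
      by (meson finite_subset inf_le1 inf_le2 inf_mono order_refl)
  qed
  have "zeros F \<inter> zeros G \<subseteq> (\<Union>v\<in>V. span2 v ?e \<inter> (zeros F \<inter> zeros G))"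
  proof
    fix p assume p: "p \<in> zeros F \<inter> zeros G"
    obtain x where x: "x \<noteq> 0" "p = proj x" by (rule proj_cases)
    have z: "eval3 F (c *s x) = 0" "eval3 G (c *s x) = 0" for c
      using p x by (simp_all add: proj_in_zeros[OF F(1)] proj_in_zeros[OF G(1)] eval3_scale[OF F(1)] eval3_scale[OF G(1)])
    have "\<exists>v\<in>V. p \<in> span2 v ?e"
    proof (cases "x $ 1 = 0")
      case True
      have "x = (x $ 2) *s axis 2 1 + (x $ 3) *s ?e" using True by (simp add: vec_eq_iff forall_3 axis_def)
      then have "p \<in> span2 (axis 2 1) ?e" using x proj_combination_in_span2 by blast
      then show ?thesis by (auto simp: V_def)
    next
      case False
      define c where "c = c0 / x $ 1"
      have "poly r0 (c * x $ 2) = 0"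
        using rz[OF z(1)[of c] z(2)[of c]] False by (simp add: c_def flip: r0)
      then have "vector [c0, c * x $ 2, 0] \<in> V" by (simp add: V_def)
      moreover have "x = (1 / c) *s vector [c0, c * x $ 2, 0] + (x $ 3) *s ?e"
        using False c0(1) by (simp add: vec_eq_iff forall_3 axis_def c_def)
      then have "p \<in> span2 (vector [c0, c * x $ 2, 0]) ?e"
        using x proj_combination_in_span2 by blast
      ultimately show ?thesis by blast
    qed
    then show "p \<in> (\<Union>v\<in>V. span2 v ?e \<inter> (zeros F \<inter> zeros G))" using p by blast
  qed
  then show ?thesis using finV fin by (meson finite_UN_I finite_subset)
qed

subsection \<open>Lines meeting a curve of three components in at most two points\<close>

text \<open>The finiteness condition excludes lines contained in the curve, as \<open>card\<close>
  of an infinite set is 0.\<close>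

definition lines_meeting_twice :: "point set \<Rightarrow> point set set" where
  "lines_meeting_twice B = {C. is_line C \<and> finite (C \<inter> B) \<and> card (C \<inter> B) \<le> 2}"

definition join :: "point \<Rightarrow> point \<Rightarrow> point set" where
  "join p q = (SOME C. is_line C \<and> p \<in> C \<and> q \<in> C)"

lemma join: "p \<noteq> q \<Longrightarrow> is_line (join p q) \<and> p \<in> join p q \<and> q \<in> join p q"
  unfolding join_def by (rule someI_ex) (meson ex_line_through)

lemma join_eq: "p \<noteq> q \<Longrightarrow> is_line C \<Longrightarrow> p \<in> C \<Longrightarrow> q \<in> C \<Longrightarrow> C = join p q"
  using join line_unique by metis

lemma card_le_2E:
  assumes "finite X" "card X \<le> 2" "X \<noteq> {}" obtains p q where "X = {p, q}"
proof -
  have "card X = 1 \<or> card X = 2" using assms by (metis One_nat_def Suc_1 card_0_eq le_SucE le_zero_eq)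
  then show ?thesis using that by (metis card_1_singletonE card_2_iff insert_absorb2)
qed

lemma card_insert_2_le: "card {p, q} \<le> 2"
  by (metis card_2_iff card_1_singleton_iff insert_absorb2 One_nat_def Suc_1 le_SucI order_refl)

lemma line_span2_two_points:
  assumes "is_line C" "p \<in> C" "q \<in> C" "p \<noteq> q"
  obtains v w where "indep v w" "C = span2 v w" "p = proj v" "q = proj w"
proof -
  obtain v where v: "v \<noteq> 0" "p = proj v" by (rule proj_cases)
  obtain w where w: "w \<noteq> 0" "q = proj w" by (rule proj_cases)
  have "indep v w" using v w assms by (simp add: indep_iff_proj)
  then show ?thesis using line_eq_span2[of C v w] assms v w that by metis
qed

lemma two_lines_meet:
  assumes "is_line C" "is_line D" "C \<noteq> D"
  obtains p where "C \<inter> D = {p}"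
proof -
  obtain a where a: "a \<noteq> 0" "D = zeros (lin a)" using assms(2) is_line_iff by blast
  have ns: "\<not> C \<subseteq> zeros (lin a)"
  proof
    assume s: "C \<subseteq> zeros (lin a)"
    have "irreducible (lin a)" using a irreducible_lin_iff by blast
    then have "C = zeros (lin a)" using line_in_irreducible(2)[OF homogeneous_lin _ _ assms(1) s] by simp
    then show False using a assms(3) by simp
  qed
  note f = line_inter_zeros[OF homogeneous_lin assms(1) ns]
  have "card (C \<inter> D) = 1" using f a by (metis card_0_eq le_antisym less_one not_le order_refl)
  then show ?thesis using that card_1_singletonE by blast
qed

text \<open>Indexing the components by the type \<open>3\<close> lets one argument serve every
  choice of two of them. The condition \<open>not_dvd\<close> is what squarefreeness of the product
  provides.\<close>

locale three_curves =
  fixes b :: "3 \<Rightarrow> nat" and F :: "3 \<Rightarrow> poly3"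
  assumes hom: "homogeneous (b i) (F i)" and deg: "b i \<ge> 1" and irr: "irreducible (F i)"
    and node: "i \<noteq> j \<Longrightarrow> p \<in> zeros (F i) \<Longrightarrow> p \<in> zeros (F j) \<Longrightarrow> node (F 1 * F 2 * F 3) p"
    and not_dvd: "i \<noteq> j \<Longrightarrow> \<not> F i dvd F j"
begin

abbreviation "Z i \<equiv> zeros (F i)"

abbreviation "H \<equiv> lines_meeting_twice (\<Union>i. Z i)"

definition "N = (Z 1 \<inter> Z 2) \<union> (Z 1 \<inter> Z 3) \<union> (Z 2 \<inter> Z 3)"

lemma prod_perm: "i \<noteq> j \<Longrightarrow> k \<noteq> i \<Longrightarrow> k \<noteq> j \<Longrightarrow> F 1 * F 2 * F 3 = F i * F j * F k" for i j k :: 3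
  using three_cases[of i] three_cases[of j] three_cases[of k] by (auto simp: mult_ac)

lemma in_Z: "v \<noteq> 0 \<Longrightarrow> proj v \<in> Z i \<longleftrightarrow> eval3 (F i) v = 0"
  by (rule proj_in_zeros[OF hom])

text \<open>The quadratic term at a node on two components contains the value of the third equation
  as a factor.\<close>

lemma no_triple_point:
  assumes "i \<noteq> j" "k \<noteq> i" "k \<noteq> j" "p \<in> Z i" "p \<in> Z j" shows "p \<notin> Z k"
proof -
  obtain v where v: "v \<noteq> 0" "p = proj v" by (rule proj_cases)
  have "node (F i * F j * F k) (proj v)" using node[of i j p] prod_perm[of i j k] assms v by simp
  then show ?thesis
    using node_transversal(1)[OF hom hom _ v(1), of i j "F k"] assms v by (simp add: in_Z)
qed

lemma transversal:
  assumes "i \<noteq> j" "v \<noteq> 0" "proj v \<in> Z i" "proj v \<in> Z j"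
  shows "grad (F j) v \<noteq> 0"
    "indep v w \<Longrightarrow> dot (grad (F i) v) w = 0 \<Longrightarrow> dot (grad (F j) v) w \<noteq> 0"
proof -
  obtain k where k: "k \<noteq> i" "k \<noteq> j" using third_index assms(1) by blast
  have "node (F i * F j * F k) (proj v)" using node[of i j "proj v"] prod_perm[of i j k] assms k by simp
  note t = node_transversal(3,4)[OF hom hom this assms(2)]
  show "grad (F j) v \<noteq> 0" "indep v w \<Longrightarrow> dot (grad (F i) v) w = 0 \<Longrightarrow> dot (grad (F j) v) w \<noteq> 0"
    using t assms by (simp_all add: in_Z)
qed

lemma finite_N: "finite N"
  unfolding N_def using finite_zeros_inter[OF hom deg irr hom deg irr not_dvd] by simp

lemma line_not_component:
  assumes "C \<in> H" shows "\<not> C \<subseteq> Z i"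
proof
  assume "C \<subseteq> Z i"
  then have "C \<inter> (\<Union>i. Z i) = C" by blast
  then show False using assms infinite_line by (auto simp: lines_meeting_twice_def)
qed

lemma tangent_if_single:
  assumes "is_line C" "b j \<ge> 2" "i \<noteq> j" "C \<inter> Z j = {p}" "p \<in> Z i"
  shows "C = tangent_line (F j) p"
proof -
  obtain v where v: "v \<noteq> 0" "p = proj v" by (rule proj_cases)
  obtain w where w: "indep v w" "C = span2 v w" using line_obtain_other[OF assms(1)] v assms(4) by blast
  have "dot (grad (F j) v) w = 0"
    using dot_grad_eq_0_if_single(1)[OF hom w(1) _ assms(2)] assms w v by simp
  moreover have "grad (F j) v \<noteq> 0" using transversal(1)[of i j v] assms v by blast
  moreover have "eval3 (F j) v = 0" using assms v in_Z by blast
  ultimately show ?thesis using span2_eq_tangent_line[OF hom deg w(1)] w v by simp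
qed

text \<open>Each component meets the line in a nonempty part of \<open>{p, q}\<close>. The
  conclusion avoids \<open>j = 1\<close> because the first component may be a line, to which
  tangency does not apply.\<close>

lemma meeting_twice_cases:
  assumes "C \<in> H"
  obtains i j p where "j \<noteq> 1" "i \<noteq> j" "C \<inter> Z j = {p}" "p \<in> Z i"
proof -
  have C: "is_line C" "finite (C \<inter> (\<Union>i. Z i))" "card (C \<inter> (\<Union>i. Z i)) \<le> 2"
    using assms by (auto simp: lines_meeting_twice_def)
  have ne: "C \<inter> Z i \<noteq> {}" for i
    using line_inter_zeros(3)[OF hom C(1) line_not_component[OF assms] deg] .
  then obtain p q where pq: "C \<inter> (\<Union>i. Z i) = {p, q}" using card_le_2E[OF C(2,3)] by blast
  have sub: "C \<inter> Z i \<subseteq> {p, q}" for i using pq by blast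
  have nt: "x \<in> Z 1 \<Longrightarrow> x \<in> Z 2 \<Longrightarrow> x \<in> Z 3 \<Longrightarrow> False" for x
    using no_triple_point[of 1 2 3 x] by simp
  have s: "C \<inter> Z i = {p} \<or> C \<inter> Z i = {q} \<or> (p \<in> Z i \<and> q \<in> Z i)" for i
    using sub[of i] ne[of i] by blast
  \<comment> \<open>The second and third components cannot both contain \<open>p\<close> and
    \<open>q\<close>, or a point of the first would be triple. If one of them meets the line in a
    single point that lies on no other component, the remaining two both pass only through the other
    point.\<close>
  have ex: "\<exists>p. (C \<inter> Z 2 = {p} \<and> (p \<in> Z 1 \<or> p \<in> Z 3)) \<or> (C \<inter> Z 3 = {p} \<and> (p \<in> Z 1 \<or> p \<in> Z 2))"
    using s[of 1] s[of 2] s[of 3] nt[of p] nt[of q] by blast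
  then show ?thesis
    using that[of 2 1] that[of 2 3] that[of 3 1] that[of 3 2] three_distinct by metis
qed

lemma N_iff: "i \<noteq> j \<Longrightarrow> p \<in> Z i \<Longrightarrow> p \<in> Z j \<Longrightarrow> p \<in> N"
  using three_cases[of i] three_cases[of j] by (auto simp: N_def)

theorem meeting_twice_nodal_tangents:
  assumes "b 2 \<ge> 2" "b 3 \<ge> 2"
  shows "finite (H)" "card (H) \<le> 2 * card N"
proof -
  define T where "T p = (\<lambda>j. tangent_line (F j) p) ` {j. p \<in> Z j}" for p
  have sub: "H \<subseteq> (\<Union>p\<in>N. T p)"
  proof
    fix C assume C: "C \<in> H"
    obtain i j p where ijp: "j \<noteq> 1" "i \<noteq> j" "C \<inter> Z j = {p}" "p \<in> Z i"
      using meeting_twice_cases[OF C] by metis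
    have "b j \<ge> 2" using ijp(1) assms three_cases[of j] by auto
    then have "C = tangent_line (F j) p"
      using tangent_if_single ijp C by (auto simp: lines_meeting_twice_def)
    moreover have "p \<in> N" using N_iff ijp by blast
    ultimately show "C \<in> (\<Union>p\<in>N. T p)" using ijp by (auto simp: T_def)
  qed
  have "card (T p) \<le> 2" for p
  proof -
    \<comment> \<open>As some component misses \<open>p\<close>, at most two tangents are attached
      to it.\<close>
    obtain k where k: "p \<notin> Z k" using no_triple_point[of 1 2 3 p] by auto
    obtain i j :: 3 where ij: "\<And>l. l = k \<or> l = i \<or> l = j" using three_cases by metis
    have "{j. p \<in> Z j} \<subseteq> {i, j}"
    proof
      fix l assume "l \<in> {j. p \<in> Z j}"
      then show "l \<in> {i, j}" using k ij[of l] by auto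
    qed
    then have "card {j. p \<in> Z j} \<le> card {i, j}" by (intro card_mono) auto
    also have "\<dots> \<le> 2" by (rule card_insert_2_le)
    finally show ?thesis unfolding T_def using card_image_le[of "{j. p \<in> Z j}" "\<lambda>j. tangent_line (F j) p"] by simp
  qed
  then have "card (\<Union>p\<in>N. T p) \<le> (\<Sum>p\<in>N. 2)"
    by (intro order.trans[OF card_UN_le[OF finite_N]] sum_mono)
  moreover have fin: "finite (\<Union>p\<in>N. T p)" using finite_N by (simp add: T_def)
  ultimately show "card (H) \<le> 2 * card N"
    using card_mono[OF fin sub] by simp
  show "finite (H)" using finite_subset[OF sub fin] .
qed

end

subsection \<open>Two of the components are lines\<close>

locale two_lines_and_curve = three_curves +
  assumes b1: "b 1 = 1" and b2: "b 2 = 1" and b3: "b 3 \<ge> 2"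
begin

lemma is_line_Z: "is_line (Z 1)" "is_line (Z 2)"
  using hom[of 1] hom[of 2] irr b1 b2 unfolding integral_curve_def by auto

lemma line_not_in_Z3: "is_line C \<Longrightarrow> \<not> C \<subseteq> Z 3"
  using line_in_irreducible(1)[OF hom deg irr, of C 3] b3 by auto

text \<open>If the two lines coincided, a point where they meet the third component would be
  triple.\<close>

lemma Z1_neq_Z2: "Z 1 \<noteq> Z 2"
proof
  assume "Z 1 = Z 2"
  moreover obtain p where "p \<in> Z 1 \<inter> Z 3"
    using line_inter_zeros(3)[OF hom[of 3] is_line_Z(1) line_not_in_Z3[OF is_line_Z(1)] deg] by blast
  ultimately show False using no_triple_point[of 1 2 3 p] by auto
qed

definition "centre = (THE p. Z 1 \<inter> Z 2 = {p})"

lemma centre: "Z 1 \<inter> Z 2 = {centre}"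
proof -
  obtain p where p: "Z 1 \<inter> Z 2 = {p}" using two_lines_meet[OF is_line_Z Z1_neq_Z2] by blast
  then have "centre = p" unfolding centre_def by (intro the_equality) auto
  then show ?thesis using p by simp
qed

lemma centre_notin_Z3: "centre \<notin> Z 3"
  using no_triple_point[of 1 2 3 centre] centre by auto

text \<open>The centre is not on the curve, so this \<open>tangent_line\<close> is its polar line.\<close>

definition "polar = Z 3 \<inter> tangent_line (F 3) centre"

lemma polar_eq:
  assumes u: "u \<noteq> 0" "centre = proj u"
  shows "polar = Z 3 \<inter> zeros (lin (grad (F 3) u))" "is_line (zeros (lin (grad (F 3) u)))"
    "centre \<notin> zeros (lin (grad (F 3) u))"
proof -
  show "polar = Z 3 \<inter> zeros (lin (grad (F 3) u))"
    using tangent_line_proj[OF hom deg u(1)] u by (simp add: polar_def)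
  \<comment> \<open>Euler's identity at a point off the curve: the polar is a genuine line and
    misses the centre.\<close>
  have "dot (grad (F 3) u) u \<noteq> 0"
    using dot_grad_self[OF hom, of 3 u] deg[of 3] centre_notin_Z3 u in_Z by auto
  then show "centre \<notin> zeros (lin (grad (F 3) u))"
    using u by (simp add: proj_in_zeros[OF homogeneous_lin])
  have "grad (F 3) u \<noteq> 0" using \<open>dot (grad (F 3) u) u \<noteq> 0\<close> by (auto simp: dot_def)
  then show "is_line (zeros (lin (grad (F 3) u)))" using is_line_iff by blast
qed

lemma polar_card: "finite polar" "card polar \<le> b 3" "polar \<noteq> {}"
proof -
  obtain u where u: "u \<noteq> 0" "centre = proj u" by (rule proj_cases)
  note p = polar_eq[OF u]
  show "finite polar" "card polar \<le> b 3" "polar \<noteq> {}"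
    using line_inter_zeros[OF hom[of 3] p(2) line_not_in_Z3[OF p(2)]] deg
    by (simp_all add: p(1) Int_commute)
qed

text \<open>On such a line the form restricts to \<open>c * t ^ b 3\<close>, and the vanishing of its coefficient of degree
  \<open>b 3 - 1\<close> is the equation of the polar line.\<close>

lemma contact_in_polar:
  assumes C: "is_line C" "centre \<in> C" "C \<inter> Z 3 = {q}"
  shows "q \<in> polar"
proof -
  have "q \<noteq> centre" using C centre_notin_Z3 by blast
  then obtain v w where vw: "indep v w" "C = span2 v w" "q = proj v" "centre = proj w"
    using line_span2_two_points[OF C(1), of q centre] C by blast
  have "dot (grad (F 3) w) v = 0"
    using dot_grad_eq_0_if_single(2)[OF hom vw(1) _ b3] C vw by simp
  then show ?thesis
    using polar_eq(1)[of w] vw indep_nonzero[OF vw(1)] C(3) by (auto simp: proj_in_zeros[OF homogeneous_lin])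
qed

definition "nodes3 = Z 3 \<inter> (Z 1 \<union> Z 2)"

lemma nodes3_card: "finite nodes3" "card nodes3 \<le> 2 * b 3"
proof -
  note 1 = line_inter_zeros[OF hom[of 3] is_line_Z(1) line_not_in_Z3[OF is_line_Z(1)]]
  note 2 = line_inter_zeros[OF hom[of 3] is_line_Z(2) line_not_in_Z3[OF is_line_Z(2)]]
  have e: "nodes3 = (Z 1 \<inter> Z 3) \<union> (Z 2 \<inter> Z 3)" by (auto simp: nodes3_def)
  show "finite nodes3" using 1 2 e by simp
  show "card nodes3 \<le> 2 * b 3"
    unfolding e using card_Un_le[of "Z 1 \<inter> Z 3" "Z 2 \<inter> Z 3"] 1(2) 2(2) by simp
qed

text \<open>Away from the centre, the points on the two lines are distinct and already exhaust the
  two that are permitted.\<close>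

lemma meeting_twice_points:
  assumes C: "C \<in> H" and "centre \<notin> C"
  obtains p q where "p \<noteq> q" "C \<inter> Z 1 = {p}" "C \<inter> Z 2 = {q}" "C \<inter> Z 3 \<subseteq> {p, q}"
proof -
  have L: "is_line C" "finite (C \<inter> (\<Union>i. Z i))" "card (C \<inter> (\<Union>i. Z i)) \<le> 2"
    using C by (auto simp: lines_meeting_twice_def)
  have n: "C \<noteq> Z 1" "C \<noteq> Z 2" using line_not_component[OF C] by blast+
  obtain p where p: "C \<inter> Z 1 = {p}" using two_lines_meet[OF L(1) is_line_Z(1) n(1)] .
  obtain q where q: "C \<inter> Z 2 = {q}" using two_lines_meet[OF L(1) is_line_Z(2) n(2)] .
  note pq = p q
  have ne: "p \<noteq> q"
  proof
    assume "p = q"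
    then have "p \<in> Z 1 \<inter> Z 2" "p \<in> C" using pq by blast+
    then show False using centre assms(2) by simp
  qed
  then have "card {p, q} = 2" by simp
  moreover have "{p, q} \<subseteq> C \<inter> (\<Union>i. Z i)" using pq by blast
  ultimately have "C \<inter> (\<Union>i. Z i) = {p, q}" using L by (metis card_seteq)
  then show ?thesis using that[OF ne pq] by blast
qed

text \<open>The centre uses up one of the two permitted points and is not on the third component,
  which is left with just one.\<close>

lemma meeting_twice_through_centre:
  assumes C: "C \<in> H" and c: "centre \<in> C"
  obtains q where "C \<inter> Z 3 = {q}"
proof -
  have L: "is_line C" "finite (C \<inter> (\<Union>i. Z i))" "card (C \<inter> (\<Union>i. Z i)) \<le> 2"
    using C by (auto simp: lines_meeting_twice_def)
  have "insert centre (C \<inter> Z 3) \<subseteq> C \<inter> (\<Union>i. Z i)" using c centre by blast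
  then have "card (insert centre (C \<inter> Z 3)) \<le> 2" using L card_mono order.trans by metis
  moreover have "finite (C \<inter> Z 3)" using L(2) by (rule finite_subset[rotated]) blast
  ultimately have "card (C \<inter> Z 3) \<le> 1" using centre_notin_Z3 by simp
  moreover have "C \<inter> Z 3 \<noteq> {}" using line_inter_zeros(3)[OF hom L(1) line_not_in_Z3[OF L(1)] deg] .
  ultimately have "card (C \<inter> Z 3) = 1" using \<open>finite (C \<inter> Z 3)\<close>
    by (metis card_0_eq le_antisym less_one not_le)
  then show ?thesis using that card_1_singletonE by blast
qed

lemma nodes3D: "p \<in> nodes3 \<Longrightarrow> p \<in> Z 3 \<and> (\<exists>i. i \<noteq> 3 \<and> p \<in> Z i)"
  unfolding nodes3_def using three_distinct(2,3) by blast

lemma span2_eq_tangent_at_node: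
  assumes "indep v w" "proj v \<in> nodes3" "dot (grad (F 3) v) w = 0"
  shows "span2 v w = tangent_line (F 3) (proj v)"
proof -
  have v: "v \<noteq> 0" using indep_nonzero(1)[OF assms(1)] .
  obtain i where "i \<noteq> 3" "proj v \<in> Z i" "proj v \<in> Z 3" using nodes3D[OF assms(2)] by blast
  then have "grad (F 3) v \<noteq> 0" "eval3 (F 3) v = 0" using transversal(1)[of i 3 v] v in_Z by simp_all
  then show ?thesis using span2_eq_tangent_line[OF hom deg assms(1)] assms(3) by blast
qed

theorem meeting_twice_cubic_or_more:
  assumes "b 3 \<ge> 3"
  shows "finite (H)" "card (H) \<le> 3 * b 3 * (b 3 - 2)"
proof -
  let ?S = "tangent_line (F 3) ` nodes3 \<union> join centre ` polar"
  have sub: "H \<subseteq> ?S"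
  proof
    fix C assume C: "C \<in> H"
    then have L: "is_line C" by (auto simp: lines_meeting_twice_def)
    show "C \<in> ?S"
    proof (cases "centre \<in> C")
      case True
      obtain q where q: "C \<inter> Z 3 = {q}" using meeting_twice_through_centre[OF C True] .
      have "C = join centre q" using join_eq[OF _ L] True q centre_notin_Z3 by blast
      then show ?thesis using contact_in_polar[OF L True q] by blast
    next
      case False
      obtain p q where pq: "p \<noteq> q" "C \<inter> Z 1 = {p}" "C \<inter> Z 2 = {q}" "C \<inter> Z 3 \<subseteq> {p, q}"
        using meeting_twice_points[OF C False] .
      obtain v w where vw: "indep v w" "C = span2 v w" "p = proj v" "q = proj w"
        using line_span2_two_points[OF L, of p q] pq by blast
      note nz = indep_nonzero[OF vw(1)]
      have pZ: "p \<in> Z 1" "q \<in> Z 2" using pq by blast+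
      obtain c m where cm: "c \<noteq> 0" "m \<le> b 3" "along (F 3) v w = monom c m"
        using along_eq_monom[OF hom vw(1), of 3] line_not_in_Z3[OF L] pq vw by metis
      \<comment> \<open>The multiplicities at \<open>p\<close> and \<open>q\<close> are
        \<open>m\<close> and \<open>b 3 - m\<close>. As \<open>b 3\<close> is at least 3, one of
        them is at least 2, and the line is tangent there.\<close>
      show ?thesis
      proof (cases "m \<ge> 2")
        case True
        have "eval3 (F 3) v = 0" using coeff_along_0[of "F 3" v w] cm True by simp
        then have "p \<in> nodes3" using pZ vw nz in_Z by (simp add: nodes3_def)
        moreover have "dot (grad (F 3) v) w = 0" using coeff_along_1[of "F 3" v w] cm True by simp
        ultimately have "C = tangent_line (F 3) p" using span2_eq_tangent_at_node vw by blast
        then show ?thesis using \<open>p \<in> nodes3\<close> by blast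
      next
        case False
        have "eval3 (F 3) w = 0" using coeff_along_top[OF hom, of 3 v w] cm False assms by simp
        then have "q \<in> nodes3" using pZ vw nz in_Z by (simp add: nodes3_def)
        moreover have "coeff (along (F 3) w v) (Suc 0) = 0"
          using coeff_along_swap[OF hom, of 1 3 w v] cm False assms by simp
        then have "dot (grad (F 3) w) v = 0" by (simp add: coeff_along_1)
        ultimately have "span2 w v = tangent_line (F 3) q"
          using span2_eq_tangent_at_node[OF indep_sym[OF vw(1)]] vw by blast
        moreover have "C = span2 w v" using line_eq_span2[OF L indep_sym[OF vw(1)]] vw by simp
        ultimately show ?thesis using \<open>q \<in> nodes3\<close> by blast
      qed
    qed
  qed
  have fin: "finite ?S" using nodes3_card polar_card by simp
  show "finite (H)" using finite_subset[OF sub fin] .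
  have "card (H) \<le> card ?S" using card_mono[OF fin sub] .
  also have "\<dots> \<le> card (tangent_line (F 3) ` nodes3) + card (join centre ` polar)" by (rule card_Un_le)
  also have "\<dots> \<le> 2 * b 3 + b 3"
    using card_image_le[OF nodes3_card(1), of "tangent_line (F 3)"] card_image_le[OF polar_card(1), of "join centre"]
      nodes3_card(2) polar_card(2) by linarith
  \<comment> \<open>The count is \<open>3 * b 3\<close>; the factor \<open>b 3 - 2\<close> is at
    least 1.\<close>
  also have "\<dots> \<le> 3 * b 3 * (b 3 - 2)" using assms by (cases "b 3 - 2") auto
  finally show "card (H) \<le> 3 * b 3 * (b 3 - 2)" .
qed

end

subsection \<open>Two lines and a conic\<close>

locale two_lines_and_conic = two_lines_and_curve +
  assumes conic: "b 3 = 2"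
begin

lemma hom3: "homogeneous 2 (F 3)"
  using hom[of 3] conic by simp

lemma Un_Z: "(\<Union>i. Z i) = Z 1 \<union> Z 2 \<union> Z 3"
  by (simp add: UNIV_3 Un_assoc)

lemma line_meets_Z12:
  assumes "is_line C" "C \<noteq> Z i" "i = 1 \<or> i = 2" obtains r where "C \<inter> Z i = {r}"
  using assms is_line_Z two_lines_meet[of C "Z i"] by auto

lemma card_inter_conic: "is_line C \<Longrightarrow> finite (C \<inter> Z 3)" "is_line C \<Longrightarrow> card (C \<inter> Z 3) \<le> 2"
    "is_line C \<Longrightarrow> C \<inter> Z 3 \<noteq> {}"
  using line_inter_zeros[OF hom3 _ line_not_in_Z3] by auto

text \<open>Towards another point of the conic, the restriction at a singular point has no term at
  all, so the conic would contain a line. Another point exists because the two lines meet the conic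
  in different points.\<close>

lemma conic_smooth:
  assumes v: "v \<noteq> 0" "proj v \<in> Z 3" shows "grad (F 3) v \<noteq> 0"
proof
  assume g: "grad (F 3) v = 0"
  obtain p where p: "p \<in> Z 1" "p \<in> Z 3" using card_inter_conic(3)[OF is_line_Z(1)] by blast
  obtain q where q: "q \<in> Z 2" "q \<in> Z 3" using card_inter_conic(3)[OF is_line_Z(2)] by blast
  have "p \<noteq> q" using no_triple_point[of 1 2 3 p] p q by auto
  then obtain r where r: "r \<noteq> proj v" "r \<in> Z 3" using p q by metis
  obtain w where w: "w \<noteq> 0" "r = proj w" by (rule proj_cases)
  have vw: "indep v w" using v w r by (simp add: indep_iff_proj)
  have "along (F 3) v w = 0"
    using v w r in_Z g by (simp add: along_conic[OF hom3] dot_def)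
  then have "span2 v w \<subseteq> Z 3" using line_subset_zeros_iff[OF hom3 vw] by simp
  then show False using line_not_in_Z3[OF is_line_span2[OF vw]] by blast
qed

lemma conic_tangent:
  assumes v: "v \<noteq> 0" "proj v \<in> Z 3"
  shows "is_line (tangent_line (F 3) (proj v))" "tangent_line (F 3) (proj v) \<inter> Z 3 = {proj v}"
proof -
  note g = conic_smooth[OF v]
  have T: "tangent_line (F 3) (proj v) = zeros (lin (grad (F 3) v))"
    using tangent_line_proj[OF hom3 _ v(1)] by simp
  then show L: "is_line (tangent_line (F 3) (proj v))" using is_line_iff g by blast
  have v0: "eval3 (F 3) v = 0" using in_Z v by blast
  then have "dot (grad (F 3) v) v = 0" using dot_grad_self[OF hom3, of v] by simp
  then have "proj v \<in> tangent_line (F 3) (proj v)" using T v by (simp add: proj_in_zeros[OF homogeneous_lin])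
  then obtain w where w: "indep v w" "tangent_line (F 3) (proj v) = span2 v w"
    using line_obtain_other[OF L _ v(1)] by metis
  have "proj w \<in> zeros (lin (grad (F 3) v))" using w T proj_in_span2(2) by metis
  then have d: "dot (grad (F 3) v) w = 0"
    using indep_nonzero(2)[OF w(1)] by (simp add: proj_in_zeros[OF homogeneous_lin])
  have a: "along (F 3) v w = [:0, 0, eval3 (F 3) w:]"
    using v0 d by (simp add: along_conic[OF hom3])
  have "along (F 3) v w \<noteq> 0" using line_subset_zeros_iff[OF hom3 w(1)] line_not_in_Z3[OF L] w(2) by simp
  then have w0: "eval3 (F 3) w \<noteq> 0" using a by auto
  show "tangent_line (F 3) (proj v) \<inter> Z 3 = {proj v}"
  proof (intro equalityI subsetI)
    fix x assume x: "x \<in> tangent_line (F 3) (proj v) \<inter> Z 3"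
    have "proj w \<notin> Z 3" using w0 in_Z indep_nonzero(2)[OF w(1)] by simp
    then have "x \<noteq> proj w" using x by blast
    then obtain t where t: "x = proj (v + t *s w)" using x w(2) span2_cases[of x v w] by auto
    then have "poly (along (F 3) v w) t = 0" using x in_Z proj_add_neq(1)[OF w(1)] by (simp add: poly_along)
    then have "t = 0" using a w0 by simp
    then show "x \<in> {proj v}" using t by simp
  qed (use w v in auto)
qed

lemma tangent_at:
  assumes "p \<in> Z 3"
  shows "is_line (tangent_line (F 3) p)" "tangent_line (F 3) p \<inter> Z 3 = {p}" "smooth_point (F 3) p"
proof -
  obtain v where v: "v \<noteq> 0" "p = proj v" by (rule proj_cases)
  then show "is_line (tangent_line (F 3) p)" "tangent_line (F 3) p \<inter> Z 3 = {p}"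
    using conic_tangent[of v] assms by simp_all
  show "smooth_point (F 3) p"
    using smooth_point_proj[OF hom3 _ v(1)] conic_smooth[OF v(1)] assms v in_Z by simp
qed

lemma eq_tangent_line:
  assumes "is_line C" "C \<inter> Z 3 = {p}" shows "C = tangent_line (F 3) p"
proof -
  obtain v where v: "v \<noteq> 0" "p = proj v" by (rule proj_cases)
  obtain w where w: "indep v w" "C = span2 v w" using line_obtain_other[OF assms(1)] v assms(2) by blast
  have "dot (grad (F 3) v) w = 0"
    using dot_grad_eq_0_if_single(1)[OF hom3 w(1)] assms w v by simp
  moreover have "p \<in> Z 3" using assms by blast
  ultimately show ?thesis
    using span2_eq_tangent_line[OF hom3 _ w(1)] conic_smooth[OF v(1)] w v in_Z by simp
qed

lemma inj_tangent: "inj_on (tangent_line (F 3)) (Z 3)"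
proof (rule inj_onI)
  fix p q assume pq: "p \<in> Z 3" "q \<in> Z 3" "tangent_line (F 3) p = tangent_line (F 3) q"
  have "{p} = {q}" using tangent_at(2)[OF pq(1)] tangent_at(2)[OF pq(2)] unfolding pq(3) by (rule trans[OF sym])
  then show "p = q" by simp
qed

text \<open>A single intersection would be a tangency of the line with the conic, contrary to
  transversality at a node.\<close>

lemma card_line_inter_conic:
  assumes i: "i = 1 \<or> i = 2" shows "card (Z i \<inter> Z 3) = 2"
proof -
  have L: "is_line (Z i)" using i is_line_Z by auto
  have "card (Z i \<inter> Z 3) \<noteq> 0" using card_inter_conic(1,3)[OF L] by simp
  moreover have "card (Z i \<inter> Z 3) \<noteq> 1"
  proof
    assume "card (Z i \<inter> Z 3) = 1"
    then obtain p where p: "Z i \<inter> Z 3 = {p}" using card_1_singletonE by blast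
    then have pZ: "p \<in> Z i" "p \<in> Z 3" by blast+
    obtain v where v: "v \<noteq> 0" "p = proj v" by (rule proj_cases)
    obtain w where w: "indep v w" "Z i = span2 v w" using line_obtain_other[OF L] v pZ by metis
    have "dot (grad (F 3) v) w = 0"
      using dot_grad_eq_0_if_single(1)[OF hom3 w(1)] p w v by simp
    moreover have "along (F i) v w = 0" using line_subset_zeros_iff[OF hom w(1), of i] w by simp
    then have "dot (grad (F i) v) w = 0" by (simp flip: coeff_along_1)
    ultimately show False using transversal(2)[of i 3 v w] w v pZ i by auto
  qed
  ultimately show ?thesis using card_inter_conic(2)[OF L] by linarith
qed

text \<open>Reciprocity of poles and polars: for a form of degree 2, degrees 1 and d - 1 coincide,
  so the first-order coefficient is symmetric in the two points.\<close>

lemma in_polar_iff: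
  assumes "p \<in> Z 3" shows "p \<in> polar \<longleftrightarrow> centre \<in> tangent_line (F 3) p"
proof -
  obtain v where v: "v \<noteq> 0" "p = proj v" by (rule proj_cases)
  obtain u where u: "u \<noteq> 0" "centre = proj u" by (rule proj_cases)
  have "p \<in> polar \<longleftrightarrow> dot (grad (F 3) u) v = 0"
    using polar_eq(1)[OF u] assms v by (simp add: proj_in_zeros[OF homogeneous_lin])
  also have "dot (grad (F 3) u) v = dot (grad (F 3) v) u"
    using coeff_along_swap[OF hom3, of 1 u v] by (simp add: coeff_along_1)
  also have "dot (grad (F 3) v) u = 0 \<longleftrightarrow> centre \<in> tangent_line (F 3) p"
    using tangent_line_proj[OF hom3 _ v(1)] u v by (simp add: proj_in_zeros[OF homogeneous_lin])
  finally show ?thesis .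
qed

text \<open>If the polar met the conic once, it would be the tangent at that point, and reciprocity
  would put the centre on its own polar.\<close>

lemma card_polar: "card polar = 2"
proof -
  obtain u where u: "u \<noteq> 0" "centre = proj u" by (rule proj_cases)
  note pe = polar_eq[OF u]
  have "card polar \<noteq> 0" using polar_card by simp
  moreover have "card polar \<noteq> 1"
  proof
    assume "card polar = 1"
    then obtain q where q: "polar = {q}" using card_1_singletonE by blast
    then have s: "zeros (lin (grad (F 3) u)) \<inter> Z 3 = {q}" using pe(1) by (simp add: Int_commute)
    then have "zeros (lin (grad (F 3) u)) = tangent_line (F 3) q" using eq_tangent_line[OF pe(2)] by blast
    moreover have "q \<in> Z 3" "q \<in> polar" using s q by blast+
    ultimately show False using in_polar_iff pe(3) by simp
  qed
  ultimately show ?thesis using polar_card(2) conic by linarith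
qed

section \<open>The four chords and six tangents of the conic\<close>

definition "Chords = {C. is_line C \<and> C \<noteq> Z 1 \<and> C \<noteq> Z 2 \<and>
   (\<exists>p\<in>Z 3 \<inter> (Z 1 \<union> Z 2). \<exists>q\<in>Z 3 \<inter> (Z 1 \<union> Z 2). p \<noteq> q \<and> p \<in> C \<and> q \<in> C)}"

definition "Tangents = {C. is_line C \<and> (\<exists>p. smooth_point (F 3) p \<and> C = tangent_line (F 3) p) \<and> C \<inter> N \<noteq> {}}"

lemma Z12_disjoint: "p \<in> Z 3 \<Longrightarrow> p \<in> Z 1 \<Longrightarrow> p \<notin> Z 2"
  using no_triple_point[of 1 3 2 p] by simp

lemma join_conic:
  assumes p: "p \<in> Z 1 \<inter> Z 3" and q: "q \<in> Z 2 \<inter> Z 3"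
  shows "p \<noteq> q" "is_line (join p q)" "join p q \<inter> Z 3 = {p, q}" "join p q \<inter> Z 1 = {p}" "join p q \<inter> Z 2 = {q}"
proof -
  show pq: "p \<noteq> q" using p q Z12_disjoint by blast
  note j = join[OF pq]
  show L: "is_line (join p q)" using j by blast
  have s: "{p, q} \<subseteq> join p q \<inter> Z 3" using j p q by blast
  have "card {p, q} = 2" using pq by simp
  then show "join p q \<inter> Z 3 = {p, q}"
    using card_seteq[OF card_inter_conic(1)[OF L] s] card_inter_conic(2)[OF L] by simp
  have "join p q \<noteq> Z 1" using j q Z12_disjoint[of q] by auto
  then obtain r where "join p q \<inter> Z 1 = {r}" using line_meets_Z12[OF L, of 1] by blast
  moreover have "p \<in> join p q \<inter> Z 1" using j p by blast
  ultimately show "join p q \<inter> Z 1 = {p}" by simp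
  have "join p q \<noteq> Z 2" using j p Z12_disjoint[of p] by auto
  then obtain r where "join p q \<inter> Z 2 = {r}" using line_meets_Z12[OF L, of 2] by blast
  moreover have "q \<in> join p q \<inter> Z 2" using j q by blast
  ultimately show "join p q \<inter> Z 2 = {q}" by simp
qed

text \<open>A line through two points of the same component line is that line, so a chord joins a
  point on \<open>Z 1\<close> to one on \<open>Z 2\<close>. There are two choices for each, and the
  chord determines both.\<close>

lemma Chords_eq: "Chords = (\<lambda>(p, q). join p q) ` ((Z 1 \<inter> Z 3) \<times> (Z 2 \<inter> Z 3))"
proof (intro equalityI subsetI)
  fix C assume "C \<in> Chords"
  then obtain p q where C: "is_line C" "C \<noteq> Z 1" "C \<noteq> Z 2" and pq: "p \<noteq> q" "p \<in> C" "q \<in> C"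
    and p: "p \<in> Z 3" "p \<in> Z 1 \<or> p \<in> Z 2" and q: "q \<in> Z 3" "q \<in> Z 1 \<or> q \<in> Z 2"
    by (auto simp: Chords_def)
  have "\<not> (p \<in> Z 1 \<and> q \<in> Z 1)" using line_unique[OF C(1) is_line_Z(1) pq(1)] pq C by blast
  moreover have "\<not> (p \<in> Z 2 \<and> q \<in> Z 2)" using line_unique[OF C(1) is_line_Z(2) pq(1)] pq C by blast
  ultimately have "(p, q) \<in> (Z 1 \<inter> Z 3) \<times> (Z 2 \<inter> Z 3) \<or> (q, p) \<in> (Z 1 \<inter> Z 3) \<times> (Z 2 \<inter> Z 3)"
    using p q by blast
  moreover have "C = join p q" "C = join q p" using join_eq[OF _ C(1)] pq by metis+
  ultimately show "C \<in> (\<lambda>(p, q). join p q) ` ((Z 1 \<inter> Z 3) \<times> (Z 2 \<inter> Z 3))" by (metis (mono_tags, lifting) case_prod_conv image_eqI)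
next
  fix C assume "C \<in> (\<lambda>(p, q). join p q) ` ((Z 1 \<inter> Z 3) \<times> (Z 2 \<inter> Z 3))"
  then obtain p q where C: "C = join p q" and p: "p \<in> Z 1 \<inter> Z 3" and q: "q \<in> Z 2 \<inter> Z 3" by auto
  note j = join_conic[OF p q]
  have "p \<in> C" "q \<in> C" "p \<in> Z 3" "q \<in> Z 3" "p \<in> Z 1 \<union> Z 2" "q \<in> Z 1 \<union> Z 2" using j(3) p q C by blast+
  moreover have "C \<noteq> Z 1" "C \<noteq> Z 2"
    using infinite_line[OF j(2)] j(4,5) C by auto
  ultimately show "C \<in> Chords" using j(1,2) C by (auto simp: Chords_def)
qed

lemma card_Chords: "card Chords = 4"
proof -
  have "inj_on (\<lambda>(p, q). join p q) ((Z 1 \<inter> Z 3) \<times> (Z 2 \<inter> Z 3))"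
  proof (rule inj_onI, clarsimp)
    fix p q p' q' assume "p \<in> Z 1" "p \<in> Z 3" "q \<in> Z 2" "q \<in> Z 3" "p' \<in> Z 1" "p' \<in> Z 3" "q' \<in> Z 2" "q' \<in> Z 3"
      and e: "join p q = join p' q'"
    then show "p = p' \<and> q = q'" using join_conic(4,5)[of p q] join_conic(4,5)[of p' q'] by auto
  qed
  then show ?thesis unfolding Chords_eq using card_line_inter_conic by (simp add: card_image card_cartesian_product)
qed

lemma N_eq: "N = insert centre nodes3"
  using centre by (auto simp: N_def nodes3_def)

text \<open>A tangent meets the conic only at its point of contact. A point of \<open>N\<close> on
  it is therefore this contact point or the centre; by reciprocity the latter means contact on the
  polar.\<close>

lemma Tangents_eq: "Tangents = tangent_line (F 3) ` (nodes3 \<union> polar)"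
proof (intro equalityI subsetI)
  fix C assume "C \<in> Tangents"
  then obtain p where p: "smooth_point (F 3) p" "C = tangent_line (F 3) p" and n: "C \<inter> N \<noteq> {}"
    by (auto simp: Tangents_def)
  have pZ: "p \<in> Z 3" using p(1) by (simp add: smooth_point_def)
  note t = tangent_at[OF pZ]
  obtain n where n: "n \<in> C" "n = centre \<or> n \<in> nodes3" using n N_eq by auto
  have "p \<in> nodes3 \<union> polar"
  proof (cases "n = centre")
    case True
    then show ?thesis using in_polar_iff[OF pZ] n p by simp
  next
    case False
    then have "n \<in> nodes3" using n by blast
    moreover from this have "n \<in> C \<inter> Z 3" using n by (simp add: nodes3_def)
    then have "n = p" using t(2) p(2) by simp
    ultimately show ?thesis by blast
  qed
  then show "C \<in> tangent_line (F 3) ` (nodes3 \<union> polar)" using p by blast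
next
  fix C assume "C \<in> tangent_line (F 3) ` (nodes3 \<union> polar)"
  then obtain p where p: "p \<in> nodes3 \<union> polar" "C = tangent_line (F 3) p" by blast
  then have pZ: "p \<in> Z 3" by (auto simp: nodes3_def polar_def)
  note t = tangent_at[OF pZ]
  have "p \<in> C" using t(2) p(2) by blast
  then have "C \<inter> N \<noteq> {}" using p in_polar_iff[OF pZ] N_eq by auto
  then show "C \<in> Tangents" using t p by (auto simp: Tangents_def)
qed

lemma Z_meets_conic_twice: "i = 1 \<or> i = 2 \<Longrightarrow> tangent_line (F 3) p \<noteq> Z i" if "p \<in> Z 3"
  using tangent_at(2)[OF that] card_line_inter_conic[of i] by auto

text \<open>Four contacts are nodes and two lie on the polar. They are distinct: a tangent at a node
  through the centre shares two points with a component line and equals it, but that line meets the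
  conic twice.\<close>

lemma card_Tangents: "card Tangents = 6"
proof -
  have e: "nodes3 = (Z 1 \<inter> Z 3) \<union> (Z 2 \<inter> Z 3)" by (auto simp: nodes3_def)
  have f: "finite (Z 1 \<inter> Z 3)" "finite (Z 2 \<inter> Z 3)" using card_inter_conic(1) is_line_Z by blast+
  have "(Z 1 \<inter> Z 3) \<inter> (Z 2 \<inter> Z 3) = {}" using Z12_disjoint by blast
  then have "card nodes3 = 2 + 2" unfolding e using card_Un_disjoint[OF f] card_line_inter_conic by simp
  moreover have "nodes3 \<inter> polar = {}"
  proof (rule ccontr)
    assume "nodes3 \<inter> polar \<noteq> {}"
    then obtain p where p: "p \<in> nodes3" "p \<in> polar" by blast
    then obtain i where i: "i = 1 \<or> i = 2" "p \<in> Z i" and pZ: "p \<in> Z 3" by (auto simp: nodes3_def)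
    note t = tangent_at[OF pZ]
    have c: "centre \<in> tangent_line (F 3) p" using p in_polar_iff[OF pZ] by blast
    have "centre \<in> Z i" using i centre by auto
    moreover have "p \<noteq> centre" using pZ centre_notin_Z3 by blast
    moreover have "p \<in> tangent_line (F 3) p" using t(2) by blast
    moreover have "is_line (Z i)" using i is_line_Z by auto
    ultimately have "tangent_line (F 3) p = Z i" using line_unique[OF t(1)] c i(2) by blast
    then show False using Z_meets_conic_twice[OF pZ i(1)] by blast
  qed
  ultimately have "card (nodes3 \<union> polar) = 6"
    using card_Un_disjoint[OF nodes3_card(1) polar_card(1)] card_polar by simp
  moreover have "inj_on (tangent_line (F 3)) (nodes3 \<union> polar)"
    by (rule inj_on_subset[OF inj_tangent]) (auto simp: nodes3_def polar_def)
  ultimately show ?thesis unfolding Tangents_eq by (simp add: card_image)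
qed

lemma meeting_twiceI:
  assumes "is_line C" "C \<inter> (\<Union>i. Z i) \<subseteq> {p, q}" shows "C \<in> H"
  unfolding lines_meeting_twice_def
  using assms finite_subset[OF assms(2)] card_mono[OF _ assms(2)] card_insert_2_le[of p q] by auto

theorem meeting_twice_conic: "H = Chords \<union> Tangents"
proof (intro equalityI subsetI)
  fix C assume C: "C \<in> H"
  then have L: "is_line C" by (auto simp: lines_meeting_twice_def)
  show "C \<in> Chords \<union> Tangents"
  proof (cases "centre \<in> C")
    case True
    obtain q where q: "C \<inter> Z 3 = {q}" using meeting_twice_through_centre[OF C True] .
    then show ?thesis using contact_in_polar[OF L True q] eq_tangent_line[OF L q] Tangents_eq by blast
  next
    case False
    obtain p q where pq: "p \<noteq> q" "C \<inter> Z 1 = {p}" "C \<inter> Z 2 = {q}" "C \<inter> Z 3 \<subseteq> {p, q}"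
      using meeting_twice_points[OF C False] .
    have pZ: "p \<in> Z 1" "q \<in> Z 2" "p \<in> C" "q \<in> C" using pq by blast+
    have "C \<inter> Z 3 = {p} \<or> C \<inter> Z 3 = {q} \<or> (p \<in> Z 3 \<and> q \<in> Z 3)"
      using pq(4) card_inter_conic(3)[OF L] by blast
    then show ?thesis
    proof (elim disjE)
      assume s: "C \<inter> Z 3 = {p}"
      then have "p \<in> nodes3" using pZ by (auto simp: nodes3_def)
      then show ?thesis using eq_tangent_line[OF L s] Tangents_eq by blast
    next
      assume s: "C \<inter> Z 3 = {q}"
      then have "q \<in> nodes3" using pZ by (auto simp: nodes3_def)
      then show ?thesis using eq_tangent_line[OF L s] Tangents_eq by blast
    next
      assume s: "p \<in> Z 3 \<and> q \<in> Z 3"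
      then have "C = join p q" using join_eq[OF pq(1) L] pZ by blast
      then show ?thesis using s pZ Chords_eq by blast
    qed
  qed
next
  fix C assume "C \<in> Chords \<union> Tangents"
  then show "C \<in> H"
  proof
    assume "C \<in> Chords"
    then obtain p q where C: "C = join p q" and p: "p \<in> Z 1 \<inter> Z 3" and q: "q \<in> Z 2 \<inter> Z 3"
      unfolding Chords_eq by auto
    show ?thesis using join_conic[OF p q] C by (intro meeting_twiceI[of _ p q]) (auto simp: Un_Z)
  next
    assume "C \<in> Tangents"
    then obtain p where p: "p \<in> nodes3 \<union> polar" "C = tangent_line (F 3) p" unfolding Tangents_eq by blast
    then have pZ: "p \<in> Z 3" by (auto simp: nodes3_def polar_def)
    note t = tangent_at[OF pZ, folded p(2)]
    have pC: "p \<in> C" using t(2) by blast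
    have n: "C \<noteq> Z 1" "C \<noteq> Z 2" using Z_meets_conic_twice[OF pZ] p(2) by simp_all
    obtain r1 where r1: "C \<inter> Z 1 = {r1}" using line_meets_Z12[OF t(1) n(1)] by blast
    obtain r2 where r2: "C \<inter> Z 2 = {r2}" using line_meets_Z12[OF t(1) n(2)] by blast
    \<comment> \<open>The tangent meets each of the two lines once. For contact on the polar, both
      of these points are the centre; for contact at a node, one of them is the contact
      point.\<close>
    show ?thesis
    proof (cases "p \<in> polar")
      case True
      then have "centre \<in> C" "centre \<in> Z 1" "centre \<in> Z 2" using in_polar_iff[OF pZ] p(2) centre by auto
      then have "centre \<in> C \<inter> Z 1" "centre \<in> C \<inter> Z 2" by blast+
      then have "r1 = centre" "r2 = centre" unfolding r1 r2 by simp_all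
      then show ?thesis using t r1 r2 by (intro meeting_twiceI[of _ p centre]) (auto simp: Un_Z)
    next
      case False
      then have "p \<in> Z 1 \<or> p \<in> Z 2" using p by (auto simp: nodes3_def)
      then have "p \<in> C \<inter> Z 1 \<or> p \<in> C \<inter> Z 2" using pC by blast
      then have "r1 = p \<or> r2 = p" unfolding r1 r2 by auto
      then show ?thesis using t r1 r2
        by (elim disjE) (intro meeting_twiceI[of _ p r2] meeting_twiceI[of _ p r1]; auto simp: Un_Z)+
    qed
  qed
qed

lemma card_meeting_twice_conic: "card (H) = 10"
proof -
  have "Chords \<inter> Tangents = {}"
  proof (rule ccontr)
    assume "Chords \<inter> Tangents \<noteq> {}"
    then obtain C where C: "C \<in> Chords" "C \<in> Tangents" by blast
    then obtain p q where pq: "C = join p q" "p \<in> Z 1 \<inter> Z 3" "q \<in> Z 2 \<inter> Z 3"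
      unfolding Chords_eq by auto
    obtain r where r: "C = tangent_line (F 3) r" "r \<in> Z 3"
      using C(2) unfolding Tangents_eq nodes3_def polar_def by blast
    have "{p, q} = {r}" using join_conic(3)[OF pq(2,3)] tangent_at(2)[OF r(2)] pq(1) r(1) by simp
    then show False using join_conic(1)[OF pq(2,3)] by auto
  qed
  moreover have "finite Chords" "finite Tangents"
    using card_Chords card_Tangents by (metis card.infinite zero_neq_numeral)+
  ultimately show ?thesis
    unfolding meeting_twice_conic using card_Chords card_Tangents by (simp add: card_Un_disjoint)
qed

end

subsection \<open>Normalization of a line\<close>

definition type_ring :: "'a::field set \<Rightarrow> 'a ring" where
  "type_ring A = \<lparr>carrier = A, mult = (*), one = 1, zero = 0, add = (+)\<rparr>"

lemma type_ring_simps [simp]: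
  "carrier (type_ring A) = A" "mult (type_ring A) = (*)" "one (type_ring A) = 1"
  "zero (type_ring A) = 0" "add (type_ring A) = (+)"
  by (simp_all add: type_ring_def)

lemma cring_type_ring:
  assumes "0 \<in> A" "1 \<in> A" "\<And>x y. x \<in> A \<Longrightarrow> y \<in> A \<Longrightarrow> x + y \<in> A"
    "\<And>x y. x \<in> A \<Longrightarrow> y \<in> A \<Longrightarrow> x * y \<in> A" "\<And>x. x \<in> A \<Longrightarrow> - x \<in> A"
  shows "cring (type_ring A)"
proof (rule cringI)
  show "abelian_group (type_ring A)"
  proof (rule abelian_groupI)
    fix x assume "x \<in> carrier (type_ring A)"
    then show "\<exists>y\<in>carrier (type_ring A). y \<oplus>\<^bsub>type_ring A\<^esub> x = \<zero>\<^bsub>type_ring A\<^esub>"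
      using assms(5) by (intro bexI[of _ "- x"]) auto
  qed (use assms in \<open>simp_all add: add_ac\<close>)
  show "comm_monoid (type_ring A)"
    by (rule comm_monoidI) (use assms in \<open>simp_all add: mult_ac\<close>)
qed (simp add: algebra_simps)

lemma type_ring_finsum:
  fixes f :: "'i \<Rightarrow> 'a::field"
  shows "finite I \<Longrightarrow> finsum (type_ring UNIV) f I = sum f I"
proof (induction I rule: finite_induct)
  interpret cring "type_ring (UNIV :: 'a set)" by (rule cring_type_ring) auto
  {
    case (insert x I)
    show ?case using insert by (simp add: finsum_insert)
  next
    case empty
    show ?case by simp
  }
qed

subsection \<open>The local ring of the affine line at the origin\<close>

definition regular_at_0 :: "complex poly fract set" where
  "regular_at_0 = {Fract g h | g h. coeff h 0 \<noteq> 0}"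

definition vanishing_at_0 :: "complex poly fract set" where
  "vanishing_at_0 = {Fract g h | g h. coeff h 0 \<noteq> 0 \<and> coeff g 0 = 0}"

lemma regular_at_0_ring:
  "0 \<in> regular_at_0" "1 \<in> regular_at_0"
  "x \<in> regular_at_0 \<Longrightarrow> y \<in> regular_at_0 \<Longrightarrow> x + y \<in> regular_at_0"
  "x \<in> regular_at_0 \<Longrightarrow> y \<in> regular_at_0 \<Longrightarrow> x * y \<in> regular_at_0"
  "x \<in> regular_at_0 \<Longrightarrow> - x \<in> regular_at_0"
proof -
  show "0 \<in> regular_at_0" "1 \<in> regular_at_0"
    unfolding regular_at_0_def Zero_fract_def One_fract_def
    by (rule CollectI, rule exI[of _ 0], rule exI[of _ 1], simp)
      (rule CollectI, rule exI[of _ 1], rule exI[of _ 1], simp)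
next
  assume "x \<in> regular_at_0" "y \<in> regular_at_0"
  then obtain g h g' h' where *: "x = Fract g h" "coeff h 0 \<noteq> 0" "y = Fract g' h'" "coeff h' 0 \<noteq> 0"
    by (auto simp: regular_at_0_def)
  then have "h \<noteq> 0" "h' \<noteq> 0" by auto
  then have "x + y = Fract (g * h' + g' * h) (h * h')" "x * y = Fract (g * g') (h * h')" using * by simp_all
  moreover have "coeff (h * h') 0 \<noteq> 0" using * by (simp add: coeff_mult_0)
  ultimately show "x + y \<in> regular_at_0" "x * y \<in> regular_at_0" unfolding regular_at_0_def by blast+
next
  assume "x \<in> regular_at_0"
  then obtain g h where "x = Fract g h" "coeff h 0 \<noteq> 0" by (auto simp: regular_at_0_def)
  then have "- x = Fract (- g) h" "coeff h 0 \<noteq> 0" by simp_all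
  then show "- x \<in> regular_at_0" unfolding regular_at_0_def by blast
qed

lemma vanishing_at_0_subset: "vanishing_at_0 \<subseteq> regular_at_0"
  by (auto simp: regular_at_0_def vanishing_at_0_def)

lemma one_notin_vanishing_at_0: "1 \<notin> vanishing_at_0"
proof
  assume "1 \<in> vanishing_at_0"
  then obtain g h :: "complex poly" where gh: "1 = Fract g h" "coeff h 0 \<noteq> 0" "coeff g 0 = 0"
    unfolding vanishing_at_0_def by blast
  then have "h \<noteq> 0" by auto
  then have "g = h" using gh(1) by (simp add: One_fract_def eq_fract)
  then show False using gh by simp
qed

lemma vanishing_at_0_ideal:
  "0 \<in> vanishing_at_0"
  "x \<in> vanishing_at_0 \<Longrightarrow> y \<in> vanishing_at_0 \<Longrightarrow> x + y \<in> vanishing_at_0"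
  "x \<in> regular_at_0 \<Longrightarrow> y \<in> vanishing_at_0 \<Longrightarrow> x * y \<in> vanishing_at_0"
proof -
  show "0 \<in> vanishing_at_0"
    unfolding vanishing_at_0_def Zero_fract_def
    by (rule CollectI, rule exI[of _ 0], rule exI[of _ 1], simp)
next
  assume "x \<in> vanishing_at_0" "y \<in> vanishing_at_0"
  then obtain g h g' h' where *: "x = Fract g h" "coeff h 0 \<noteq> 0" "y = Fract g' h'" "coeff h' 0 \<noteq> 0" "coeff g 0 = 0" "coeff g' 0 = 0"
    by (auto simp: vanishing_at_0_def)
  then have "h \<noteq> 0" "h' \<noteq> 0" by auto
  then have "x + y = Fract (g * h' + g' * h) (h * h')" using * by simp
  moreover have "coeff (h * h') 0 \<noteq> 0" "coeff (g * h' + g' * h) 0 = 0" using * by (simp_all add: coeff_mult_0)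
  ultimately show "x + y \<in> vanishing_at_0" unfolding vanishing_at_0_def by blast
next
  assume "x \<in> regular_at_0" "y \<in> vanishing_at_0"
  then obtain g h g' h' where *: "x = Fract g h" "coeff h 0 \<noteq> 0" "y = Fract g' h'" "coeff h' 0 \<noteq> 0" "coeff g' 0 = 0"
    by (auto simp: vanishing_at_0_def regular_at_0_def)
  then have "x * y = Fract (g * g') (h * h')" by simp
  moreover have "coeff (h * h') 0 \<noteq> 0" "coeff (g * g') 0 = 0" using * by (simp_all add: coeff_mult_0)
  ultimately show "x * y \<in> vanishing_at_0" unfolding vanishing_at_0_def by blast
qed

lemma regular_not_vanishing_unit:
  assumes "x \<in> regular_at_0" "x \<notin> vanishing_at_0" shows "\<exists>y\<in>regular_at_0. x * y = 1"
proof -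
  obtain g h where gh: "x = Fract g h" "coeff h 0 \<noteq> 0" using assms(1) by (auto simp: regular_at_0_def)
  then have g: "coeff g 0 \<noteq> 0" using assms(2) by (auto simp: vanishing_at_0_def)
  then have "h \<noteq> 0" "g \<noteq> 0" using gh by auto
  then have "x * Fract h g = 1" using gh by (simp add: One_fract_def eq_fract)
  moreover have "Fract h g \<in> regular_at_0" using g unfolding regular_at_0_def by blast
  ultimately show ?thesis by blast
qed

text \<open>The valuation ring property: the powers of t in numerator and denominator are
  compared.\<close>

lemma regular_or_inverse_vanishing: "x \<in> regular_at_0 \<or> inverse x \<in> vanishing_at_0"
proof (cases "x = 0")
  case False
  obtain g h where gh: "x = Fract g h" "h \<noteq> 0" by (cases x)
  then have g: "g \<noteq> 0" using False by (auto simp: Zero_fract_def eq_fract)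
  have split: "\<exists>q a. p = [:0, 1:] ^ a * q \<and> coeff q 0 \<noteq> 0" if "p \<noteq> 0" for p :: "complex poly"
    using order_decomp[OF that, of 0] by (auto simp: poly_eq_0_iff_dvd[of _ 0, simplified, symmetric] poly_0_coeff_0)
  obtain g' k where g': "g = [:0, 1:] ^ k * g'" "coeff g' 0 \<noteq> 0" using split[OF g] by blast
  obtain h' l where h': "h = [:0, 1:] ^ l * h'" "coeff h' 0 \<noteq> 0" using split[OF gh(2)] by blast
  have n0: "g' \<noteq> 0" "h' \<noteq> 0" using g' h' by auto
  show ?thesis
  proof (cases "l \<le> k")
    case True
    then have "[:0, 1:] ^ k = [:0, 1:] ^ l * [:0, 1 :: complex:] ^ (k - l)" by (simp flip: power_add)
    then have "x = Fract ([:0, 1:] ^ (k - l) * g') h'"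
      using gh n0 by (simp add: eq_fract g' h' mult_ac)
    then show ?thesis using h' unfolding regular_at_0_def by blast
  next
    case False
    then have "[:0, 1:] ^ l = [:0, 1:] ^ k * [:0, 1 :: complex:] ^ (l - k)" by (simp flip: power_add)
    then have "inverse x = Fract ([:0, 1:] ^ (l - k) * h') g'"
      using gh g n0 by (simp add: eq_fract g' h' mult_ac)
    moreover have "coeff ([:0, 1:] ^ (l - k) * h') 0 = 0" using False by (simp add: coeff_mult_0 coeff_0_power)
    ultimately show ?thesis using g' unfolding vanishing_at_0_def by blast
  qed
qed (use regular_at_0_ring in simp)

lemma regular_at_0_power: "x \<in> regular_at_0 \<Longrightarrow> x ^ n \<in> regular_at_0"
  by (induction n) (auto intro: regular_at_0_ring)

text \<open>If \<open>x\<close> is not regular, its inverse \<open>z\<close> vanishes at 0.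
  Multiplying the integral equation by z^n expresses 1 as a combination of positive powers of
  \<open>z\<close> with regular coefficients, which vanishes at 0.\<close>

lemma regular_at_0_integrally_closed:
  assumes a: "\<And>i. i < n \<Longrightarrow> a i \<in> regular_at_0" and eq: "x ^ n + (\<Sum>i<n. a i * x ^ i) = 0"
  shows "x \<in> regular_at_0"
proof (rule ccontr)
  assume nr: "x \<notin> regular_at_0"
  define z where "z = inverse x"
  have z: "z \<in> vanishing_at_0" using nr regular_or_inverse_vanishing z_def by blast
  have x0: "x \<noteq> 0" using nr regular_at_0_ring(1) by auto
  then have xz: "x * z = 1" by (simp add: z_def)
  have "0 = z ^ n * (x ^ n + (\<Sum>i<n. a i * x ^ i))" using eq by simp
  also have "\<dots> = (x * z) ^ n + (\<Sum>i<n. a i * (z ^ n * x ^ i))"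
    by (simp add: algebra_simps power_mult_distrib sum_distrib_left)
  \<comment> \<open>One factor \<open>z\<close> is split off each term to show that it lies in the
    ideal; this is possible because \<open>i < n\<close>.\<close>
  also have "(\<Sum>i<n. a i * (z ^ n * x ^ i)) = (\<Sum>i<n. a i * z ^ (n - Suc i) * z)"
  proof (rule sum.cong[OF refl])
    fix i assume "i \<in> {..<n}"
    then have "z ^ n = z ^ (n - Suc i) * z * z ^ i"
      by (simp flip: power_add power_Suc2 power_Suc)
    then have "z ^ n * x ^ i = z ^ (n - Suc i) * z * (x * z) ^ i" by (simp add: power_mult_distrib mult_ac)
    then show "a i * (z ^ n * x ^ i) = a i * z ^ (n - Suc i) * z" by (simp add: xz mult_ac)
  qed
  finally have "1 = (- 1) * (\<Sum>i<n. a i * z ^ (n - Suc i) * z)" by (simp add: xz eq_neg_iff_add_eq_0)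
  moreover have "(\<Sum>i\<in>I. a i * z ^ (n - Suc i) * z) \<in> vanishing_at_0" if "finite I" "I \<subseteq> {..<n}" for I
    using that
  proof (induction I rule: finite_induct)
    case (insert j I)
    have "a j * z ^ (n - Suc j) * z \<in> vanishing_at_0"
      using insert a z vanishing_at_0_subset
      by (intro vanishing_at_0_ideal(3) regular_at_0_ring(4) regular_at_0_power) auto
    then show ?case using insert vanishing_at_0_ideal(2) by simp
  qed (simp add: vanishing_at_0_ideal(1))
  then have "(\<Sum>i<n. a i * z ^ (n - Suc i) * z) \<in> vanishing_at_0" by simp
  then have "(- 1) * (\<Sum>i<n. a i * z ^ (n - Suc i) * z) \<in> vanishing_at_0"
    by (intro vanishing_at_0_ideal(3) regular_at_0_ring)
  ultimately show False using one_notin_vanishing_at_0 by simp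
qed

text \<open>A proper ideal cannot contain a unit, so it lies inside \<open>M0\<close> when
  everything outside \<open>M0\<close> is a unit.\<close>

lemma (in cring) unique_maximalideal:
  assumes M0: "ideal M0 R" "M0 \<noteq> carrier R" and unit: "\<And>x. x \<in> carrier R \<Longrightarrow> x \<notin> M0 \<Longrightarrow> \<exists>y\<in>carrier R. x \<otimes> y = \<one>"
  shows "{M. maximalideal M R} = {M0}"
proof -
  have whole: "J = carrier R" if J: "ideal J R" "x \<in> J" "x \<notin> M0" for J x
  proof -
    have x: "x \<in> carrier R" using ideal.Icarr[OF J(1,2)] .
    obtain y where "y \<in> carrier R" "x \<otimes> y = \<one>" using unit[OF x J(3)] by blast
    then have "\<one> \<in> J" using ideal.I_r_closed[OF J(1,2)] by metis
    then show ?thesis using ideal.one_imp_carrier[OF J(1)] by blast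
  qed
  have sub0: "M0 \<subseteq> carrier R" using M0(1) ideal.Icarr by fast
  have "maximalideal M0 R"
    by (rule maximalidealI[OF M0(1)]) (use M0(2) whole in blast)+
  moreover have "M = M0" if M: "maximalideal M R" for M
  proof -
    interpret M: maximalideal M R by (rule M)
    have "M \<subseteq> M0" using whole[OF M.is_ideal] M.I_notcarr by blast
    then show ?thesis using M.I_maximal[OF M0(1) _ sub0] M0(2) by blast
  qed
  ultimately show ?thesis by blast
qed

subsection \<open>Restriction of rational functions to a line\<close>

lemma ex_dual:
  assumes vw: "indep v w" shows "\<exists>a. dot a v = 1 \<and> dot a w = 0"
proof -
  obtain i j where m: "v $ i * w $ j - v $ j * w $ i \<noteq> 0" using indep_minor[OF vw] by blast
  have s: "dot a v = dot v a" for a v by (simp add: dot_def mult.commute)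
  let ?m = "v $ i * w $ j - v $ j * w $ i"
  let ?a = "(1 / ?m) *s (axis i (w $ j) - axis j (w $ i))"
  have "dot v ?a = 1" "dot w ?a = 0"
    using m by (simp_all only: dot_scale dot_diff dot_axis) (simp_all add: mult.commute)
  then have "dot ?a v = 1" "dot ?a w = 0" using s by metis+
  then show ?thesis by blast
qed

locale param_line =
  fixes v w :: "complex ^ 3"
  assumes vw: "indep v w"
begin

abbreviation "C \<equiv> span2 v w"

lemma not_subset_zeros: "homogeneous d H \<Longrightarrow> \<not> C \<subseteq> zeros H \<longleftrightarrow> along H v w \<noteq> 0"
  using line_subset_zeros_iff[OF _ vw] by blast

lemma ex_form_along:
  assumes "degree g \<le> d" obtains G where "homogeneous d G" "along G v w = g"
proof -
  obtain a where a: "dot a v = 1" "dot a w = 0" using ex_dual[OF vw] by blast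
  obtain e where e: "dot e w = 1" "dot e v = 0" using ex_dual[OF indep_sym[OF vw]] by blast
  have S: "along (lin a) v w = 1" and T: "along (lin e) v w = [:0, 1:]"
    by (rule poly_ext_complex; simp add: poly_along a e)+
  \<comment> \<open>The homogenization of \<open>g\<close> in the coordinates dual to
    \<open>v\<close> and \<open>w\<close>, which restrict to 1 and t.\<close>
  define G where "G = (\<Sum>i\<le>d. const3 (coeff g i) * (lin a ^ (d - i) * lin e ^ i))"
  have "homogeneous d G"
    unfolding G_def
  proof (intro homogeneous_sum homogeneous_const_mult)
    fix i assume "i \<in> {..d}"
    then have "d = 1 * (d - i) + 1 * i" by simp
    then show "homogeneous d (lin a ^ (d - i) * lin e ^ i)"
      using homogeneous_mult[OF homogeneous_power[OF homogeneous_lin] homogeneous_power[OF homogeneous_lin]] by metis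
  qed
  moreover have "along G v w = g"
    by (rule poly_ext_complex) (simp add: G_def S T poly_sum poly_altdef_le[OF assms])
  ultimately show ?thesis using that by blast
qed

lemma ex_forms_along:
  obtains d G H where "homogeneous d G" "along G v w = g" "homogeneous d H" "along H v w = h"
proof -
  let ?d = "max (degree g) (degree h)"
  obtain G where "homogeneous ?d G" "along G v w = g" using ex_form_along[of g ?d] by auto
  moreover obtain H where "homogeneous ?d H" "along H v w = h" using ex_form_along[of h ?d] by auto
  ultimately show ?thesis using that by blast
qed

abbreviation "R \<equiv> generic_ring C"
abbreviation "I \<equiv> generic_ideal C"

lemma R_eq: "R = type_ring {Fract G H | G H d. homogeneous d G \<and> homogeneous d H \<and> along H v w \<noteq> 0}"
  unfolding generic_ring_def type_ring_def using not_subset_zeros by (metis (no_types, lifting))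

definition restr :: "poly3 fract \<Rightarrow> complex poly fract" where
  "restr x = (THE y. \<exists>G H d. x = Fract G H \<and> homogeneous d G \<and> homogeneous d H \<and> along H v w \<noteq> 0 \<and>
     y = Fract (along G v w) (along H v w))"

text \<open>The restriction does not depend on the chosen fraction: equality of fractions is an
  identity of products, and \<open>along\<close> is multiplicative. This justifies the description
  by \<open>THE\<close>.\<close>

lemma restr_Fract:
  assumes "homogeneous d G" "homogeneous d H" "along H v w \<noteq> 0"
  shows "restr (Fract G H) = Fract (along G v w) (along H v w)"
  unfolding restr_def
proof (rule the_equality)
  show "\<exists>G' H' d. Fract G H = Fract G' H' \<and> homogeneous d G' \<and> homogeneous d H' \<and> along H' v w \<noteq> 0 \<and>
      Fract (along G v w) (along H v w) = Fract (along G' v w) (along H' v w)"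
    using assms by blast
  fix y assume "\<exists>G' H' d. Fract G H = Fract G' H' \<and> homogeneous d G' \<and> homogeneous d H' \<and> along H' v w \<noteq> 0 \<and>
      y = Fract (along G' v w) (along H' v w)"
  then obtain G' H' where *: "Fract G H = Fract G' H'" "along H' v w \<noteq> 0"
    "y = Fract (along G' v w) (along H' v w)" by blast
  have "H \<noteq> 0" "H' \<noteq> 0" using assms * by auto
  then have "G * H' = G' * H" using *(1) by (simp add: eq_fract)
  then have "along G v w * along H' v w = along G' v w * along H v w" by (metis along_mult)
  then show "y = Fract (along G v w) (along H v w)" using * assms by (simp add: eq_fract)
qed

lemma R_cases:
  assumes "x \<in> carrier R"
  obtains G H d where "x = Fract G H" "homogeneous d G" "homogeneous d H" "along H v w \<noteq> 0" "H \<noteq> 0"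
    "restr x = Fract (along G v w) (along H v w)"
proof -
  obtain G H d where *: "x = Fract G H" "homogeneous d G" "homogeneous d H" "along H v w \<noteq> 0"
    using assms unfolding R_eq by auto
  then have "H \<noteq> 0" by auto
  then show ?thesis using that * restr_Fract by blast
qed

lemma R_I: "homogeneous d G \<Longrightarrow> homogeneous d H \<Longrightarrow> along H v w \<noteq> 0 \<Longrightarrow> Fract G H \<in> carrier R"
  unfolding R_eq by auto

lemma R_add_mult:
  assumes "x \<in> carrier R" "y \<in> carrier R"
  shows "x + y \<in> carrier R" "restr (x + y) = restr x + restr y"
    "x * y \<in> carrier R" "restr (x * y) = restr x * restr y"
proof -
  obtain G H d where x: "x = Fract G H" "homogeneous d G" "homogeneous d H" "along H v w \<noteq> 0" "H \<noteq> 0"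
    "restr x = Fract (along G v w) (along H v w)" using R_cases[OF assms(1)] .
  obtain G' H' d' where y: "y = Fract G' H'" "homogeneous d' G'" "homogeneous d' H'" "along H' v w \<noteq> 0" "H' \<noteq> 0"
    "restr y = Fract (along G' v w) (along H' v w)" using R_cases[OF assms(2)] .
  have s: "x + y = Fract (G * H' + G' * H) (H * H')" "x * y = Fract (G * G') (H * H')" using x y by simp_all
  have h: "homogeneous (d + d') (G * H' + G' * H)" "homogeneous (d + d') (H * H')" "homogeneous (d + d') (G * G')"
    using x y homogeneous_mult homogeneous_add by (metis add.commute)+
  have n: "along (H * H') v w \<noteq> 0" using x y by simp
  show "x + y \<in> carrier R" "x * y \<in> carrier R" unfolding s using h n R_I by blast+
  show "restr (x + y) = restr x + restr y" "restr (x * y) = restr x * restr y"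
    unfolding s restr_Fract[OF h(1,2) n] restr_Fract[OF h(3,2) n] using x y by simp_all
qed

lemma R_0_1: "0 \<in> carrier R" "1 \<in> carrier R" "restr 1 = 1"
  using R_I[of 0 0 1] R_I[of 0 1 1] restr_Fract[of 0 1 1]
  by (simp_all add: Zero_fract_def One_fract_def)

lemma R_uminus: "x \<in> carrier R \<Longrightarrow> - x \<in> carrier R"
proof -
  assume "x \<in> carrier R"
  then obtain G H d where *: "x = Fract G H" "homogeneous d G" "homogeneous d H" "along H v w \<noteq> 0"
    using R_cases by metis
  then have "- x = Fract (0 - G) H" by simp
  then show ?thesis using R_I[OF homogeneous_diff[OF homogeneous_0] *(3,4)] *(2) by metis
qed

lemma cring_R: "cring R"
  using cring_type_ring[OF R_0_1(1,2) R_add_mult(1,3) R_uminus] unfolding R_eq by simp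

abbreviation "S \<equiv> type_ring (UNIV :: complex poly fract set)"

lemma cring_S: "cring S"
  by (rule cring_type_ring) auto

lemma R_ops: "mult R = (*)" "add R = (+)" "one R = 1" "zero R = 0"
  by (simp_all add: generic_ring_def)

lemma restr_hom: "ring_hom_ring R S restr"
  by (rule ring_hom_ringI) (use cring_R cring_S R_add_mult R_0_1 in \<open>auto simp: R_ops cring.axioms\<close>)

lemma restr_surj: "restr ` carrier R = carrier S"
proof -
  have "\<exists>x\<in>carrier R. restr x = y" for y
  proof -
    obtain g h where gh: "y = Fract g h" "h \<noteq> 0" by (cases y)
    obtain d G H where G: "homogeneous d G" "along G v w = g" and H: "homogeneous d H" "along H v w = h"
      using ex_forms_along .
    show ?thesis using R_I[OF G(1) H(1)] restr_Fract[OF G(1) H(1)] G H gh by (intro bexI[of _ "Fract G H"]) auto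
  qed
  then show ?thesis by (auto simp: image_iff) metis
qed

lemma restr_kernel: "a_kernel R S restr = I"
proof (intro equalityI subsetI)
  fix x assume "x \<in> a_kernel R S restr"
  then have x: "x \<in> carrier R" "restr x = 0" by (simp_all add: a_kernel_def')
  obtain G H d where *: "x = Fract G H" "homogeneous d G" "homogeneous d H" "along H v w \<noteq> 0" "H \<noteq> 0"
    "restr x = Fract (along G v w) (along H v w)" using R_cases[OF x(1)] .
  then have "along G v w = 0" using x(2) by (simp add: Zero_fract_def eq_fract)
  then show "x \<in> I"
    using * not_subset_zeros line_subset_zeros_iff[OF *(2) vw] unfolding generic_ideal_def by blast
next
  fix x assume "x \<in> I"
  then obtain G H d where *: "x = Fract G H" "homogeneous d G" "homogeneous d H" "\<not> C \<subseteq> zeros H" "C \<subseteq> zeros G"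
    unfolding generic_ideal_def by blast
  then have a: "along H v w \<noteq> 0" "along G v w = 0"
    using not_subset_zeros line_subset_zeros_iff[OF *(2) vw] by blast+
  then show "x \<in> a_kernel R S restr"
    using R_I[OF *(2,3)] restr_Fract[OF *(2,3)] * by (simp add: a_kernel_def' Zero_fract_def eq_fract)
qed

abbreviation "K \<equiv> function_field C"

definition restrq :: "poly3 fract set \<Rightarrow> complex poly fract" where
  "restrq X = the_elem (restr ` X)"

text \<open>The first isomorphism theorem: the function field of the line is C(t).\<close>

lemma restrq_iso: "restrq \<in> ring_iso K S"
  using ring_hom_ring.FactRing_iso_set[OF restr_hom restr_surj]
  unfolding function_field_def restr_kernel restrq_def .

lemma ideal_I: "ideal I R"
  using ring_hom_ring.kernel_is_ideal[OF restr_hom] restr_kernel by simp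

lemma cring_K: "cring K"
  unfolding function_field_def by (rule ideal.quotient_is_cring[OF ideal_I cring_R])

lemma restrq_coset:
  assumes "x \<in> carrier R" shows "restrq (I +>\<^bsub>R\<^esub> x) = restr x" "I +>\<^bsub>R\<^esub> x \<in> carrier K"
proof -
  have "restr ` (I +>\<^bsub>R\<^esub> x) = {restr x}"
  proof (intro equalityI subsetI)
    fix y assume "y \<in> restr ` (I +>\<^bsub>R\<^esub> x)"
    then obtain i where "i \<in> I" "y = restr (i + x)" by (auto simp: a_r_coset_def' R_ops)
    moreover from this have "i \<in> carrier R" "restr i = 0" using restr_kernel by (auto simp: a_kernel_def')
    ultimately show "y \<in> {restr x}" using R_add_mult(2)[OF _ assms] by simp
  next
    fix y assume "y \<in> {restr x}"
    moreover have "0 + x \<in> I +>\<^bsub>R\<^esub> x"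
      using additive_subgroup.zero_closed[OF ideal.axioms(1)[OF ideal_I]] by (auto simp: a_r_coset_def' R_ops)
    ultimately show "y \<in> restr ` (I +>\<^bsub>R\<^esub> x)" by auto
  qed
  then show "restrq (I +>\<^bsub>R\<^esub> x) = restr x" by (simp add: restrq_def)
  show "I +>\<^bsub>R\<^esub> x \<in> carrier K"
    unfolding function_field_def using assms by (auto simp: FactRing_def A_RCOSETS_def')
qed

lemma K_cases: assumes "X \<in> carrier K" obtains x where "x \<in> carrier R" "X = I +>\<^bsub>R\<^esub> x"
  using assms unfolding function_field_def by (auto simp: FactRing_def A_RCOSETS_def')

lemma proj_v_zeros: "homogeneous d H \<Longrightarrow> proj v \<notin> zeros H \<longleftrightarrow> coeff (along H v w) 0 \<noteq> 0"
  using proj_in_zeros indep_nonzero[OF vw] by simp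

lemma local_ring_eq: "local_ring C (proj v) = {X \<in> carrier K. restrq X \<in> regular_at_0}"
proof (intro equalityI subsetI)
  fix X assume "X \<in> local_ring C (proj v)"
  then obtain G H d where *: "X = I +>\<^bsub>R\<^esub> Fract G H" "homogeneous d G" "homogeneous d H" "proj v \<notin> zeros H"
    unfolding local_ring_def by blast
  then have c: "coeff (along H v w) 0 \<noteq> 0" using proj_v_zeros by blast
  then have a: "along H v w \<noteq> 0" by (metis coeff_0)
  have "restr (Fract G H) \<in> regular_at_0"
    unfolding restr_Fract[OF *(2,3) a] using c unfolding regular_at_0_def by blast
  then show "X \<in> {X \<in> carrier K. restrq X \<in> regular_at_0}"
    using restrq_coset[OF R_I[OF *(2,3) a]] * by simp
next
  fix X assume "X \<in> {X \<in> carrier K. restrq X \<in> regular_at_0}"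
  then obtain x where x: "x \<in> carrier R" "X = I +>\<^bsub>R\<^esub> x" "restrq X \<in> regular_at_0" using K_cases by blast
  obtain g h where gh: "restrq X = Fract g h" "coeff h 0 \<noteq> 0" using x(3) unfolding regular_at_0_def by blast
  obtain d G H where G: "homogeneous d G" "along G v w = g" and H: "homogeneous d H" "along H v w = h"
    using ex_forms_along .
  have a: "along H v w \<noteq> 0" using gh H by auto
  note r = restrq_coset[OF R_I[OF G(1) H(1) a]]
  have "restrq (I +>\<^bsub>R\<^esub> Fract G H) = restrq X" using r(1) restr_Fract[OF G(1) H(1) a] G H gh by simp
  moreover have "inj_on restrq (carrier K)" using restrq_iso by (simp add: ring_iso_def bij_betw_def)
  moreover have "X \<in> carrier K" using x restrq_coset(2) by blast
  ultimately have "X = I +>\<^bsub>R\<^esub> Fract G H" using r(2) by (metis inj_onD)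
  moreover have "proj v \<notin> zeros H" using proj_v_zeros[OF H(1)] gh H by simp
  ultimately show "X \<in> local_ring C (proj v)" using G(1) H(1) unfolding local_ring_def by blast
qed

lemma restrq_hom: "ring_hom_cring K S restrq"
  by (intro ring_hom_cringI ring_hom_ringI2 cring_K cring_S cring.axioms(1))
    (use restrq_iso in \<open>auto simp: ring_iso_def\<close>)

lemma restrq_uminus:
  assumes "X \<in> carrier K" shows "restrq (\<ominus>\<^bsub>K\<^esub> X) = - restrq X"
proof -
  interpret h: ring_hom_cring K S restrq by (rule restrq_hom)
  have "restrq (\<ominus>\<^bsub>K\<^esub> X) + restrq X = restrq (\<ominus>\<^bsub>K\<^esub> X \<oplus>\<^bsub>K\<^esub> X)" using assms by simp
  also have "\<dots> = 0" using assms by (simp only: h.R.l_neg h.hom_zero) simp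
  finally show ?thesis by (simp add: eq_neg_iff_add_eq_0)
qed

lemma integral_closure_eq: "integral_closure K (local_ring C (proj v)) = local_ring C (proj v)"
proof -
  interpret h: ring_hom_cring K S restrq by (rule restrq_hom)
  let ?A = "local_ring C (proj v)"
  have A: "X \<in> ?A \<longleftrightarrow> X \<in> carrier K \<and> restrq X \<in> regular_at_0" for X using local_ring_eq by blast
  have pow: "restrq (X [^]\<^bsub>K\<^esub> (n::nat)) = restrq X ^ n" if "X \<in> carrier K" for X n
    using that h.hom_one by (induction n) simp_all
  show ?thesis
  proof (intro equalityI subsetI)
    fix X assume "X \<in> integral_closure K ?A"
    then obtain n a where X: "X \<in> carrier K" and a: "a \<in> {..<n::nat} \<rightarrow> ?A"
      and eq: "X [^]\<^bsub>K\<^esub> n \<oplus>\<^bsub>K\<^esub> (\<Oplus>\<^bsub>K\<^esub>i\<in>{..<n}. a i \<otimes>\<^bsub>K\<^esub> X [^]\<^bsub>K\<^esub> i) = \<zero>\<^bsub>K\<^esub>"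
      unfolding integral_closure_def by blast
    have aK: "i < n \<Longrightarrow> a i \<in> carrier K \<and> restrq (a i) \<in> regular_at_0" for i using a A by blast
    have f: "(\<lambda>i. a i \<otimes>\<^bsub>K\<^esub> X [^]\<^bsub>K\<^esub> i) \<in> {..<n} \<rightarrow> carrier K" using aK X by auto
    have "restrq (X [^]\<^bsub>K\<^esub> n \<oplus>\<^bsub>K\<^esub> (\<Oplus>\<^bsub>K\<^esub>i\<in>{..<n}. a i \<otimes>\<^bsub>K\<^esub> X [^]\<^bsub>K\<^esub> i)) = 0" unfolding eq by simp
    moreover have "restrq (X [^]\<^bsub>K\<^esub> n \<oplus>\<^bsub>K\<^esub> (\<Oplus>\<^bsub>K\<^esub>i\<in>{..<n}. a i \<otimes>\<^bsub>K\<^esub> X [^]\<^bsub>K\<^esub> i))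
        = restrq X ^ n + (\<Sum>i<n. restrq (a i \<otimes>\<^bsub>K\<^esub> X [^]\<^bsub>K\<^esub> i))"
      using h.hom_finsum[OF f] X f by (simp add: pow type_ring_finsum comp_def)
    moreover have "(\<Sum>i<n. restrq (a i \<otimes>\<^bsub>K\<^esub> X [^]\<^bsub>K\<^esub> i)) = (\<Sum>i<n. restrq (a i) * restrq X ^ i)"
      using X aK by (intro sum.cong) (simp_all add: pow)
    ultimately have "restrq X ^ n + (\<Sum>i<n. restrq (a i) * restrq X ^ i) = 0" by simp
    then have "restrq X \<in> regular_at_0" 
      using regular_at_0_integrally_closed[of n "\<lambda>i. restrq (a i)" "restrq X"] aK by blast
    then show "X \<in> ?A" using A X by blast
  next
    fix X assume X: "X \<in> ?A"
    then have XK: "X \<in> carrier K" using A by blast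
    have "\<ominus>\<^bsub>K\<^esub> X \<in> ?A"
      using X A XK regular_at_0_ring(5) h.R.a_inv_closed restrq_uminus by metis
    \<comment> \<open>An element \<open>X\<close> of the ring is a root of the monic polynomial of
      degree 1 with constant term minus \<open>X\<close>.\<close>
    then have "(\<lambda>_. \<ominus>\<^bsub>K\<^esub> X) \<in> {..<1::nat} \<rightarrow> ?A" by blast
    moreover have "X [^]\<^bsub>K\<^esub> (1::nat) \<oplus>\<^bsub>K\<^esub> (\<Oplus>\<^bsub>K\<^esub>i\<in>{..<1::nat}. \<ominus>\<^bsub>K\<^esub> X \<otimes>\<^bsub>K\<^esub> X [^]\<^bsub>K\<^esub> i) = \<zero>\<^bsub>K\<^esub>"
    proof -
      have "{..<1::nat} = {0}" by auto
      then show ?thesis using XK by (simp add: h.R.finsum_insert h.R.r_neg)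
    qed
    ultimately show "X \<in> integral_closure K ?A" unfolding integral_closure_def using XK by blast
  qed
qed

lemma normalization_fibre_eq: "\<exists>M. normalization_fibre C (proj v) = {M}"
proof -
  interpret h: ring_hom_cring K S restrq by (rule restrq_hom)
  let ?A = "local_ring C (proj v)" let ?K = "K\<lparr>carrier := ?A\<rparr>"
  have A: "X \<in> ?A \<longleftrightarrow> X \<in> carrier K \<and> restrq X \<in> regular_at_0" for X using local_ring_eq by blast
  have bij: "bij_betw restrq (carrier K) UNIV" using restrq_iso by (simp add: ring_iso_def)
  have cr: "cring ?K"
  proof (rule cringI)
    show "abelian_group ?K"
    proof (rule abelian_groupI)
      fix X assume "X \<in> carrier ?K"
      then have "\<ominus>\<^bsub>K\<^esub> X \<in> ?A" "\<ominus>\<^bsub>K\<^esub> X \<oplus>\<^bsub>K\<^esub> X = \<zero>\<^bsub>K\<^esub>"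
        using A restrq_uminus regular_at_0_ring(5) h.R.l_neg by simp_all
      then show "\<exists>Y\<in>carrier ?K. Y \<oplus>\<^bsub>?K\<^esub> X = \<zero>\<^bsub>?K\<^esub>" by auto
    qed (use A regular_at_0_ring in \<open>simp_all add: h.R.a_ac\<close>)
    show "comm_monoid ?K"
      by (rule comm_monoidI) (use A regular_at_0_ring h.hom_one in \<open>simp_all add: h.R.m_ac\<close>)
  qed (use A in \<open>simp_all add: h.R.l_distr\<close>)
  have O: "cring (type_ring regular_at_0)" by (rule cring_type_ring) (auto intro: regular_at_0_ring)
  have hom: "ring_hom_ring ?K (type_ring regular_at_0) restrq"
    by (rule ring_hom_ringI) (use cr O A in \<open>auto simp: cring.axioms h.hom_one[simplified]\<close>)
  have m: "ideal vanishing_at_0 (type_ring regular_at_0)"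
  proof (rule idealI)
    show "ring (type_ring regular_at_0)" using O cring.axioms by blast
    interpret O: cring "type_ring regular_at_0" by (rule O)
    show "subgroup vanishing_at_0 (add_monoid (type_ring regular_at_0))"
    proof (rule O.add.subgroupI)
      fix x assume x: "x \<in> vanishing_at_0"
      have "\<ominus>\<^bsub>type_ring regular_at_0\<^esub> x = - x"
        by (rule O.minus_equality) (use x vanishing_at_0_subset regular_at_0_ring(5) in auto)
      then show "\<ominus>\<^bsub>type_ring regular_at_0\<^esub> x \<in> vanishing_at_0"
        using vanishing_at_0_ideal(3)[of "- 1" x] regular_at_0_ring x by simp
    qed (use vanishing_at_0_subset vanishing_at_0_ideal in auto)
  next
    fix a x assume "a \<in> vanishing_at_0" "x \<in> carrier (type_ring regular_at_0)"
    then have "x * a \<in> vanishing_at_0" using vanishing_at_0_ideal(3) by simp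
    then show "x \<otimes>\<^bsub>type_ring regular_at_0\<^esub> a \<in> vanishing_at_0" "a \<otimes>\<^bsub>type_ring regular_at_0\<^esub> x \<in> vanishing_at_0"
      by (simp_all add: mult.commute)
  qed
  \<comment> \<open>The maximal ideal of functions vanishing at \<open>t = 0\<close>, pulled back
    along the isomorphism; its complement consists of units.\<close>
  let ?M = "{X \<in> carrier ?K. restrq X \<in> vanishing_at_0}"
  have "{M. maximalideal M ?K} = {?M}"
  proof (rule cring.unique_maximalideal[OF cr])
    show "ideal ?M ?K" by (rule ring_hom_ring.ideal_vimage[OF hom m])
    have "\<one>\<^bsub>K\<^esub> \<in> carrier ?K" using A h.hom_one regular_at_0_ring by simp
    moreover have "\<one>\<^bsub>K\<^esub> \<notin> ?M" using h.hom_one one_notin_vanishing_at_0 by simp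
    ultimately show "?M \<noteq> carrier ?K" by blast
    fix X assume "X \<in> carrier ?K" "X \<notin> ?M"
    then have X: "X \<in> carrier K" "restrq X \<in> regular_at_0" "restrq X \<notin> vanishing_at_0" using A by auto
    obtain y where y: "y \<in> regular_at_0" "restrq X * y = 1" using regular_not_vanishing_unit[OF X(2,3)] by blast
    have "y \<in> restrq ` carrier K" using bij by (simp add: bij_betw_def)
    then obtain Y where Y: "Y \<in> carrier K" "restrq Y = y" by blast
    have "restrq (X \<otimes>\<^bsub>K\<^esub> Y) = restrq \<one>\<^bsub>K\<^esub>" using X Y y h.hom_one by simp
    then have "X \<otimes>\<^bsub>K\<^esub> Y = \<one>\<^bsub>K\<^esub>"
      using inj_onD[OF bij_betw_imp_inj_on[OF bij]] X(1) Y(1) by simp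
    then show "\<exists>Y\<in>carrier ?K. X \<otimes>\<^bsub>?K\<^esub> Y = \<one>\<^bsub>?K\<^esub>" using Y y A by auto
  qed
  then show ?thesis unfolding normalization_fibre_def integral_closure_eq by blast
qed

end

lemma normalization_fibre_line:
  assumes "is_line C" "p \<in> C" shows "\<exists>M. normalization_fibre C p = {M}"
proof -
  obtain v where v: "v \<noteq> 0" "p = proj v" by (rule proj_cases)
  obtain w where w: "indep v w" "C = span2 v w" using line_obtain_other[OF assms(1)] v assms(2) by metis
  interpret param_line v w by (rule param_line.intro[OF w(1)])
  show ?thesis using normalization_fibre_eq v w by simp
qed

text \<open>With one maximal ideal over each point, the preimage of \<open>B\<close> is the graph of
  a function on \<open>C \<inter> B\<close>.\<close>

lemma Hyp_1_2_eq: "Hyp 1 B 2 = lines_meeting_twice B"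
proof -
  have "finite (normalization_preimage C B) = finite (C \<inter> B) \<and> card (normalization_preimage C B) = card (C \<inter> B)"
    if C: "is_line C" for C
  proof -
    obtain f where f: "\<And>p. p \<in> C \<Longrightarrow> normalization_fibre C p = {f p}" using normalization_fibre_line[OF C] by metis
    have e: "normalization_preimage C B = (\<lambda>p. (p, f p)) ` (C \<inter> B)"
      unfolding normalization_preimage_def using f by auto
    have i: "inj_on (\<lambda>p. (p, f p)) (C \<inter> B)" by (rule inj_onI) simp
    show ?thesis unfolding e using card_image[OF i] finite_image_iff[OF i] by simp
  qed
  then show ?thesis unfolding Hyp_def lines_meeting_twice_def by auto
qed

subsection \<open>Algebraic dependence by counting\<close>

inductive_set polyfun :: "'i set \<Rightarrow> (('i \<Rightarrow> complex) \<Rightarrow> complex) set" for I where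
  const: "(\<lambda>_. c) \<in> polyfun I"
| coord: "i \<in> I \<Longrightarrow> (\<lambda>y. y i) \<in> polyfun I"
| add: "f \<in> polyfun I \<Longrightarrow> g \<in> polyfun I \<Longrightarrow> (\<lambda>y. f y + g y) \<in> polyfun I"
| mult: "f \<in> polyfun I \<Longrightarrow> g \<in> polyfun I \<Longrightarrow> (\<lambda>y. f y * g y) \<in> polyfun I"

text \<open>Bounding each exponent separately, rather than the total degree, gives exactly (D +
  1)^|I| exponent vectors and makes the later count elementary.\<close>

inductive_set boxspan :: "'i set \<Rightarrow> nat \<Rightarrow> (('i \<Rightarrow> complex) \<Rightarrow> complex) set" for I D where
  zero: "(\<lambda>_. 0) \<in> boxspan I D"
| add_mono: "f \<in> boxspan I D \<Longrightarrow> (\<And>i. i \<in> I \<Longrightarrow> e i \<le> D) \<Longrightarrow> (\<lambda>y. c * (\<Prod>i\<in>I. y i ^ e i) + f y) \<in> boxspan I D"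

lemma boxspan_add: "f \<in> boxspan I D \<Longrightarrow> g \<in> boxspan I D \<Longrightarrow> (\<lambda>y. f y + g y) \<in> boxspan I D"
proof (induction f rule: boxspan.induct)
  case (add_mono f e c)
  then have "(\<lambda>y. c * (\<Prod>i\<in>I. y i ^ e i) + (f y + g y)) \<in> boxspan I D" by (intro boxspan.add_mono) auto
  then show ?case by (simp add: add.assoc)
qed simp

lemma boxspan_mono:
  assumes "\<And>i. i \<in> I \<Longrightarrow> e i \<le> D" shows "(\<lambda>y. c * (\<Prod>i\<in>I. y i ^ e i)) \<in> boxspan I D"
  using boxspan.add_mono[OF boxspan.zero assms, where c = c] by simp

lemma boxspan_le: "f \<in> boxspan I D \<Longrightarrow> D \<le> D' \<Longrightarrow> f \<in> boxspan I D'"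
proof (induction f rule: boxspan.induct)
  case (add_mono f e c)
  have "e i \<le> D'" if "i \<in> I" for i using add_mono.hyps(2)[OF that] add_mono.prems by simp
  then show ?case using add_mono by (intro boxspan.add_mono) auto
qed (rule boxspan.zero)

lemma boxspan_mult:
  assumes "f \<in> boxspan I D" "g \<in> boxspan I D'" shows "(\<lambda>y. f y * g y) \<in> boxspan I (D + D')"
  using assms(1)
proof (induction f rule: boxspan.induct)
  case (add_mono f e c)
  have "(\<lambda>y. c * (\<Prod>i\<in>I. y i ^ e i) * g y) \<in> boxspan I (D + D')"
    using assms(2)
  proof (induction g rule: boxspan.induct)
    case (add_mono g e' c')
    have "(\<lambda>y. c * c' * (\<Prod>i\<in>I. y i ^ (e i + e' i)) + c * (\<Prod>i\<in>I. y i ^ e i) * g y) \<in> boxspan I (D + D')"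
      using add_mono add_mono.IH \<open>\<And>i. i \<in> I \<Longrightarrow> e i \<le> D\<close> by (intro boxspan.add_mono) (auto intro: add_le_mono)
    then show ?case by (simp add: power_add prod.distrib algebra_simps)
  qed (simp add: boxspan.zero)
  from boxspan_add[OF this add_mono.IH] show ?case by (simp add: algebra_simps)
qed (simp add: boxspan.zero)

lemma boxspan_one: "(\<lambda>_. 1) \<in> boxspan I D"
  using boxspan_mono[of I "\<lambda>_. 0" D 1] by simp

lemma boxspan_power: "f \<in> boxspan I D \<Longrightarrow> (\<lambda>y. f y ^ n) \<in> boxspan I (n * D)"
  by (induction n) (use boxspan_one boxspan_mult in auto)

lemma boxspan_prod:
  "finite J \<Longrightarrow> (\<And>j. j \<in> J \<Longrightarrow> f j \<in> boxspan I (D j)) \<Longrightarrow> (\<lambda>y. \<Prod>j\<in>J. f j y) \<in> boxspan I (\<Sum>j\<in>J. D j)"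
proof (induction J rule: finite_induct)
  case (insert x J)
  have "(\<lambda>y. f x y * (\<Prod>j\<in>J. f j y)) \<in> boxspan I (D x + (\<Sum>j\<in>J. D j))"
    using insert by (intro boxspan_mult) auto
  then show ?case using insert by simp
qed (simp add: boxspan_one)

lemma polyfun_boxspan: "f \<in> polyfun I \<Longrightarrow> finite I \<Longrightarrow> \<exists>D. f \<in> boxspan I D"
proof (induction f rule: polyfun.induct)
  case (const c)
  have "(\<lambda>y. c * (\<Prod>i\<in>I. y i ^ 0)) \<in> boxspan I 0" by (rule boxspan_mono) simp
  then show ?case by auto
next
  case (coord i)
  have "(\<lambda>y. 1 * (\<Prod>j\<in>I. y j ^ (if j = i then 1 else 0))) \<in> boxspan I 1" by (rule boxspan_mono) simp
  moreover have "(\<Prod>j\<in>I. y j ^ (if j = i then 1 else 0)) = y i" for y :: "'a \<Rightarrow> complex"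
  proof -
    have "(\<Prod>j\<in>I. y j ^ (if j = i then 1 else 0)) = (\<Prod>j\<in>I. if j = i then y j else 1)"
      by (intro prod.cong) auto
    then show ?thesis using coord by (simp add: prod.delta)
  qed
  ultimately show ?case by auto
next
  case (add f g)
  then obtain D D' where "f \<in> boxspan I D" "g \<in> boxspan I D'" by blast
  then show ?case using boxspan_add boxspan_le by (metis max.cobounded1 max.cobounded2)
next
  case (mult f g)
  then show ?case using boxspan_mult by blast
qed

lemma boxspan_explicit:
  assumes "finite I" "f \<in> boxspan I D"
  shows "\<exists>A. \<forall>y. f y = (\<Sum>e\<in>PiE I (\<lambda>_. {..D}). A e * (\<Prod>i\<in>I. y i ^ e i))"
  using assms(2)
proof (induction f rule: boxspan.induct)
  case zero
  show ?case by (intro exI[of _ "\<lambda>_. 0"]) simp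
next
  case (add_mono f e c)
  then obtain A where A: "\<And>y. f y = (\<Sum>e\<in>PiE I (\<lambda>_. {..D}). A e * (\<Prod>i\<in>I. y i ^ e i))" by blast
  let ?e = "restrict e I"
  have e: "?e \<in> PiE I (\<lambda>_. {..D})" using add_mono by auto
  have fin: "finite (PiE I (\<lambda>_. {..D}))" using assms(1) by (intro finite_PiE) auto
  have "c * (\<Prod>i\<in>I. y i ^ e i) + f y
      = (\<Sum>e\<in>PiE I (\<lambda>_. {..D}). (A e + (if e = ?e then c else 0)) * (\<Prod>i\<in>I. y i ^ e i))" for y
  proof -
    have "(\<Sum>e\<in>PiE I (\<lambda>_. {..D}). (A e + (if e = ?e then c else 0)) * (\<Prod>i\<in>I. y i ^ e i))
       = f y + (\<Sum>e\<in>PiE I (\<lambda>_. {..D}). if e = ?e then c * (\<Prod>i\<in>I. y i ^ e i) else 0)"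
      unfolding A sum.distrib[symmetric] by (intro sum.cong) (auto simp: algebra_simps)
    also have "\<dots> = f y + c * (\<Prod>i\<in>I. y i ^ ?e i)" using fin e by (simp add: sum.delta)
    also have "(\<Prod>i\<in>I. y i ^ ?e i) = (\<Prod>i\<in>I. y i ^ e i)" by (intro prod.cong) auto
    finally show ?thesis by (rule trans[OF add.commute sym])
  qed
  then show ?case by (intro exI[of _ "\<lambda>e'. A e' + (if e' = ?e then c else 0)"] allI)
qed

text \<open>Gaussian elimination, one equation and one unknown at a time.\<close>

lemma underdetermined_system:
  fixes A :: "'a \<Rightarrow> 'b \<Rightarrow> 'c::field"
  assumes "finite E" "finite E'" "card E < card E'"
  shows "\<exists>c. (\<exists>e\<in>E'. c e \<noteq> 0) \<and> (\<forall>f\<in>E. (\<Sum>e\<in>E'. c e * A e f) = 0)"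
  using assms
proof (induction E arbitrary: E' A rule: finite_induct)
  case empty
  then obtain e where "e \<in> E'" by fastforce
  then show ?case by (intro exI[of _ "\<lambda>_. 1"]) auto
next
  case (insert f0 E)
  show ?case
  proof (cases "\<forall>e\<in>E'. A e f0 = 0")
    case True
    have "card E < card E'" using insert by simp
    from insert.IH[OF insert.prems(1) this, of A] show ?thesis using True by auto
  next
    case False
    then obtain e0 where e0: "e0 \<in> E'" "A e0 f0 \<noteq> 0" by blast
    \<comment> \<open>The system after substituting for the unknown \<open>e0\<close> by means of
      equation \<open>f0\<close>.\<close>
    let ?A = "\<lambda>e f. A e f - A e f0 / A e0 f0 * A e0 f"
    have "card E < card (E' - {e0})" using insert e0 by (simp add: card_Diff_singleton)
    from insert.IH[OF _ this, of ?A] insert.prems obtain c where c: "\<exists>e\<in>E' - {e0}. c e \<noteq> 0"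
      "\<And>f. f \<in> E \<Longrightarrow> (\<Sum>e\<in>E' - {e0}. c e * ?A e f) = 0" by auto
    \<comment> \<open>The value at \<open>e0\<close> is the one that equation \<open>f0\<close>
      prescribes.\<close>
    define d where "d = (\<lambda>e. if e = e0 then - (\<Sum>e\<in>E' - {e0}. c e * A e f0) / A e0 f0 else c e)"
    have d: "(\<Sum>e\<in>E'. d e * A e f) = (\<Sum>e\<in>E' - {e0}. c e * ?A e f)" for f
    proof -
      have "(\<Sum>e\<in>E'. d e * A e f) = d e0 * A e0 f + (\<Sum>e\<in>E' - {e0}. d e * A e f)"
        using insert.prems e0 by (simp add: sum.remove)
      also have "(\<Sum>e\<in>E' - {e0}. d e * A e f) = (\<Sum>e\<in>E' - {e0}. c e * A e f)"
        by (intro sum.cong) (auto simp: d_def)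
      also have "d e0 * A e0 f = - (\<Sum>e\<in>E' - {e0}. c e * (A e f0 / A e0 f0 * A e0 f))"
        by (simp add: d_def sum_distrib_left sum_distrib_right sum_divide_distrib mult_ac)
      finally show ?thesis by (simp add: algebra_simps sum_subtractf)
    qed
    have "(\<Sum>e\<in>E'. d e * A e f) = 0" if "f \<in> insert f0 E" for f
      using that c(2) e0 unfolding d by auto
    moreover have "\<exists>e\<in>E'. d e \<noteq> 0" using c(1) by (auto simp: d_def)
    ultimately show ?thesis by blast
  qed
qed

text \<open>The monomials in the \<open>x j\<close> with exponents up to \<open>D\<close> number (D
  + 1)^|J|. They lie in the span of the monomials in \<open>y\<close> with exponents up to
  \<open>M\<close>, whose number grows only like the |I|-th power of \<open>D\<close>.\<close>

lemma algebraic_dependence: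
  assumes I: "finite I" and J: "finite J" and lt: "card I < card J" and x: "\<And>j. j \<in> J \<Longrightarrow> x j \<in> polyfun I"
  shows "\<exists>D c. (\<exists>e\<in>PiE J (\<lambda>_. {..D}). c e \<noteq> 0) \<and>
    (\<forall>y. (\<Sum>e\<in>PiE J (\<lambda>_. {..D::nat}). c e * (\<Prod>j\<in>J. x j y ^ e j)) = 0)"
proof -
  obtain d0 where d0: "\<And>j. j \<in> J \<Longrightarrow> x j \<in> boxspan I (d0 j)" using polyfun_boxspan[OF x I] by metis
  define d where "d = Max (insert 0 (d0 ` J))"
  have d: "x j \<in> boxspan I d" if "j \<in> J" for j
    using boxspan_le[OF d0[OF that]] that J by (simp add: d_def)
  \<comment> \<open>Chosen so that (M + 1)^|I| is at most D (D + 1)^|I|, which is just below (D +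
    1)^(|I| + 1).\<close>
  define D where "D = (card J * d + 1) ^ card I"
  define M where "M = card J * (D * d)"
  let ?E = "PiE I (\<lambda>_. {..M})" and ?E' = "PiE J (\<lambda>_. {..D})"
  have mem: "(\<lambda>y. \<Prod>j\<in>J. x j y ^ e j) \<in> boxspan I M" if "e \<in> ?E'" for e
  proof -
    have "(\<lambda>y. \<Prod>j\<in>J. x j y ^ e j) \<in> boxspan I (\<Sum>j\<in>J. e j * d)"
      by (intro boxspan_prod J boxspan_power d)
    moreover have "(\<Sum>j\<in>J. e j * d) \<le> (\<Sum>j\<in>J. D * d)" using that by (intro sum_mono mult_right_mono) (auto simp: PiE_iff)
    ultimately show ?thesis using boxspan_le by (simp add: M_def)
  qed
  then have "\<forall>e\<in>?E'. \<exists>a. \<forall>y. (\<Prod>j\<in>J. x j y ^ e j) = (\<Sum>f\<in>?E. a f * (\<Prod>i\<in>I. y i ^ f i))"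
    using boxspan_explicit[OF I] by blast
  from bchoice[OF this] obtain A where
    A: "\<And>e y. e \<in> ?E' \<Longrightarrow> (\<Prod>j\<in>J. x j y ^ e j) = (\<Sum>f\<in>?E. A e f * (\<Prod>i\<in>I. y i ^ f i))"
    by blast
  have "card ?E = (M + 1) ^ card I" using I by (simp add: card_PiE)
  also have "\<dots> \<le> ((card J * d + 1) * (D + 1)) ^ card I"
    by (rule power_mono) (simp_all add: M_def algebra_simps)
  also have "\<dots> = D * (D + 1) ^ card I" by (simp only: power_mult_distrib flip: D_def)
  also have "\<dots> < (D + 1) * (D + 1) ^ card I" by simp
  also have "\<dots> = (D + 1) ^ (card I + 1)" by simp
  also have "\<dots> \<le> (D + 1) ^ card J" using lt by (intro power_increasing) auto
  also have "\<dots> = card ?E'" using J by (simp add: card_PiE)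
  finally have "card ?E < card ?E'" .
  then obtain c where c: "\<exists>e\<in>?E'. c e \<noteq> 0" "\<forall>f\<in>?E. (\<Sum>e\<in>?E'. c e * A e f) = 0"
    using underdetermined_system[of ?E ?E' A] I J by (auto simp: finite_PiE)
  have "(\<Sum>e\<in>?E'. c e * (\<Prod>j\<in>J. x j y ^ e j)) = 0" for y
  proof -
    have "(\<Sum>e\<in>?E'. c e * (\<Prod>j\<in>J. x j y ^ e j)) = (\<Sum>e\<in>?E'. \<Sum>f\<in>?E. c e * A e f * (\<Prod>i\<in>I. y i ^ f i))"
      by (intro sum.cong) (simp_all add: A sum_distrib_left mult.assoc)
    also have "\<dots> = (\<Sum>f\<in>?E. \<Sum>e\<in>?E'. c e * A e f * (\<Prod>i\<in>I. y i ^ f i))" by (rule sum.swap)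
    also have "\<dots> = (\<Sum>f\<in>?E. (\<Sum>e\<in>?E'. c e * A e f) * (\<Prod>i\<in>I. y i ^ f i))" by (simp add: sum_distrib_right)
    also have "\<dots> = 0" using c(2) by simp
    finally show ?thesis .
  qed
  then show ?thesis using c(1) by blast
qed

text \<open>Extensionality of the exponent vectors ensures that different ones give different
  monomials.\<close>

lemma nonzero_polynomial_nonvanishing:
  fixes c :: "('j \<Rightarrow> nat) \<Rightarrow> complex"
  assumes "finite J" "finite E" "E \<subseteq> extensional J" "e0 \<in> E" "c e0 \<noteq> 0"
  shows "\<exists>X. (\<Sum>e\<in>E. c e * (\<Prod>j\<in>J. X j ^ e j)) \<noteq> 0"
  using assms
proof (induction J arbitrary: E e0 c rule: finite_induct)
  case empty
  then have "E = {e0}" by auto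
  then show ?case using empty by simp
next
  case (insert j J)
  \<comment> \<open>Regarded as a polynomial in the variable \<open>j\<close>, the sum has a
    coefficient of degree \<open>k\<close> that is a nonzero polynomial in the others, by the
    induction hypothesis not vanishing for some choice of them.\<close>
  define k where "k = e0 j"
  define E' where "E' = (\<lambda>e. restrict e J) ` {e \<in> E. e j = k}"
  define c' where "c' = (\<lambda>e. c (e(j := k)))"
  have up: "(restrict e J)(j := k) = e" if "e \<in> E" "e j = k" for e
  proof
    fix i show "((restrict e J)(j := k)) i = e i"
      using that insert.prems(2) by (auto simp: restrict_def extensional_def)
  qed
  have inj: "inj_on (\<lambda>e. restrict e J) {e \<in> E. e j = k}"
    by (rule inj_on_inverseI[where g = "\<lambda>e. e(j := k)"]) (simp add: up)
  have "\<exists>X. (\<Sum>e\<in>E'. c' e * (\<Prod>i\<in>J. X i ^ e i)) \<noteq> 0"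
  proof (rule insert.IH[of _ "restrict e0 J"])
    show "c' (restrict e0 J) \<noteq> 0" using insert.prems up[of e0] by (simp add: c'_def k_def)
    show "restrict e0 J \<in> E'"
      unfolding E'_def by (rule imageI) (use insert.prems in \<open>simp add: k_def\<close>)
  qed (use insert.prems in \<open>auto simp: E'_def\<close>)
  then obtain X where X: "(\<Sum>e\<in>E'. c' e * (\<Prod>i\<in>J. X i ^ e i)) \<noteq> 0" by blast
  have "(\<Sum>e\<in>E'. c' e * (\<Prod>i\<in>J. X i ^ e i)) = (\<Sum>e\<in>{e \<in> E. e j = k}. c e * (\<Prod>i\<in>J. X i ^ e i))"
    unfolding E'_def sum.reindex[OF inj] using up by (intro sum.cong) (auto simp: c'_def)
  also have "\<dots> = (\<Sum>e\<in>E. if e j = k then c e * (\<Prod>i\<in>J. X i ^ e i) else 0)"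
    using insert.prems(1) by (simp add: sum.inter_filter)
  finally have s: "(\<Sum>e\<in>E. if e j = k then c e * (\<Prod>i\<in>J. X i ^ e i) else 0) \<noteq> 0" using X by simp
  define p where "p = (\<Sum>e\<in>E. monom (c e * (\<Prod>i\<in>J. X i ^ e i)) (e j))"
  have "coeff p k \<noteq> 0" using s by (simp add: p_def coeff_sum)
  then have "p \<noteq> 0" by auto
  then obtain t where t: "poly p t \<noteq> 0" using poly_all_0_iff_0 by blast
  have "poly p t = (\<Sum>e\<in>E. c e * (\<Prod>i\<in>insert j J. (X(j := t)) i ^ e i))"
    unfolding p_def poly_sum poly_monom
  proof (rule sum.cong[OF refl])
    fix e
    have "(\<Prod>i\<in>J. (X(j := t)) i ^ e i) = (\<Prod>i\<in>J. X i ^ e i)" using insert.hyps by (intro prod.cong) auto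
    then show "c e * (\<Prod>i\<in>J. X i ^ e i) * t ^ e j = c e * (\<Prod>i\<in>insert j J. (X(j := t)) i ^ e i)"
      using insert.hyps by simp
  qed
  then show ?case using t by (intro exI[of _ "X(j := t)"]) simp
qed

subsection \<open>Polynomial functions of triples of forms\<close>

definition comp3 :: "nat \<Rightarrow> poly3 \<times> poly3 \<times> poly3 \<Rightarrow> poly3" where
  "comp3 b T = (if b = 0 then fst T else if b = 1 then fst (snd T) else snd (snd T))"

definition xcoord :: "nat \<times> nat \<times> nat \<times> nat \<Rightarrow> poly3 \<times> poly3 \<times> poly3 \<Rightarrow> complex" where
  "xcoord = (\<lambda>(b, i, j, k) T. mcoeff (comp3 b T) i j k)"

lemma xcoord_coeff_polys: "xcoord x \<in> coeff_polys"
proof -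
  obtain b i j k where x: "x = (b, i, j, k)" by (cases x)
  consider "b = 0" | "b = 1" | "b \<noteq> 0" "b \<noteq> 1" by blast
  then show ?thesis
  proof cases
    case 1
    then have "xcoord x = (\<lambda>(F1, F2, F3). mcoeff F1 i j k)" by (simp add: xcoord_def x comp3_def fun_eq_iff)
    then show ?thesis by (simp only: coeff_polys.coeff1)
  next
    case 2
    then have "xcoord x = (\<lambda>(F1, F2, F3). mcoeff F2 i j k)" by (simp add: xcoord_def x comp3_def fun_eq_iff)
    then show ?thesis by (simp only: coeff_polys.coeff2)
  next
    case 3
    then have "xcoord x = (\<lambda>(F1, F2, F3). mcoeff F3 i j k)" by (simp add: xcoord_def x comp3_def fun_eq_iff)
    then show ?thesis by (simp only: coeff_polys.coeff3)
  qed
qed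

lemma coeff_polys_power: "P \<in> coeff_polys \<Longrightarrow> (\<lambda>T. P T ^ n) \<in> coeff_polys"
  by (induction n) (auto intro: coeff_polys.const coeff_polys.mult)

lemma coeff_polys_prod: "(\<And>x. x \<in> A \<Longrightarrow> P x \<in> coeff_polys) \<Longrightarrow> (\<lambda>T. \<Prod>x\<in>A. P x T) \<in> coeff_polys"
  by (induction A rule: infinite_finite_induct) (auto intro: coeff_polys.const coeff_polys.mult)

lemma coeff_polys_sum: "(\<And>x. x \<in> A \<Longrightarrow> P x \<in> coeff_polys) \<Longrightarrow> (\<lambda>T. \<Sum>x\<in>A. P x T) \<in> coeff_polys"
  by (induction A rule: infinite_finite_induct) (auto intro: coeff_polys.const coeff_polys.add)

text \<open>Zero forms are allowed here, so that this is a vector space and contains the line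
  joining two of its points.\<close>

definition forms3 :: "nat \<Rightarrow> nat \<Rightarrow> nat \<Rightarrow> (poly3 \<times> poly3 \<times> poly3) set" where
  "forms3 b1 b2 b3 = {F. homogeneous b1 F} \<times> {F. homogeneous b2 F} \<times> {F. homogeneous b3 F}"

lemma triples_subset: "triples b1 b2 b3 \<subseteq> forms3 b1 b2 b3"
  by (auto simp: triples_def forms3_def)

text \<open>Irreducibility of the space of triples: on the line joining \<open>T0\<close> and
  \<open>T1\<close> both functions are nonzero polynomials in one variable, and so is their
  product.\<close>

lemma common_nonvanishing:
  assumes P: "P \<in> coeff_polys" "T0 \<in> forms3 b1 b2 b3" "P T0 \<noteq> 0"
    and Q: "Q \<in> coeff_polys" "T1 \<in> forms3 b1 b2 b3" "Q T1 \<noteq> 0"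
  obtains T where "T \<in> forms3 b1 b2 b3" "P T \<noteq> 0" "Q T \<noteq> 0"
proof -
  obtain F1 F2 F3 where T0: "T0 = (F1, F2, F3)" by (cases T0)
  obtain G1 G2 G3 where T1: "T1 = (G1, G2, G3)" by (cases T1)
  define L where "L t = (const3 (1 - t) * F1 + const3 t * G1, const3 (1 - t) * F2 + const3 t * G2,
      const3 (1 - t) * F3 + const3 t * G3)" for t
  have L: "L t \<in> forms3 b1 b2 b3" for t
    using P(2) Q(2) by (auto simp: T0 T1 L_def forms3_def intro!: homogeneous_add homogeneous_const_mult)
  have z: "const3 0 = 0" by (simp add: const3_def)
  have L01: "L 0 = T0" "L 1 = T1" by (simp_all add: L_def T0 T1 z)
  have poly: "\<exists>p. \<forall>t. R (L t) = poly p t" if "R \<in> coeff_polys" for R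
    using that
  proof (induction R rule: coeff_polys.induct)
    case (const c)
    show ?case by (intro exI[of _ "[:c:]"]) simp
  next
    case (coeff1 i j k)
    show ?case by (intro exI[of _ "[:mcoeff F1 i j k, mcoeff G1 i j k - mcoeff F1 i j k:]"]) (simp add: L_def, simp add: algebra_simps)
  next
    case (coeff2 i j k)
    show ?case by (intro exI[of _ "[:mcoeff F2 i j k, mcoeff G2 i j k - mcoeff F2 i j k:]"]) (simp add: L_def, simp add: algebra_simps)
  next
    case (coeff3 i j k)
    show ?case by (intro exI[of _ "[:mcoeff F3 i j k, mcoeff G3 i j k - mcoeff F3 i j k:]"]) (simp add: L_def, simp add: algebra_simps)
  next
    case (add P Q)
    then obtain p q where "\<forall>t. P (L t) = poly p t" "\<forall>t. Q (L t) = poly q t" by blast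
    then show ?case by (intro exI[of _ "p + q"]) simp
  next
    case (mult P Q)
    then obtain p q where "\<forall>t. P (L t) = poly p t" "\<forall>t. Q (L t) = poly q t" by blast
    then show ?case by (intro exI[of _ "p * q"]) simp
  qed
  obtain p where p: "\<And>t. P (L t) = poly p t" using poly[OF P(1)] by blast
  obtain q where q: "\<And>t. Q (L t) = poly q t" using poly[OF Q(1)] by blast
  have "p \<noteq> 0" using p[of 0] P(3) L01 by auto
  moreover have "q \<noteq> 0" using q[of 1] Q(3) L01 by auto
  ultimately have "p * q \<noteq> 0" by simp
  then obtain t where "poly (p * q) t \<noteq> 0" using poly_all_0_iff_0 by blast
  then show ?thesis using that[OF L[of t]] p q by simp
qed

lemma open_dense_nonvanishing:
  assumes P: "P \<in> coeff_polys" "multihomogeneous P" "T1 \<in> forms3 b1 b2 b3" "P T1 \<noteq> 0"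
  shows "open_dense (zariski_triples b1 b2 b3) {T \<in> triples b1 b2 b3. P T \<noteq> 0}"
proof -
  let ?B = "{{T \<in> triples b1 b2 b3. P T \<noteq> 0} | P. P \<in> coeff_polys \<and> multihomogeneous P}"
  let ?U = "{T \<in> triples b1 b2 b3. P T \<noteq> 0}"
  have op: "openin (zariski_triples b1 b2 b3) ?U"
    unfolding zariski_triples_def by (rule topology_generated_by_Basis) (use P in blast)
  have "multihomogeneous (\<lambda>_. 1)"
    unfolding multihomogeneous_def by (rule exI[of _ 0], rule exI[of _ 0], rule exI[of _ 0]) simp
  then have "triples b1 b2 b3 \<in> ?B"
    by (intro CollectI exI[of _ "\<lambda>_. 1"]) (simp add: coeff_polys.const)
  then have top: "topspace (zariski_triples b1 b2 b3) = triples b1 b2 b3"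
    unfolding zariski_triples_def topology_generated_by_topspace by auto
  \<comment> \<open>Finite intersections of basic sets correspond to products, so every
    neighbourhood contains the nonvanishing set of one polynomial function.\<close>
  have nbhd: "\<exists>Q\<in>coeff_polys. Q T \<noteq> 0 \<and> {T' \<in> triples b1 b2 b3. Q T' \<noteq> 0} \<subseteq> W"
    if "generate_topology_on ?B W" "T \<in> W" for W T
    using that
  proof (induction W rule: generate_topology_on.induct)
    case (Int a b)
    then obtain Q Q' where Q: "Q \<in> coeff_polys" "Q T \<noteq> 0" "{T' \<in> triples b1 b2 b3. Q T' \<noteq> 0} \<subseteq> a"
      "Q' \<in> coeff_polys" "Q' T \<noteq> 0" "{T' \<in> triples b1 b2 b3. Q' T' \<noteq> 0} \<subseteq> b" by blast
    show ?case by (rule bexI[OF _ coeff_polys.mult[OF Q(1,4)]]) (use Q in auto)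
  next
    case (UN K)
    then obtain k where k: "k \<in> K" "T \<in> k" by blast
    from UN.IH[OF this] k(1) show ?case by blast
  qed auto
  have "T \<in> zariski_triples b1 b2 b3 closure_of ?U" if T: "T \<in> triples b1 b2 b3" for T
    unfolding in_closure_of
  proof (intro conjI allI impI)
    show "T \<in> topspace (zariski_triples b1 b2 b3)" using T top by simp
    fix W assume W: "T \<in> W \<and> openin (zariski_triples b1 b2 b3) W"
    then obtain Q where Q: "Q \<in> coeff_polys" "Q T \<noteq> 0" "{T' \<in> triples b1 b2 b3. Q T' \<noteq> 0} \<subseteq> W"
      using nbhd[of W T] unfolding zariski_triples_def openin_topology_generated_by_iff by blast
    obtain F1 F2 F3 where TF: "T = (F1, F2, F3)" by (cases T)
    have n0: "F1 \<noteq> 0" "F2 \<noteq> 0" "F3 \<noteq> 0" using T TF by (auto simp: triples_def)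
    have nz: "\<exists>i j k. mcoeff F i j k \<noteq> 0" if "F \<noteq> 0" for F
      using that mcoeff_ext[of F 0] by auto
    obtain i1 j1 k1 where m1: "mcoeff F1 i1 j1 k1 \<noteq> 0" using nz[OF n0(1)] by blast
    obtain i2 j2 k2 where m2: "mcoeff F2 i2 j2 k2 \<noteq> 0" using nz[OF n0(2)] by blast
    obtain i3 j3 k3 where m3: "mcoeff F3 i3 j3 k3 \<noteq> 0" using nz[OF n0(3)] by blast
    note m = m1 m2 m3
    \<comment> \<open>The extra factors are nonzero coefficients of the three forms of
      \<open>T\<close>; they keep the forms of the new triple nonzero.\<close>
    define Q' where "Q' = (\<lambda>T. Q T * (xcoord (0, i1, j1, k1) T * (xcoord (1, i2, j2, k2) T * xcoord (2, i3, j3, k3) T)))"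
    have "Q' \<in> coeff_polys"
      unfolding Q'_def by (intro coeff_polys.mult Q(1) xcoord_coeff_polys)
    moreover have "Q' T \<noteq> 0" using Q m by (simp add: Q'_def TF xcoord_def comp3_def)
    ultimately obtain T' where T': "T' \<in> forms3 b1 b2 b3" "P T' \<noteq> 0" "Q' T' \<noteq> 0"
      using common_nonvanishing[OF P(1,3,4), of Q' T] T triples_subset by blast
    then have "T' \<in> triples b1 b2 b3" "Q T' \<noteq> 0"
      by (auto simp: forms3_def triples_def Q'_def xcoord_def comp3_def)
    then show "\<exists>y. y \<in> ?U \<and> y \<in> W" using T' Q(3) by blast
  qed
  then have "zariski_triples b1 b2 b3 closure_of ?U = topspace (zariski_triples b1 b2 b3)"
    using closure_of_subset_topspace top by fast
  then show ?thesis unfolding open_dense_def using op by blast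
qed

lemma comp3_simps [simp]:
  "comp3 0 (F1, F2, F3) = F1" "comp3 (Suc 0) (F1, F2, F3) = F2" "comp3 2 (F1, F2, F3) = F3"
  by (simp_all add: comp3_def)

lemma less_3_cases: "(b::nat) < 3 \<Longrightarrow> b = 0 \<or> b = 1 \<or> b = 2"
  by auto

definition form_idx :: "(nat \<Rightarrow> nat) \<Rightarrow> (nat \<times> nat \<times> nat \<times> nat) set" where
  "form_idx d = Sigma {..<3} (\<lambda>b. idx3 (d b))"

lemma finite_form_idx [simp]: "finite (form_idx d)"
  by (simp add: form_idx_def)

text \<open>The family depends on fewer parameters than a triple has coefficients, so counting monomials of
  bounded degree gives a relation between the coefficients. As the family is stable under rescaling
  each form, it satisfies every multihomogeneous component of that relation.\<close>

lemma ex_multihomogeneous_vanishing: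
  fixes \<Phi> :: "('i \<Rightarrow> complex) \<Rightarrow> poly3 \<times> poly3 \<times> poly3" and d :: "nat \<Rightarrow> nat"
  assumes I: "finite I" "card I < card (form_idx d)"
    and poly: "\<And>x. x \<in> form_idx d \<Longrightarrow> (\<lambda>y. xcoord x (\<Phi> y)) \<in> polyfun I"
    and scale: "\<And>y R. \<exists>y'. \<forall>b x. (b, x) \<in> form_idx d \<longrightarrow> xcoord (b, x) (\<Phi> y') = R b * xcoord (b, x) (\<Phi> y)"
  obtains P where "P \<in> coeff_polys" "multihomogeneous P" "\<And>y. P (\<Phi> y) = 0"
    "\<exists>T\<in>forms3 (d 0) (d 1) (d 2). P T \<noteq> 0"
proof -
  let ?J = "form_idx d"
  have "\<exists>D c. (\<exists>e\<in>PiE ?J (\<lambda>_. {..D}). c e \<noteq> 0) \<and>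
    (\<forall>y. (\<Sum>e\<in>PiE ?J (\<lambda>_. {..D::nat}). c e * (\<Prod>j\<in>?J. xcoord j (\<Phi> y) ^ e j)) = 0)"
    by (rule algebraic_dependence[OF I(1) finite_form_idx I(2)]) (rule poly)
  then obtain D c where c: "\<exists>e\<in>PiE ?J (\<lambda>_. {..D::nat}). c e \<noteq> 0"
    and dep: "\<forall>y. (\<Sum>e\<in>PiE ?J (\<lambda>_. {..D}). c e * (\<Prod>j\<in>?J. xcoord j (\<Phi> y) ^ e j)) = 0"
    by (elim exE conjE)
  let ?E = "PiE ?J (\<lambda>_. {..D})"
  have finE: "finite ?E" by (intro finite_PiE) auto
  define deg where "deg e = restrict (\<lambda>b. \<Sum>x\<in>idx3 (d b). e (b, x)) {..<3}" for e :: "nat \<times> nat \<times> nat \<times> nat \<Rightarrow> nat"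
  obtain e0 where e0: "e0 \<in> ?E" "c e0 \<noteq> 0" using c by blast
  \<comment> \<open>The multihomogeneous component of the relation that contains the monomial
    \<open>e0\<close>.\<close>
  let ?Edeg = "{e \<in> ?E. deg e = deg e0}"
  define P where "P T = (\<Sum>e\<in>?Edeg. c e * (\<Prod>j\<in>?J. xcoord j T ^ e j))" for T
  have "P \<in> coeff_polys"
    unfolding P_def
    by (intro coeff_polys_sum coeff_polys.mult coeff_polys.const coeff_polys_prod coeff_polys_power xcoord_coeff_polys)
  have monoscale: "(\<Prod>j\<in>?J. xcoord j T' ^ e j) = (\<Prod>b<3. R b ^ deg e b) * (\<Prod>j\<in>?J. xcoord j T ^ e j)"
    if s: "\<And>b x. (b, x) \<in> ?J \<Longrightarrow> xcoord (b, x) T' = R b * xcoord (b, x) T" for R T T' e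
  proof -
    have "(\<Prod>j\<in>?J. xcoord j T' ^ e j) = (\<Prod>j\<in>?J. R (fst j) ^ e j * xcoord j T ^ e j)"
      by (intro prod.cong) (auto simp: s power_mult_distrib)
    also have "\<dots> = (\<Prod>j\<in>?J. R (fst j) ^ e j) * (\<Prod>j\<in>?J. xcoord j T ^ e j)" by (rule prod.distrib)
    also have "(\<Prod>j\<in>?J. R (fst j) ^ e j) = (\<Prod>b<3. \<Prod>x\<in>idx3 (d b). R b ^ e (b, x))"
      unfolding form_idx_def by (subst prod.Sigma) (auto intro!: prod.cong)
    also have "\<dots> = (\<Prod>b<3. R b ^ deg e b)" by (intro prod.cong) (auto simp: deg_def power_sum)
    finally show ?thesis .
  qed
  have "multihomogeneous P"
    unfolding multihomogeneous_def
  proof (rule exI[of _ "deg e0 0"], rule exI[of _ "deg e0 1"], rule exI[of _ "deg e0 2"], intro allI)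
    fix r s t :: complex and F1 F2 F3
    let ?T' = "(smult [:[:r:]:] F1, smult [:[:s:]:] F2, smult [:[:t:]:] F3)" and ?T = "(F1, F2, F3)"
    let ?R = "\<lambda>b::nat. if b = 0 then r else if b = 1 then s else t"
    have sc: "xcoord (b, x) ?T' = ?R b * xcoord (b, x) ?T" for b x
      by (cases x) (auto simp: xcoord_def comp3_def)
    have "(\<Prod>j\<in>?J. xcoord j ?T' ^ e j) = (\<Prod>b<3. ?R b ^ deg e b) * (\<Prod>j\<in>?J. xcoord j ?T ^ e j)" for e
      by (rule monoscale[where R = ?R]) (rule sc)
    moreover have "(\<Prod>b<3. ?R b ^ deg e b) = r ^ deg e 0 * s ^ deg e 1 * t ^ deg e 2" for e
      by (simp add: numeral_3_eq_3 numeral_2_eq_2)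
    ultimately show "P ?T' = r ^ deg e0 0 * s ^ deg e0 1 * t ^ deg e0 2 * P ?T"
      unfolding P_def sum_distrib_left by (intro sum.cong) auto
  qed
  moreover have "P (\<Phi> y) = 0" for y
  proof (rule ccontr)
    assume nz: "P (\<Phi> y) \<noteq> 0"
    define m where "m \<delta> = (\<Sum>e\<in>{e \<in> ?E. deg e = \<delta>}. c e * (\<Prod>j\<in>?J. xcoord j (\<Phi> y) ^ e j))" for \<delta>
    have ext: "deg ` ?E \<subseteq> extensional {..<3}" by (auto simp: deg_def)
    have "m (deg e0) \<noteq> 0" using nz by (simp add: m_def P_def)
    \<comment> \<open>The components \<open>m\<close> are the coefficients of a polynomial in the
      scaling factors. If one is nonzero, some rescaled member of the family violates the full
      relation.\<close>
    then obtain R where R: "(\<Sum>\<delta>\<in>deg ` ?E. m \<delta> * (\<Prod>b<3. R b ^ \<delta> b)) \<noteq> 0"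
      using nonzero_polynomial_nonvanishing[of "{..<3::nat}" "deg ` ?E" "deg e0" m] ext finE e0 by auto
    obtain y' where y': "\<And>b x. (b, x) \<in> ?J \<Longrightarrow> xcoord (b, x) (\<Phi> y') = R b * xcoord (b, x) (\<Phi> y)" using scale by blast
    have "0 = (\<Sum>e\<in>?E. c e * (\<Prod>j\<in>?J. xcoord j (\<Phi> y') ^ e j))"
      by (rule dep[rule_format, symmetric])
    also have "\<dots> = (\<Sum>e\<in>?E. c e * (\<Prod>j\<in>?J. xcoord j (\<Phi> y) ^ e j) * (\<Prod>b<3. R b ^ deg e b))"
      by (intro sum.cong) (simp_all add: monoscale[OF y'] mult_ac)
    also have "\<dots> = (\<Sum>\<delta>\<in>deg ` ?E. \<Sum>e\<in>{e \<in> ?E. deg e = \<delta>}. c e * (\<Prod>j\<in>?J. xcoord j (\<Phi> y) ^ e j) * (\<Prod>b<3. R b ^ deg e b))"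
      by (rule sum.image_gen[OF finE])
    also have "\<dots> = (\<Sum>\<delta>\<in>deg ` ?E. m \<delta> * (\<Prod>b<3. R b ^ \<delta> b))"
      unfolding m_def sum_distrib_right by (intro sum.cong) auto
    finally show False using R by simp
  qed
  moreover have "\<exists>T\<in>forms3 (d 0) (d 1) (d 2). P T \<noteq> 0"
  proof -
    have "?Edeg \<subseteq> extensional ?J" by (auto simp: PiE_def)
    then obtain X where X: "(\<Sum>e\<in>?Edeg. c e * (\<Prod>j\<in>?J. X j ^ e j)) \<noteq> 0"
      using nonzero_polynomial_nonvanishing[of ?J ?Edeg e0 c] finE e0 by auto
    \<comment> \<open>The triple whose coefficients are the prescribed values
      \<open>X\<close>.\<close>
    define G where "G b = form_of (d b) (\<lambda>x. X (b, x))" for b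
    have "xcoord j (G 0, G 1, G 2) = X j" if "j \<in> ?J" for j
      using that less_3_cases[of "fst j"] by (auto simp: form_idx_def xcoord_def G_def mcoeff_form_of idx3_def)
    then have "P (G 0, G 1, G 2) = (\<Sum>e\<in>?Edeg. c e * (\<Prod>j\<in>?J. X j ^ e j))"
      unfolding P_def by (intro sum.cong arg_cong2[of _ _ _ _ "(*)"] prod.cong) auto
    moreover have "(G 0, G 1, G 2) \<in> forms3 (d 0) (d 1) (d 2)" by (simp add: forms3_def G_def homogeneous_form_of)
    ultimately show ?thesis using X by (intro bexI[of _ "(G 0, G 1, G 2)"]) auto
  qed
  ultimately show ?thesis using that \<open>P \<in> coeff_polys\<close> by blast
qed

section \<open>Families of forms with polynomial coefficients\<close>

definition polyfam :: "'i set \<Rightarrow> (('i \<Rightarrow> complex) \<Rightarrow> poly3) \<Rightarrow> bool" where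
  "polyfam I F \<longleftrightarrow> (\<forall>i j k. (\<lambda>y. mcoeff (F y) i j k) \<in> polyfun I)"

lemma polyfun_sum: "(\<And>x. x \<in> A \<Longrightarrow> f x \<in> polyfun I) \<Longrightarrow> (\<lambda>y. \<Sum>x\<in>A. f x y) \<in> polyfun I"
  by (induction A rule: infinite_finite_induct) (auto intro: polyfun.const polyfun.add)

lemma mcoeff_mult:
  "mcoeff (F * G) i j k = (\<Sum>k'\<le>k. \<Sum>j'\<le>j. \<Sum>i'\<le>i. mcoeff F i' j' k' * mcoeff G (i - i') (j - j') (k - k'))"
  by (simp add: mcoeff_def coeff_mult coeff_sum)

lemma polyfam_mult: "polyfam I F \<Longrightarrow> polyfam I G \<Longrightarrow> polyfam I (\<lambda>y. F y * G y)"
  unfolding polyfam_def mcoeff_mult by (auto intro!: polyfun_sum polyfun.mult)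

lemma polyfam_add: "polyfam I F \<Longrightarrow> polyfam I G \<Longrightarrow> polyfam I (\<lambda>y. F y + G y)"
  unfolding polyfam_def by (auto intro!: polyfun.add)

lemma polyfam_const: "polyfam I (\<lambda>_. F)"
  unfolding polyfam_def by (auto intro!: polyfun.const)

lemma polyfam_mono3:
  assumes "f \<in> polyfun I" shows "polyfam I (\<lambda>y. mono3 i j k (f y))"
  unfolding polyfam_def mcoeff_mono
proof (intro allI)
  fix i' j' k'
  show "(\<lambda>y. if i' = i \<and> j' = j \<and> k' = k then f y else 0) \<in> polyfun I"
  proof (cases "i' = i \<and> j' = j \<and> k' = k")
    case False
    then have "(\<lambda>y. if i' = i \<and> j' = j \<and> k' = k then f y else 0) = (\<lambda>_. 0)" by auto
    then show ?thesis by (simp only: polyfun.const)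
  qed (use assms in simp)
qed

lemma const3_eq_mono3: "const3 c = mono3 0 0 0 c"
  by (rule eval3_ext) simp

lemma polyfam_const3: "f \<in> polyfun I \<Longrightarrow> polyfam I (\<lambda>y. const3 (f y))"
  unfolding const3_eq_mono3 by (rule polyfam_mono3)

lemma polyfam_diff: "polyfam I F \<Longrightarrow> polyfam I G \<Longrightarrow> polyfam I (\<lambda>y. F y - G y)"
  unfolding polyfam_def
proof (intro allI)
  fix i j k
  assume "\<forall>i j k. (\<lambda>y. mcoeff (F y) i j k) \<in> polyfun I" "\<forall>i j k. (\<lambda>y. mcoeff (G y) i j k) \<in> polyfun I"
  then have "(\<lambda>y. mcoeff (F y) i j k + (- 1) * mcoeff (G y) i j k) \<in> polyfun I"
    by (intro polyfun.add polyfun.mult polyfun.const) auto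
  then show "(\<lambda>y. mcoeff (F y - G y) i j k) \<in> polyfun I" by simp
qed

lemma polyfam_power: "polyfam I F \<Longrightarrow> polyfam I (\<lambda>y. F y ^ n)"
  by (induction n) (simp_all add: polyfam_const polyfam_mult)

subsection \<open>Triples of forms with a line meeting them in at most two points\<close>

text \<open>Two points of a line with homogeneous coordinates \<open>p = e\<^sub>i + a e\<^sub>j + b e\<^sub>k\<close> and
  \<open>q = c p + e\<^sub>j + d e\<^sub>k\<close>: in the basis \<open>p, q, e\<^sub>k\<close> the coordinates are the linear forms
  \<open>coordS\<close>, \<open>coordT\<close>, \<open>coordU\<close>.\<close>

definition coordT :: "3 \<Rightarrow> 3 \<Rightarrow> complex \<Rightarrow> poly3" where
  "coordT i j a = var3 j - const3 a * var3 i"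

definition coordS :: "3 \<Rightarrow> 3 \<Rightarrow> complex \<Rightarrow> complex \<Rightarrow> poly3" where
  "coordS i j a c = var3 i - const3 c * coordT i j a"

definition coordU :: "3 \<Rightarrow> 3 \<Rightarrow> 3 \<Rightarrow> complex \<Rightarrow> complex \<Rightarrow> complex \<Rightarrow> poly3" where
  "coordU i j k a b d = var3 k - const3 b * var3 i - const3 d * coordT i j a"

lemma homogeneous_coord: "homogeneous 1 (coordT i j a)" "homogeneous 1 (coordS i j a c)"
  unfolding coordS_def coordT_def
  by (intro homogeneous_diff homogeneous_const_mult homogeneous_var)+

lemma basis_expansion:
  assumes "i \<noteq> j" "i \<noteq> k" "j \<noteq> k"
    and p: "p = axis i 1 + a *s axis j 1 + b *s axis k 1" and q: "q = c *s p + axis j 1 + d *s axis k 1"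
  shows "x = eval3 (coordS i j a c) x *s p + eval3 (coordT i j a) x *s q + eval3 (coordU i j k a b d) x *s axis k 1"
  unfolding vec_eq_iff
proof
  fix l
  have "l = i \<or> l = j \<or> l = k" using index_cases[of i j k l] assms(1-3) by blast
  then show "x $ l = (eval3 (coordS i j a c) x *s p + eval3 (coordT i j a) x *s q + eval3 (coordU i j k a b d) x *s axis k 1) $ l"
    using assms(1-3) by (auto simp: p q coordS_def coordT_def coordU_def axis_def algebra_simps)
qed

lemma coordU_eq_lin:
  "coordU i j k a b d = lin (axis k 1 - b *s axis i 1 - d *s (axis j 1 - a *s axis i 1))"
proof (rule eval3_ext)
  have "dot (axis l c) v = c * v $ l" for l :: 3 and c v
    using three_cases[of l] by (auto simp: dot_def sum_3 axis_def)
  moreover have "dot (x - y) v = dot x v - dot y v" "dot (c *s x) v = c * dot x v" for x y v c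
    by (simp_all add: dot_def sum_3 algebra_simps)
  ultimately show "eval3 (coordU i j k a b d) v
      = eval3 (lin (axis k 1 - b *s axis i 1 - d *s (axis j 1 - a *s axis i 1))) v" for v
    by (simp add: coordU_def coordT_def, simp add: algebra_simps)
qed

lemma normalized_basis:
  assumes "p \<noteq> q"
  obtains i j k a b c d v w where "i \<noteq> j" "i \<noteq> k" "j \<noteq> k" "p = proj v" "q = proj w"
    "v = axis i 1 + a *s axis j 1 + b *s axis k 1" "w = c *s v + axis j 1 + d *s axis k 1"
proof -
  obtain v0 where v0: "v0 \<noteq> 0" "p = proj v0" by (rule proj_cases)
  obtain w0 where w0: "w0 \<noteq> 0" "q = proj w0" by (rule proj_cases)
  obtain i where i: "v0 $ i \<noteq> 0" using vec3_nonzero v0 by blast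
  define v where "v = (1 / v0 $ i) *s v0"
  have v: "p = proj v" "v $ i = 1" "v \<noteq> 0" using proj_scale[of "1 / v0 $ i" v0] v0 i by (auto simp: v_def)
  \<comment> \<open>Clearing coordinate \<open>i\<close> of \<open>w0\<close> leaves a nonzero
    vector, and its entry at some other \<open>j\<close> can be scaled to 1. The remaining freedom
    is the four numbers a, b, c, d.\<close>
  define u where "u = w0 - (w0 $ i) *s v"
  have "u \<noteq> 0"
  proof
    assume "u = 0"
    then have "w0 = (w0 $ i) *s v" by (simp add: u_def)
    moreover from this have "w0 $ i \<noteq> 0" using w0 by auto
    ultimately have "proj w0 = proj v" using proj_scale by metis
    then show False using assms v w0 by simp
  qed
  then obtain j where j: "u $ j \<noteq> 0" using vec3_nonzero by blast
  have "u $ i = 0" using v by (simp add: u_def)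
  then have ij: "i \<noteq> j" using j by auto
  then obtain k where k: "i \<noteq> k" "j \<noteq> k" using third_index[OF ij] by metis
  have ijk: "l = i \<or> l = j \<or> l = k" for l using index_cases[of i j k l] ij k by blast
  define w where "w = (1 / u $ j) *s w0"
  have w: "q = proj w" using proj_scale[of "1 / u $ j" w0] w0 j by (simp add: w_def)
  have "v = axis i 1 + (v $ j) *s axis j 1 + (v $ k) *s axis k 1"
    unfolding vec_eq_iff
  proof
    fix l show "v $ l = (axis i 1 + (v $ j) *s axis j 1 + (v $ k) *s axis k 1) $ l"
      using ijk[of l] v ij k by (auto simp: axis_def)
  qed
  moreover have "w = (w0 $ i / u $ j) *s v + axis j 1 + (u $ k / u $ j) *s axis k 1"
    unfolding vec_eq_iff
  proof
    fix l
    have "w $ l = (w0 $ i / u $ j) * v $ l + u $ l / u $ j"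
      using j by (simp add: w_def u_def diff_divide_distrib)
    then show "w $ l = ((w0 $ i / u $ j) *s v + axis j 1 + (u $ k / u $ j) *s axis k 1) $ l"
      using ijk[of l] \<open>u $ i = 0\<close> ij k j by (auto simp: axis_def)
  qed
  ultimately show ?thesis using that[OF ij k v(1) w] by blast
qed

text \<open>The cofactor may be replaced by its part of degree \<open>d\<close>, since its other
  parts contribute only in degrees other than \<open>d + 1\<close>. Its coefficients then fit the
  finite list of parameters.\<close>

lemma lin_quotient_homogeneous:
  assumes "homogeneous (Suc d) (lin a * G)"
  shows "lin a * G = lin a * form_of d (\<lambda>(i, j, k). mcoeff G i j k)"
proof (rule mcoeff_ext)
  let ?G = "form_of d (\<lambda>(i, j, k). mcoeff G i j k)"
  have mG: "mcoeff ?G i j k = (if i + j + k = d then mcoeff G i j k else 0)" for i j k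
    by (simp add: mcoeff_form_of)
  have l: "mcoeff (lin a * H) i j k = a $ 1 * (if i = 0 then 0 else mcoeff H (i - 1) j k)
     + a $ 2 * (if j = 0 then 0 else mcoeff H i (j - 1) k) + a $ 3 * (if k = 0 then 0 else mcoeff H i j (k - 1))" for H i j k
    by (simp add: lin_def sum_3 distrib_right mult.assoc mcoeff_var_mult)
  fix i j k
  show "mcoeff (lin a * G) i j k = mcoeff (lin a * ?G) i j k"
  proof (cases "i + j + k = Suc d")
    case True
    have "(if i = 0 then 0 else mcoeff ?G (i - 1) j k) = (if i = 0 then 0 else mcoeff G (i - 1) j k)"
      by (cases i) (use True mG in simp_all)
    moreover have "(if j = 0 then 0 else mcoeff ?G i (j - 1) k) = (if j = 0 then 0 else mcoeff G i (j - 1) k)"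
      by (cases j) (use True mG in simp_all)
    moreover have "(if k = 0 then 0 else mcoeff ?G i j (k - 1)) = (if k = 0 then 0 else mcoeff G i j (k - 1))"
      by (cases k) (use True mG in simp_all)
    ultimately show ?thesis unfolding l by simp
  next
    case False
    then have "mcoeff (lin a * G) i j k = 0" using assms unfolding homogeneous_def by blast
    moreover have "homogeneous (1 + d) (lin a * ?G)"
      by (intro homogeneous_mult homogeneous_lin homogeneous_form_of)
    then have "mcoeff (lin a * ?G) i j k = 0" using False unfolding homogeneous_def by auto
    ultimately show ?thesis by simp
  qed
qed

text \<open>Parameters: \<open>(3, n, 0, 0)\<close> for \<open>n < 4\<close> are the coordinates of the two points, \<open>(4, n, 0, 0)\<close>
  for \<open>n < 3\<close> are scalars, and the others are coefficients of forms of degree one less.\<close>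

definition param_idx :: "(nat \<Rightarrow> nat) \<Rightarrow> (nat \<times> nat \<times> nat \<times> nat) set" where
  "param_idx d = form_idx (\<lambda>b. d b - 1) \<union> {3} \<times> {..<4} \<times> {0} \<times> {0} \<union> {4} \<times> {..<3} \<times> {0} \<times> {0}"

text \<open>A form with the given monomial restriction to the line \<open>coordU = 0\<close> differs
  from that monomial by a multiple of \<open>coordU\<close>. The discrete data, namely the axes and
  the exponents \<open>m\<close>, form a separate argument, so that each family is polynomial in
  \<open>y\<close>.\<close>

definition fam_form :: "(nat \<Rightarrow> nat) \<Rightarrow> 3 \<times> 3 \<times> 3 \<times> (nat \<Rightarrow> nat) \<Rightarrow> nat \<Rightarrow> (nat \<times> nat \<times> nat \<times> nat \<Rightarrow> complex) \<Rightarrow> poly3" where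
  "fam_form d = (\<lambda>(i, j, k, m) b y.
     const3 (y (4, b, 0, 0)) * coordS i j (y (3, 0, 0, 0)) (y (3, 2, 0, 0)) ^ (d b - m b) *
       coordT i j (y (3, 0, 0, 0)) ^ m b +
     coordU i j k (y (3, 0, 0, 0)) (y (3, 1, 0, 0)) (y (3, 3, 0, 0)) *
       form_of (d b - 1) (\<lambda>x. y (b, x)))"

definition fam :: "(nat \<Rightarrow> nat) \<Rightarrow> 3 \<times> 3 \<times> 3 \<times> (nat \<Rightarrow> nat) \<Rightarrow> (nat \<times> nat \<times> nat \<times> nat \<Rightarrow> complex) \<Rightarrow> poly3 \<times> poly3 \<times> poly3" where
  "fam d \<kappa> y = (fam_form d \<kappa> 0 y, fam_form d \<kappa> 1 y, fam_form d \<kappa> 2 y)"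

lemma polyfam_fam_form: "b < 3 \<Longrightarrow> polyfam (param_idx d) (fam_form d \<kappa> b)"
proof -
  assume b: "b < 3"
  obtain i j k m where \<kappa>: "\<kappa> = (i, j, k, m)" by (cases \<kappa>)
  have y3: "(\<lambda>y. y (3, n, 0, 0)) \<in> polyfun (param_idx d)" if "n < 4" for n
    by (rule polyfun.coord) (use that in \<open>simp add: param_idx_def\<close>)
  have y4: "(\<lambda>y. y (4, b, 0, 0)) \<in> polyfun (param_idx d)"
    by (rule polyfun.coord) (use b in \<open>simp add: param_idx_def\<close>)
  have T: "polyfam (param_idx d) (\<lambda>y. coordT i j (y (3, 0, 0, 0)))"
    unfolding coordT_def by (intro polyfam_diff polyfam_mult polyfam_const polyfam_const3 y3) simp
  have S: "polyfam (param_idx d) (\<lambda>y. coordS i j (y (3, 0, 0, 0)) (y (3, 2, 0, 0)))"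
    unfolding coordS_def by (intro polyfam_diff polyfam_mult polyfam_const polyfam_const3 y3 T) simp
  have U: "polyfam (param_idx d) (\<lambda>y. coordU i j k (y (3, 0, 0, 0)) (y (3, 1, 0, 0)) (y (3, 3, 0, 0)))"
    unfolding coordU_def by (intro polyfam_diff polyfam_mult polyfam_const polyfam_const3 y3 T) simp_all
  have "polyfam (param_idx d) (\<lambda>y. form_of (d b - 1) (\<lambda>x. y (b, x)))"
    unfolding polyfam_def mcoeff_form_of
  proof (intro allI)
    fix i j k
    show "(\<lambda>y. if i + j + k = d b - 1 then y (b, i, j, k) else 0) \<in> polyfun (param_idx d)"
      using b by (cases "i + j + k = d b - 1") (auto simp: param_idx_def form_idx_def idx3_def intro: polyfun.coord polyfun.const)
  qed
  then show ?thesis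
    unfolding fam_form_def \<kappa> prod.case
    by (intro polyfam_add polyfam_mult polyfam_power polyfam_const3 S T U y4)
qed

text \<open>Rescaling one form changes its scalar and its cofactor but not the two points shared by
  all three.\<close>

lemma fam_form_scale:
  assumes "b < 3"
  shows "fam_form d \<kappa> b (\<lambda>(c, x). if c < 3 then R c * y (c, x) else if c = 4 then R (fst x) * y (c, x) else y (c, x))
      = const3 (R b) * fam_form d \<kappa> b y"
  by (rule eval3_ext)
    (cases \<kappa>, use assms in \<open>simp add: fam_form_def form_of_def algebra_simps sum_distrib_left case_prod_unfold\<close>)

text \<open>The exponents with positive last entry come from degree \<open>d\<close>; those with
  last entry 0 number d + 2.\<close>

lemma card_idx3_Suc: "card (idx3 (Suc d)) = card (idx3 d) + (d + 2)"
proof -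
  let ?A = "(\<lambda>(i, j, k). (i, j, Suc k)) ` idx3 d" and ?B = "(\<lambda>i. (i, Suc d - i, 0::nat)) ` {..Suc d}"
  have "idx3 (Suc d) \<subseteq> ?A \<union> ?B"
  proof
    fix x assume x: "x \<in> idx3 (Suc d)"
    obtain i j k where ijk: "x = (i, j, k)" by (cases x)
    show "x \<in> ?A \<union> ?B"
    proof (cases k)
      case 0
      then have "x = (i, Suc d - i, 0)" "i \<le> Suc d" using x ijk by (auto simp: idx3_def)
      then show ?thesis by auto
    next
      case (Suc k')
      then have "(i, j, k') \<in> idx3 d" "x = (\<lambda>(i, j, k). (i, j, Suc k)) (i, j, k')" using x ijk by (auto simp: idx3_def)
      then show ?thesis by blast
    qed
  qed
  moreover have "?A \<union> ?B \<subseteq> idx3 (Suc d)" by (auto simp: idx3_def)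
  ultimately have e: "idx3 (Suc d) = ?A \<union> ?B" by blast
  have "card ?A = card (idx3 d)" by (rule card_image) (auto simp: inj_on_def)
  moreover have "card ?B = d + 2" by (subst card_image) (auto simp: inj_on_def)
  moreover have "?A \<inter> ?B = {}" by auto
  ultimately show ?thesis unfolding e by (subst card_Un_disjoint) auto
qed

text \<open>Lowering the degrees loses d 0 + d 1 + d 2 + 3 coefficients, at least 8, while only 4 +
  3 parameters are added.\<close>

lemma card_param_idx:
  assumes "\<And>b. b < 3 \<Longrightarrow> 1 \<le> d b" "5 \<le> d 0 + d 1 + d 2"
  shows "finite (param_idx d)" "card (param_idx d) < card (form_idx d)"
proof -
  show "finite (param_idx d)" by (simp add: param_idx_def)
  have c: "card (form_idx d) = card (idx3 (d 0)) + card (idx3 (d 1)) + card (idx3 (d 2))" for d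
    by (simp add: form_idx_def numeral_3_eq_3 numeral_2_eq_2)
  have s: "card (idx3 (d b)) = card (idx3 (d b - 1)) + (d b + 1)" if "b < 3" for b
    using card_idx3_Suc[of "d b - 1"] assms(1)[OF that] by simp
  have "card (param_idx d) \<le> card (form_idx (\<lambda>b. d b - 1)) + 4 + 3"
    unfolding param_idx_def
    by (rule order.trans[OF order.trans[OF card_Un_le add_right_mono[OF card_Un_le]]])
      (simp add: card_cartesian_product)
  then show "card (param_idx d) < card (form_idx d)"
    unfolding c[of d] c[of "\<lambda>b. d b - 1"] using s[of 0] s[of 1] s[of 2] assms(2) by simp
qed

lemma ex_vanishing_on_fam:
  assumes "\<And>b. b < 3 \<Longrightarrow> 1 \<le> d b" "5 \<le> d 0 + d 1 + d 2"
  obtains P where "P \<in> coeff_polys" "multihomogeneous P" "\<And>y. P (fam d \<kappa> y) = 0"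
    "\<exists>T\<in>forms3 (d 0) (d 1) (d 2). P T \<noteq> 0"
proof (rule ex_multihomogeneous_vanishing[OF card_param_idx[OF assms], where \<Phi> = "fam d \<kappa>"])
  have comp: "comp3 b (fam d \<kappa> y) = fam_form d \<kappa> b y" if "b < 3" for b y
    using less_3_cases[OF that] by (auto simp: fam_def)
  fix x assume x: "x \<in> form_idx d"
  obtain b i j k where b: "x = (b, i, j, k)" by (cases x)
  then have "b < 3" using x by (auto simp: form_idx_def)
  then show "(\<lambda>y. xcoord x (fam d \<kappa> y)) \<in> polyfun (param_idx d)"
    using polyfam_fam_form unfolding polyfam_def by (simp add: b xcoord_def comp)
next
  have comp: "comp3 b (fam d \<kappa> y) = fam_form d \<kappa> b y" if "b < 3" for b y
    using less_3_cases[OF that] by (auto simp: fam_def)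
  fix y :: "nat \<times> nat \<times> nat \<times> nat \<Rightarrow> complex" and R :: "nat \<Rightarrow> complex"
  show "\<exists>y'. \<forall>b x. (b, x) \<in> form_idx d \<longrightarrow> xcoord (b, x) (fam d \<kappa> y') = R b * xcoord (b, x) (fam d \<kappa> y)"
    by (rule exI[of _ "\<lambda>(c, x). if c < 3 then R c * y (c, x) else if c = 4 then R (fst x) * y (c, x) else y (c, x)"])
      (auto simp: form_idx_def xcoord_def comp fam_form_scale)
qed (rule that | assumption)+

text \<open>After subtracting the monomial in \<open>coordS\<close> and \<open>coordT\<close>, the
  form vanishes where \<open>coordU\<close> does, so the linear form \<open>coordU\<close> divides
  the difference.\<close>

lemma form_in_fam:
  assumes F: "homogeneous d F" "1 \<le> d" and ijk: "i \<noteq> j" "i \<noteq> k" "j \<noteq> k"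
    and v: "v = axis i 1 + a *s axis j 1 + b *s axis k 1" and w: "w = c *s v + axis j 1 + e *s axis k 1"
    and al: "along F v w = monom r m" "m \<le> d"
  obtains g where "F = const3 r * coordS i j a c ^ (d - m) * coordT i j a ^ m + coordU i j k a b e * form_of (d - 1) g"
proof -
  \<comment> \<open>For \<open>s = 0\<close> the value is the coefficient of degree
    \<open>d\<close>, which agrees with the formula because \<open>0 ^ 0 = 1\<close>.\<close>
  have ev: "eval3 F (s *s v + t *s w) = r * s ^ (d - m) * t ^ m" for s t
  proof (cases "s = 0")
    case True
    have "eval3 F w = (if m = d then r else 0)" using coeff_along_top[OF F(1), of v w] al by simp
    then show ?thesis using True al(2) by (auto simp: eval3_scale[OF F(1)] power_0_left)
  next
    case False
    have "s *s v + t *s w = s *s (v + (t / s) *s w)" using False by (simp add: vec_eq_iff algebra_simps)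
    then have "eval3 F (s *s v + t *s w) = s ^ d * poly (along F v w) (t / s)"
      by (simp only: eval3_scale[OF F(1)] poly_along)
    also have "\<dots> = r * (s ^ d / s ^ m) * t ^ m" using al by (simp add: poly_monom power_divide)
    also have "s ^ d / s ^ m = s ^ (d - m)" using False al(2) by (simp add: power_diff)
    finally show ?thesis .
  qed
  define M where "M = const3 r * coordS i j a c ^ (d - m) * coordT i j a ^ m"
  have "homogeneous (1 * (d - m) + 1 * m) (const3 r * (coordS i j a c ^ (d - m) * coordT i j a ^ m))"
    by (intro homogeneous_const_mult homogeneous_mult homogeneous_power homogeneous_coord)
  then have hM: "homogeneous d M" using al(2) by (simp add: M_def mult.assoc)
  obtain u where u: "coordU i j k a b e = lin u" using coordU_eq_lin by blast
  have "eval3 (lin u) (axis k 1) = 1"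
    using ijk by (simp flip: u add: coordU_def coordT_def axis_def)
  then have u0: "u \<noteq> 0" by (auto simp: dot_def)
  have "lin u dvd F - M"
    unfolding lin_dvd_iff[OF u0]
  proof (intro allI impI)
    fix x assume "dot u x = 0"
    then have "eval3 (coordU i j k a b e) x = 0" by (simp add: u)
    then have x: "x = eval3 (coordS i j a c) x *s v + eval3 (coordT i j a) x *s w"
      using basis_expansion[OF ijk v w, of x] by simp
    have "eval3 F x = r * eval3 (coordS i j a c) x ^ (d - m) * eval3 (coordT i j a) x ^ m"
      by (subst x) (rule ev)
    then show "eval3 (F - M) x = 0" by (simp add: M_def)
  qed
  then obtain G where G: "F - M = lin u * G" by blast
  have "homogeneous d (F - M)" by (rule homogeneous_diff[OF F(1) hM])
  then have "homogeneous (Suc (d - 1)) (lin u * G)" using F(2) G by simp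
  then have "F - M = lin u * form_of (d - 1) (\<lambda>(i, j, k). mcoeff G i j k)"
    unfolding G by (rule lin_quotient_homogeneous)
  then have "F = M + coordU i j k a b e * form_of (d - 1) (\<lambda>(i, j, k). mcoeff G i j k)"
    unfolding u by (simp add: diff_eq_eq add.commute)
  then show ?thesis using that unfolding M_def by blast
qed

text \<open>A line may meet the curve in fewer than two points; arbitrary further points of it then
  complete the pair.\<close>

lemma ex_two_points_of_line:
  assumes "is_line C" "finite X" "card X \<le> 2" "X \<subseteq> C"
  obtains p q where "p \<noteq> q" "p \<in> C" "q \<in> C" "X \<subseteq> {p, q}"
proof -
  have "\<exists>Y. X \<subseteq> Y \<and> Y \<subseteq> C \<and> card Y = 2"
  proof -
    obtain B where B: "finite B" "card B = 2 - card X" "B \<subseteq> C - X"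
      using infinite_arbitrarily_large[of "C - X" "2 - card X"] infinite_line[OF assms(1)] assms(2) by auto
    then have "card (X \<union> B) = 2" using assms(2,3) by (subst card_Un_disjoint) auto
    then show ?thesis using B assms(4) by (intro exI[of _ "X \<union> B"]) auto
  qed
  then obtain Y where Y: "X \<subseteq> Y" "Y \<subseteq> C" "card Y = 2" by blast
  then obtain p q where "Y = {p, q}" "p \<noteq> q" by (meson card_2_iff)
  then show ?thesis using that Y by auto
qed

lemma meeting_twice_in_fam:
  assumes d: "\<And>b. b < 3 \<Longrightarrow> 1 \<le> d b" and T: "T \<in> forms3 (d 0) (d 1) (d 2)"
    and C: "C \<in> lines_meeting_twice (\<Union>b<3. zeros (comp3 b T))"
  obtains i j k m y where "m \<in> PiE {..<3} (\<lambda>b. {..d b})" "T = fam d (i, j, k, m) y"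
proof -
  let ?B = "\<Union>b<3. zeros (comp3 b T)"
  have L: "is_line C" "finite (C \<inter> ?B)" "card (C \<inter> ?B) \<le> 2" using C by (auto simp: lines_meeting_twice_def)
  have hom: "homogeneous (d b) (comp3 b T)" if "b < 3" for b
    using T less_3_cases[OF that] by (cases T) (auto simp: forms3_def)
  obtain p q where pq: "p \<noteq> q" "p \<in> C" "q \<in> C" "C \<inter> ?B \<subseteq> {p, q}"
    using ex_two_points_of_line[OF L] by blast
  obtain i j k a b0 c e v w where ijk: "i \<noteq> j" "i \<noteq> k" "j \<noteq> k" and vw: "p = proj v" "q = proj w"
    and v: "v = axis i 1 + a *s axis j 1 + b0 *s axis k 1" and w: "w = c *s v + axis j 1 + e *s axis k 1"
    using normalized_basis[OF pq(1)] by metis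
  have "v $ i = 1" using ijk by (simp add: v axis_def)
  then have v0: "v \<noteq> 0" by auto
  have "w $ i = c * v $ i" "w $ j = c * v $ j + 1" using ijk by (simp_all add: w axis_def)
  then have w0: "w \<noteq> 0" using \<open>v $ i = 1\<close> by auto
  have ind: "indep v w" using indep_iff_proj[OF v0 w0] pq(1) vw by simp
  have Cs: "C = span2 v w" using line_eq_span2[OF L(1) ind] pq vw by simp
  \<comment> \<open>The guard \<open>b < 3\<close> makes a solution exist for every natural number
    \<open>b\<close>, so that choice applies.\<close>
  define R where "R b r m G \<longleftrightarrow> (b < 3 \<longrightarrow> m \<le> d b \<and> comp3 b T =
    const3 r * coordS i j a c ^ (d b - m) * coordT i j a ^ m + coordU i j k a b0 e * form_of (d b - 1) G)" for b r m G
  have "\<exists>r m G. R b r m G" for b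
  proof (cases "b < 3")
    case b: True
    have sub: "C \<inter> zeros (comp3 b T) \<subseteq> {p, q}" using pq(4) b by blast
    have ns: "\<not> C \<subseteq> zeros (comp3 b T)"
    proof
      assume "C \<subseteq> zeros (comp3 b T)"
      then have "C \<subseteq> {p, q}" using sub by blast
      then show False using infinite_line[OF L(1)] finite_subset by blast
    qed
    obtain r m where rm: "r \<noteq> 0" "m \<le> d b" "along (comp3 b T) v w = monom r m"
      using along_eq_monom[OF hom[OF b] ind ns[unfolded Cs] sub[unfolded Cs vw]] .
    obtain G where "comp3 b T = const3 r * coordS i j a c ^ (d b - m) * coordT i j a ^ m + coordU i j k a b0 e * form_of (d b - 1) G"
      using form_in_fam[OF hom[OF b] d[OF b] ijk v w rm(3,2)] .
    then have "R b r m G" using rm(2) by (simp add: R_def)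
    then show ?thesis by blast
  qed (simp add: R_def)
  then have "\<forall>b. \<exists>r m G. R b r m G" by blast
  from choice[OF this] obtain r where "\<forall>b. \<exists>m G. R b (r b) m G" by blast
  from choice[OF this] obtain m where "\<forall>b. \<exists>G. R b (r b) (m b) G" by blast
  from choice[OF this] obtain G where G: "\<And>b. R b (r b) (m b) (G b)" by blast
  have rmG: "m b \<le> d b" "comp3 b T = const3 (r b) * coordS i j a c ^ (d b - m b) *
     coordT i j a ^ m b + coordU i j k a b0 e * form_of (d b - 1) (G b)"
    if "b < 3" for b using G[of b] that unfolding R_def by blast+
  define y where "y = (\<lambda>(c', n, n2, n3). if c' = 3 then (if n = 0 then a else if n = 1 then b0 else if n = 2 then c else e)
     else if c' = 4 then r n else G c' (n, n2, n3))"
  let ?m = "restrict m {..<3}"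
  have "fam_form d (i, j, k, ?m) b y = comp3 b T" if "b < 3" for b
    using that rmG(2)[OF that] by (simp add: fam_form_def y_def)
  then have "fam d (i, j, k, ?m) y = T"
    unfolding fam_def by (cases T) (simp add: comp3_def)
  moreover have "?m \<in> PiE {..<3} (\<lambda>b. {..d b})" using rmG(1) by auto
  ultimately show ?thesis using that by blast
qed

lemma multihomogeneous_mult: "multihomogeneous P \<Longrightarrow> multihomogeneous Q \<Longrightarrow> multihomogeneous (\<lambda>T. P T * Q T)"
proof -
  assume "multihomogeneous P" "multihomogeneous Q"
  then obtain l m n l' m' n' where
    P: "\<And>r s t F1 F2 F3. P (smult [:[:r:]:] F1, smult [:[:s:]:] F2, smult [:[:t:]:] F3) = r ^ l * s ^ m * t ^ n * P (F1, F2, F3)"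
    and Q: "\<And>r s t F1 F2 F3. Q (smult [:[:r:]:] F1, smult [:[:s:]:] F2, smult [:[:t:]:] F3) = r ^ l' * s ^ m' * t ^ n' * Q (F1, F2, F3)"
    unfolding multihomogeneous_def by metis
  show ?thesis
    unfolding multihomogeneous_def
    by (rule exI[of _ "l + l'"], rule exI[of _ "m + m'"], rule exI[of _ "n + n'"])
      (simp add: P Q power_add mult_ac)
qed

theorem generic_no_line:
  assumes "1 \<le> b1" "1 \<le> b2" "1 \<le> b3" "5 \<le> b1 + b2 + b3"
  shows "\<exists>U. open_dense (zariski_triples b1 b2 b3) U \<and>
    (\<forall>(F1, F2, F3)\<in>U. lines_meeting_twice (union3 F1 F2 F3) = {})"
proof -
  define d where "d b = (if b = 0 then b1 else if b = 1 then b2 else b3)" for b :: nat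
  have d: "d 0 = b1" "d 1 = b2" "d 2 = b3" "\<And>b. 1 \<le> d b" using assms by (auto simp: d_def)
  have sum: "5 \<le> d 0 + d 1 + d 2" using assms d by simp
  have "\<exists>P\<in>coeff_polys. multihomogeneous P \<and> (\<exists>T\<in>forms3 b1 b2 b3. P T \<noteq> 0) \<and> (\<forall>\<kappa>\<in>A. \<forall>y. P (fam d \<kappa> y) = 0)"
    if "finite A" for A
    using that
  proof (induction A rule: finite_induct)
    case empty
    have "multihomogeneous (\<lambda>_. 1)"
      unfolding multihomogeneous_def by (rule exI[of _ 0], rule exI[of _ 0], rule exI[of _ 0]) simp
    moreover have "(0, 0, 0) \<in> forms3 b1 b2 b3" by (simp add: forms3_def)
    ultimately show ?case by (intro bexI[OF _ coeff_polys.const[of 1]]) auto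
  next
    case (insert \<kappa> A)
    then obtain P where P: "P \<in> coeff_polys" "multihomogeneous P" "\<exists>T\<in>forms3 b1 b2 b3. P T \<noteq> 0"
      "\<forall>\<kappa>\<in>A. \<forall>y. P (fam d \<kappa> y) = 0" by blast
    obtain Q where Q: "Q \<in> coeff_polys" "multihomogeneous Q" "\<And>y. Q (fam d \<kappa> y) = 0"
      "\<exists>T\<in>forms3 (d 0) (d 1) (d 2). Q T \<noteq> 0" using ex_vanishing_on_fam[OF d(4) sum] by blast
    obtain T0 where T0: "T0 \<in> forms3 b1 b2 b3" "P T0 \<noteq> 0" using P(3) by blast
    obtain T1 where T1: "T1 \<in> forms3 b1 b2 b3" "Q T1 \<noteq> 0" using Q(4) d(1-3) by auto
    obtain T where "T \<in> forms3 b1 b2 b3" "P T \<noteq> 0" "Q T \<noteq> 0"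
      using common_nonvanishing[OF P(1) T0 Q(1) T1] .
    then show ?case
      using coeff_polys.mult[OF P(1) Q(1)] multihomogeneous_mult[OF P(2) Q(2)] P(4) Q(3)
      by (intro bexI[OF _ coeff_polys.mult[OF P(1) Q(1)]]) auto
  qed
  \<comment> \<open>There are finitely many families, one for each choice of axes and exponents, so
    a single product of polynomials vanishes on all of them.\<close>
  moreover have "finite (UNIV \<times> UNIV \<times> UNIV \<times> PiE {..<3} (\<lambda>b. {..d b}) :: (3 \<times> 3 \<times> 3 \<times> (nat \<Rightarrow> nat)) set)"
    by (intro finite_cartesian_product finite_PiE) auto
  ultimately obtain P where P: "P \<in> coeff_polys" "multihomogeneous P" "\<exists>T\<in>forms3 b1 b2 b3. P T \<noteq> 0"
    and van: "\<forall>\<kappa>\<in>UNIV \<times> UNIV \<times> UNIV \<times> PiE {..<3} (\<lambda>b. {..d b}). \<forall>y. P (fam d \<kappa> y) = 0"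
    by blast
  have van: "P (fam d (i, j, k, m) y) = 0" if "m \<in> PiE {..<3} (\<lambda>b. {..d b})" for i j k m y
  proof -
    have "(i, j, k, m) \<in> UNIV \<times> UNIV \<times> UNIV \<times> PiE {..<3} (\<lambda>b. {..d b})" using that by simp
    then show ?thesis using van by blast
  qed
  let ?U = "{T \<in> triples b1 b2 b3. P T \<noteq> 0}"
  have "open_dense (zariski_triples b1 b2 b3) ?U" using open_dense_nonvanishing[OF P(1,2)] P(3) by blast
  moreover have "lines_meeting_twice (union3 F1 F2 F3) = {}" if U: "(F1, F2, F3) \<in> ?U" for F1 F2 F3
  proof (rule ccontr)
    assume "lines_meeting_twice (union3 F1 F2 F3) \<noteq> {}"
    then obtain C where C: "C \<in> lines_meeting_twice (union3 F1 F2 F3)" by blast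
    have "union3 F1 F2 F3 = (\<Union>b<3. zeros (comp3 b (F1, F2, F3)))"
      by (simp add: union3_def numeral_3_eq_3 lessThan_Suc comp3_def Un_ac)
    then have C': "C \<in> lines_meeting_twice (\<Union>b<3. zeros (comp3 b (F1, F2, F3)))" using C by simp
    have T: "(F1, F2, F3) \<in> forms3 (d 0) (d 1) (d 2)" using U triples_subset d(1-3) by auto
    obtain i j k m y where "m \<in> PiE {..<3} (\<lambda>b. {..d b})" "(F1, F2, F3) = fam d (i, j, k, m) y"
      using meeting_twice_in_fam[OF d(4) T C'] by metis
    then show False using van[of m i j k y] U by simp
  qed
  ultimately show ?thesis by blast
qed

section \<open>The theorem for a curve given by three equations\<close>

definition triple3 :: "'a \<Rightarrow> 'a \<Rightarrow> 'a \<Rightarrow> 3 \<Rightarrow> 'a" where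
  "triple3 x y z i = (if i = 1 then x else if i = 2 then y else z)"

lemma triple3_simps [simp]: "triple3 x y z 1 = x" "triple3 x y z 2 = y" "triple3 x y z 3 = z"
  by (simp_all add: triple3_def)

lemma three_C_curve_locale:
  assumes C: "three_C_curve b1 b2 b3 F1 F2 F3" and b: "1 \<le> b1" "1 \<le> b2" "1 \<le> b3"
  shows "three_curves (triple3 b1 b2 b3) (triple3 F1 F2 F3)"
proof
  let ?b = "triple3 b1 b2 b3" and ?F = "triple3 F1 F2 F3"
  fix i j :: 3 and p
  show "homogeneous (?b i) (?F i)" "1 \<le> ?b i"
    using C b by (simp_all add: three_C_curve_def triple3_def)
  show irr: "irreducible (?F i)" using C by (simp add: three_C_curve_def triple3_def)
  assume ij: "i \<noteq> j"
  show "node (?F 1 * ?F 2 * ?F 3) p" if "p \<in> zeros (?F i)" "p \<in> zeros (?F j)"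
  proof -
    have "p \<in> crossings F1 F2 F3"
      using that ij three_cases[of i] three_cases[of j] by (auto simp: crossings_def)
    then show ?thesis using C by (simp add: three_C_curve_def)
  qed
  show "\<not> ?F i dvd ?F j"
  proof
    assume "?F i dvd ?F j"
    \<comment> \<open>Otherwise the square of \<open>?F i\<close> would divide the squarefree
      product.\<close>
    then have "?F i * ?F i dvd ?F i * ?F j" by (intro mult_dvd_mono) auto
    also have "?F i * ?F j dvd F1 * F2 * F3"
      using ij three_cases[of i] three_cases[of j] by (auto simp: mult_ac intro: dvd_triv_left dvd_triv_right dvd_mult)
    finally have "?F i dvd 1"
      using C unfolding three_C_curve_def squarefree_def power2_eq_square by blast
    then show False using irr irreducible_not_unit by blast
  qed
qed

lemma Hyp_union3: "Hyp 1 (union3 F1 F2 F3) 2 = lines_meeting_twice (\<Union>i. zeros (triple3 F1 F2 F3 i))"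
  unfolding Hyp_1_2_eq by (simp add: union3_def UNIV_3 Un_assoc)

theorem proposition3p2p1:
  fixes b1 b2 b3 :: nat
  assumes "1 \<le> b1" "b1 \<le> b2" "b2 \<le> b3" "4 \<le> b1 + b2 + b3"
  shows
    "(\<forall>F1 F2 F3. three_C_curve b1 b2 b3 F1 F2 F3 \<longrightarrow>
        (let B1 = zeros F1; B2 = zeros F2; B3 = zeros F3;
             B = union3 F1 F2 F3; N = crossings F1 F2 F3;
             Chords = {C. is_line C \<and> C \<noteq> B1 \<and> C \<noteq> B2 \<and>
               (\<exists>p\<in>B3 \<inter> (B1 \<union> B2). \<exists>q\<in>B3 \<inter> (B1 \<union> B2). p \<noteq> q \<and> p \<in> C \<and> q \<in> C)};
             Tangents = {C. is_line C \<and> (\<exists>p. smooth_point F3 p \<and> C = tangent_line F3 p) \<and>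
               C \<inter> N \<noteq> {}}
         in (b1 + b2 + b3 = 4 \<longrightarrow>
               card (Hyp 1 B 2) = 10 \<and>
               (\<forall>C. C \<in> Hyp 1 B 2 \<longleftrightarrow> C \<in> Chords \<or> C \<in> Tangents) \<and>
               card Chords = 4 \<and> card Tangents = 6) \<and>
            (b1 + b2 + b3 \<ge> 5 \<longrightarrow>
               finite (Hyp 1 B 2) \<and>
               (if b1 = 1 \<and> b2 = 1 then card (Hyp 1 B 2) \<le> 3 * b3 * (b3 - 2)
                else card (Hyp 1 B 2) \<le> 2 * card N)))) \<and>
     (b1 + b2 + b3 \<ge> 5 \<longrightarrow>
        (\<exists>U. open_dense (zariski_triples b1 b2 b3) U \<and>
           (\<forall>(F1, F2, F3)\<in>U. three_C_curve b1 b2 b3 F1 F2 F3 \<longrightarrow>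
              Hyp 1 (union3 F1 F2 F3) 2 = {})))"
  apply (intro conjI impI allI)
  subgoal premises C for F1 F2 F3
  proof -
    let ?b = "triple3 b1 b2 b3" and ?F = "triple3 F1 F2 F3"
    interpret three_curves ?b ?F by (rule three_C_curve_locale[OF C]) (use assms in auto)
    have N: "crossings F1 F2 F3 = N" by (simp add: N_def crossings_def)
    \<comment> \<open>The total degree is at least 4, which leaves degree at least 2 for the third
      component.\<close>
    have two_lines: "two_lines_and_curve ?b ?F" if "b1 = 1" "b2 = 1"
      by unfold_locales (use that assms in simp_all)
    show ?thesis
    proof (cases "b1 + b2 + b3 = 4")
      case True
      then have e: "b1 = 1" "b2 = 1" "b3 = 2" using assms by auto
      interpret two_lines_and_curve ?b ?F by (rule two_lines[OF e(1,2)])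
      interpret two_lines_and_conic ?b ?F by unfold_locales (use e in simp)
      note Chords_Tangents = Chords_def[unfolded triple3_simps] Tangents_def[unfolded triple3_simps]
      show ?thesis
        unfolding Let_def N Hyp_union3 Chords_Tangents[symmetric]
        using card_meeting_twice_conic meeting_twice_conic card_Chords card_Tangents True by simp
    next
      case False
      then have b5: "b1 + b2 + b3 \<ge> 5" using assms by simp
      have "finite H \<and> (if b1 = 1 \<and> b2 = 1 then card H \<le> 3 * b3 * (b3 - 2) else card H \<le> 2 * card N)"
      proof (cases "b1 = 1 \<and> b2 = 1")
        case True
        interpret two_lines_and_curve ?b ?F using two_lines True by blast
        show ?thesis using meeting_twice_cubic_or_more True b5 by simp
      next
        case False
        \<comment> \<open>Since \<open>b1 \<le> b2\<close>, the degree of the second component is 1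
          only if both are 1.\<close>
        then have "2 \<le> b2" "2 \<le> b3" using assms by auto
        then show ?thesis using meeting_twice_nodal_tangents False by simp
      qed
      then show ?thesis unfolding Let_def N Hyp_union3 using False by blast
    qed
  qed
  subgoal
    using generic_no_line[of b1 b2 b3] assms unfolding Hyp_1_2_eq by fastforce
  done

end
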